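(* Let $\mathfrak g'$ be a simply-laced simple Lie algebra with a diagram automorphism $\sigma$ and $\mathfrak g=(\mathfrak g')^\sigma$, as specified in the context; let $I'$ and $I=I'/\langle\sigma\rangle$ be the vertex sets of their Dynkin diagrams, and let $t\in\mathbb C^\times$ not be a root of unity. Then there is a surjective ring homomorphism $\operatorname{Rep}_zU_t(\widehat{\mathfrak g'})\to\mathcal K_t^-(\mathfrak g)$ fitting into a commutative diagram $$\begin{array}{ccc}\operatorname{Rep}_zU_t(\widehat{\mathfrak g'})&\xrightarrow{\ \sim\ }&\displaystyle\bigcap_{i\in I'}\mathbb C[Y_j(zt^{n})^{\pm1}]_{j\in I'\setminus\{i\},n\in\mathbb Z}\otimes\mathbb C[Y_i(zt^{n})(1+A_i(zt^{n+1})^{-1})]_{n\in\mathbb Z}\\ \downarrow&&\downarrow\\ \mathcal K_t^-(\mathfrak g)&\xrightarrow{\ \sim\ }&\displaystyle\bigcap_{i\in I}\mathbb C[Y_j(zt^{n})^{\pm1}]_{j\in I\setminus\{i\},n\in\mathbb Z}\otimes\mathbb C[Y_i(zt^{n})(1+A_i(zt^{n+1})^{-1})]_{n\in\mathbb Z}\end{array}$$ in which the top arrow is the $t$-character isomorphism, the bottom arrow is the identification of $\mathcal K_t^-(\mathfrak g)$ with this intersection, and the right vertical arrow is induced by the substitution $Y_i(zt^n)\mapsto Y_{\bar i}(zt^n)$, $i\in I'$, where $\bar i\in I$ is the $\sigma$-orbit of $i$ (i.e. by identifying $Y_i(zt^n)$ with $Y_{\sigma(i)}(zt^n)$).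
   Context: $(\mathfrak g',\mathfrak g)$ is one of: $(A_{2\ell-1},C_\ell)$, $(D_{\ell+1},B_\ell)$, $(E_6,F_4)$ with $\sigma$ of order $2$, or $(D_4,G_2)$ with $\sigma$ of order $3$ (or $\mathfrak g=\mathfrak g'$ simply-laced, $\sigma=\mathrm{id}$); $\mathfrak g$ is the Lie subalgebra of $\sigma$-invariants. For a simple Lie algebra with Cartan matrix $C_{ij}=2(\alpha_i,\alpha_j)/(\alpha_i,\alpha_i)$ put $I_{ij}=2\delta_{ij}-C_{ij}$ and, in the Laurent polynomial algebra $\mathbb C[Y_j(zt^n)^{\pm1}]$ with $j$ running over the vertices and $n\in\mathbb Z$ ($z$ a formal symbol), $$A_i(zt^n)=Y_i(zt^{n+1})Y_i(zt^{n-1})\prod_{j\ne i}Y_j(zt^n)^{-I_{ji}}.$$ This is used for $\mathfrak g'$ in the top row and for $\mathfrak g$ in the bottom row. $\mathcal K_t^-(\mathfrak g)=\bigcap_{i\in I}\operatorname{Ker}S_i^-$, where $S_i^-$ is the derivation from $\mathbb C[Y_j(zt^n)^{\pm1}]_{j\in I,n\in\mathbb Z}$ to the quotient of the free module on symbols $S_i^-(zt^m)$, $m\in\mathbb Z$, by the submodule generated by $S_i^-(zt^{m+2})-A_i(zt^{m+1})S_i^-(zt^m)$, with $S_i^-\cdot Y_j(zt^n)^{\pm1}=\pm\delta_{ij}Y_j(zt^n)^{\pm1}\otimes S_i^-(zt^n)$. It is known that $\operatorname{Ker}S_i^-$ is the $i$th factor of the intersection in the lower right corner. $\operatorname{Rep}_zU_t(\widehat{\mathfrak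 g'})$ is the Grothendieck ring (with complex coefficients) of the category of finite-dimensional representations of the quantum affine algebra $U_t(\widehat{\mathfrak g'})$ all of whose simple constituents have Drinfeld polynomials with roots in $t^{\mathbb Z}$. The $t$-character homomorphism is the Frenkel–Reshetikhin $q$-character homomorphism (with $q$ replaced by $t$) with the variables $Y_{i,t^n}$ written as $Y_i(zt^n)$; by a theorem of Frenkel–Mukhin it is an isomorphism onto the upper right corner. *)

theory Defs
  imports
    "HOL-Library.Poly_Mapping"
    "HOL-Computational_Algebra.Polynomial_FPS"
    "HOL-Algebra.QuotRing"
    "HOL-Algebra.Generated_Rings"
    "Jordan_Normal_Form.Matrix_Kernel"
begin

section \<open>Dynkin data\<close>

text \<open>Vertices carry Bourbaki's labels.\<close>

datatype dynkin = TypeA nat | TypeB nat | TypeC nat | TypeD nat | TypeE nat | TypeF4 | TypeG2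

fun valid_simply_laced :: "dynkin \<Rightarrow> bool" where
  "valid_simply_laced (TypeA n) \<longleftrightarrow> n \<ge> 1"
| "valid_simply_laced (TypeD n) \<longleftrightarrow> n \<ge> 4"
| "valid_simply_laced (TypeE n) \<longleftrightarrow> n \<in> {6, 7, 8}"
| "valid_simply_laced _ \<longleftrightarrow> False"

fun verts :: "dynkin \<Rightarrow> nat set" where
  "verts (TypeA n) = {1..n}"
| "verts (TypeB n) = {1..n}"
| "verts (TypeC n) = {1..n}"
| "verts (TypeD n) = {1..n}"
| "verts (TypeE n) = {1..n}"
| "verts TypeF4 = {1..4}"
| "verts TypeG2 = {1..2}"

fun links :: "dynkin \<Rightarrow> (nat \<times> nat) set" where
  "links (TypeA n) = {(i, j). 1 \<le> i \<and> j = i + 1 \<and> j \<le> n}"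
| "links (TypeB n) = {(i, j). 1 \<le> i \<and> j = i + 1 \<and> j \<le> n}"
| "links (TypeC n) = {(i, j). 1 \<le> i \<and> j = i + 1 \<and> j \<le> n}"
| "links (TypeD n) = {(i, j). 1 \<le> i \<and> j = i + 1 \<and> j < n} \<union> {(n - 2, n)}"
| "links (TypeE n) = {(1, 3), (2, 4), (3, 4)} \<union> {(i, j). 4 \<le> i \<and> j = i + 1 \<and> j \<le> n}"
| "links TypeF4 = {(1, 2), (2, 3), (3, 4)}"
| "links TypeG2 = {(1, 2)}"

text \<open>Squared length of a simple root, normalised so that short roots have squared length 2.\<close>

fun sq_len :: "dynkin \<Rightarrow> nat \<Rightarrow> int" where
  "sq_len (TypeB n) i = (if i < n then 4 else 2)"
| "sq_len (TypeC n) i = (if i < n then 2 else 4)"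
| "sq_len TypeF4 i = (if i \<le> 2 then 4 else 2)"
| "sq_len TypeG2 i = (if i = 1 then 2 else 6)"
| "sq_len _ i = 2"

text \<open>The inner product \<open>(\<alpha>\<^sub>i, \<alpha>\<^sub>j)\<close>. For linked vertices the Cartan integer attached to the
  longer of the two roots is \<open>-1\<close>, so the product is minus half the larger squared length.\<close>

definition ip :: "dynkin \<Rightarrow> nat \<Rightarrow> nat \<Rightarrow> int" where
  "ip X i j = (if i = j then sq_len X i
     else if (i, j) \<in> links X \<or> (j, i) \<in> links X then - (max (sq_len X i) (sq_len X j) div 2)
     else 0)"

definition cartan :: "dynkin \<Rightarrow> nat \<Rightarrow> nat \<Rightarrow> int" where
  "cartan X i j = 2 * ip X i j div ip X i i"

definition incidence :: "dynkin \<Rightarrow> nat \<Rightarrow> nat \<Rightarrow> int" where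
  "incidence X i j = 2 * of_bool (i = j) - cartan X i j"


section \<open>Diagram automorphisms and folding\<close>

text \<open>The pairs \<open>(\<gg>', \<gg>)\<close>; \<open>Unfolded X\<close> is the case \<open>\<gg> = \<gg>'\<close>, \<open>\<sigma> = id\<close>.\<close>

datatype folding = A_to_C nat | D_to_B nat | E6_to_F4 | D4_to_G2 | Unfolded dynkin

fun valid_folding :: "folding \<Rightarrow> bool" where
  "valid_folding (A_to_C l) \<longleftrightarrow> l \<ge> 2"
| "valid_folding (D_to_B l) \<longleftrightarrow> l \<ge> 3"
| "valid_folding E6_to_F4 \<longleftrightarrow> True"
| "valid_folding D4_to_G2 \<longleftrightarrow> True"
| "valid_folding (Unfolded X) \<longleftrightarrow> valid_simply_laced X"

fun upper :: "folding \<Rightarrow> dynkin" where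
  "upper (A_to_C l) = TypeA (2 * l - 1)"
| "upper (D_to_B l) = TypeD (l + 1)"
| "upper E6_to_F4 = TypeE 6"
| "upper D4_to_G2 = TypeD 4"
| "upper (Unfolded X) = X"

fun lower :: "folding \<Rightarrow> dynkin" where
  "lower (A_to_C l) = TypeC l"
| "lower (D_to_B l) = TypeB l"
| "lower E6_to_F4 = TypeF4"
| "lower D4_to_G2 = TypeG2"
| "lower (Unfolded X) = X"

fun sigma :: "folding \<Rightarrow> nat \<Rightarrow> nat" where
  "sigma (A_to_C l) i = 2 * l - i"
| "sigma (D_to_B l) i = (if i = l then l + 1 else if i = l + 1 then l else i)"
| "sigma E6_to_F4 i =
     (if i = 1 then 6 else if i = 6 then 1 else if i = 3 then 5 else if i = 5 then 3 else i)"
| "sigma D4_to_G2 i = (if i = 1 then 3 else if i = 3 then 4 else if i = 4 then 1 else i)"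
| "sigma (Unfolded X) i = i"

text \<open>The label in the diagram of \<open>\<gg>\<close> of the \<open>\<sigma>\<close>-orbit of a vertex of the diagram of \<open>\<gg>'\<close>. The lemmas
  \<open>orb_image\<close> and \<open>orb_eq_iff\<close> say that this identifies the set of \<open>\<sigma>\<close>-orbits with \<open>verts (lower F)\<close>, and
  \<open>cartan_lower\<close> says that the Cartan matrix of \<open>lower F\<close> is the one of the simple roots of \<open>\<gg>\<close>, the
  restrictions of the simple roots of \<open>\<gg>'\<close> to the \<open>\<sigma>\<close>-invariants of the Cartan subalgebra.\<close>

fun orb :: "folding \<Rightarrow> nat \<Rightarrow> nat" where
  "orb (A_to_C l) i = min i (2 * l - i)"
| "orb (D_to_B l) i = min i l"
| "orb E6_to_F4 i = (if i = 2 then 1 else if i = 4 then 2 else if i = 3 \<or> i = 5 then 3 else 4)"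
| "orb D4_to_G2 i = (if i = 2 then 2 else 1)"
| "orb (Unfolded X) i = i"


section \<open>Laurent polynomials in the variables \<open>Y\<^sub>j(zt\<^sup>n)\<close>\<close>

text \<open>The variable \<open>Y\<^sub>j(zt\<^sup>n)\<close> is indexed by \<open>(j, n)\<close>; since \<open>z\<close> is formal and \<open>t\<close> is not a root of unity,
  the \<open>zt\<^sup>n\<close> are distinct. Laurent monomials are written additively as exponent vectors, and Laurent
  polynomials form the group algebra of the group of monomials.\<close>

type_synonym monom = "(nat \<times> int) \<Rightarrow>\<^sub>0 int"
type_synonym laurent = "monom \<Rightarrow>\<^sub>0 complex"

definition const :: "complex \<Rightarrow> laurent" where
  "const c = Poly_Mapping.single 0 c"

definition of_monom :: "monom \<Rightarrow> laurent" where
  "of_monom m = Poly_Mapping.single m 1"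

definition Y_monom :: "nat \<Rightarrow> int \<Rightarrow> monom" where
  "Y_monom j n = Poly_Mapping.single (j, n) 1"

definition A_monom :: "dynkin \<Rightarrow> nat \<Rightarrow> int \<Rightarrow> monom" where
  "A_monom X i n = Y_monom i (n + 1) + Y_monom i (n - 1)
     + (\<Sum>j\<in>verts X - {i}. Poly_Mapping.single (j, n) (- incidence X j i))"

definition monoms :: "dynkin \<Rightarrow> monom set" where
  "monoms X = {m. Poly_Mapping.keys m \<subseteq> verts X \<times> UNIV}"

definition laurent_ring :: "dynkin \<Rightarrow> laurent ring" where
  "laurent_ring X = \<lparr>carrier = {f. Poly_Mapping.keys f \<subseteq> monoms X},
     mult = (*), one = 1, zero = 0, add = (+)\<rparr>"

text \<open>The \<open>i\<close>th factor of the intersection: the tensor product is formed inside the Laurent polynomial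
  ring, i.e. it is the subalgebra generated by its two tensor factors.\<close>

definition corner_factor :: "dynkin \<Rightarrow> nat \<Rightarrow> laurent set" where
  "corner_factor X i = generate_ring (laurent_ring X)
     (range const
      \<union> {of_monom (Y_monom j n) | j n. j \<in> verts X - {i}}
      \<union> {of_monom (- Y_monom j n) | j n. j \<in> verts X - {i}}
      \<union> {of_monom (Y_monom i n) * (1 + of_monom (- A_monom X i (n + 1))) | n. True})"

definition corner_ring :: "dynkin \<Rightarrow> laurent ring" where
  "corner_ring X = (laurent_ring X)\<lparr>carrier := (\<Inter>i\<in>verts X. corner_factor X i)\<rparr>"

definition fold_monom :: "folding \<Rightarrow> monom \<Rightarrow> monom" where
  "fold_monom F m = (\<Sum>(i, n)\<in>Poly_Mapping.keys m.
     Poly_Mapping.single (orb F i, n) (Poly_Mapping.lookup m (i, n)))"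

definition fold_laurent :: "folding \<Rightarrow> laurent \<Rightarrow> laurent" where
  "fold_laurent F f = (\<Sum>m\<in>Poly_Mapping.keys f.
     Poly_Mapping.single (fold_monom F m) (Poly_Mapping.lookup f m))"


section \<open>Screening operators\<close>

text \<open>The free module on the symbols \<open>S\<^sub>i\<^sup>-(zt\<^sup>m)\<close> is \<open>int \<Rightarrow>\<^sub>0 laurent\<close>. The derivation
  \<open>screening_lift i\<close> with values in it lifts \<open>S\<^sub>i\<^sup>-\<close>; see the lemmas \<open>screening_lift_mult\<close>,
  \<open>screening_lift_Y\<close> and \<open>screening_lift_Y_inverse\<close>.\<close>

type_synonym screening_module = "int \<Rightarrow>\<^sub>0 laurent"

definition screening_lift :: "nat \<Rightarrow> laurent \<Rightarrow> screening_module" where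
  "screening_lift i f = (\<Sum>m\<in>Poly_Mapping.keys f. \<Sum>n | (i, n) \<in> Poly_Mapping.keys m.
     Poly_Mapping.single n
       (Poly_Mapping.single m (of_int (Poly_Mapping.lookup m (i, n)) * Poly_Mapping.lookup f m)))"

text \<open>The submodule generated by the elements \<open>S\<^sub>i\<^sup>-(zt\<^bsup>m+2\<^esup>) - A\<^sub>i(zt\<^bsup>m+1\<^esup>) S\<^sub>i\<^sup>-(zt\<^sup>m)\<close>.\<close>

inductive_set screening_relations :: "dynkin \<Rightarrow> nat \<Rightarrow> screening_module set"
  for X :: dynkin and i :: nat where
  zero: "0 \<in> screening_relations X i"
| add_multiple: "r \<in> screening_relations X i \<Longrightarrow> a \<in> carrier (laurent_ring X) \<Longrightarrow>
    r + Poly_Mapping.single (m + 2) a - Poly_Mapping.single m (a * of_monom (A_monom X i (m + 1)))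
      \<in> screening_relations X i"

definition screening :: "dynkin \<Rightarrow> nat \<Rightarrow> laurent \<Rightarrow> screening_module set" where
  "screening X i f = {screening_lift i f + r | r. r \<in> screening_relations X i}"

definition K_minus :: "dynkin \<Rightarrow> laurent ring" where
  "K_minus X = (laurent_ring X)\<lparr>carrier :=
     (\<Inter>i\<in>verts X. {f \<in> carrier (laurent_ring X). screening X i f = screening_relations X i})\<rparr>"


section \<open>Finite-dimensional representations of the quantum affine algebra\<close>

text \<open>\<open>X\<close> is simply-laced throughout. A list of vertices adding up to the highest root \<open>\<theta>\<close>:
  \<open>\<theta> = \<Sum>\<^sub>k \<alpha>\<^bsub>i\<^sub>k\<^esub>\<close>, ordered such that \<open>(\<alpha>\<^bsub>i\<^sub>1\<^esub> + \<dots> + \<alpha>\<^bsub>i\<^sub>k\<^sub>-\<^sub>1\<^esub>, \<alpha>\<^bsub>i\<^sub>k\<^esub>) = -1\<close> for \<open>k \<ge> 2\<close>.\<close>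

fun theta_list :: "dynkin \<Rightarrow> nat list" where
  "theta_list (TypeA n) = [1..<n + 1]"
| "theta_list (TypeD n) = [1..<n + 1] @ rev [2..<n - 1]"
| "theta_list (TypeE n) =
     [1, 3, 4, 2, 5, 4, 3, 6, 5, 4, 2]
     @ (if n \<ge> 7 then [7, 6, 5, 4, 3, 1] else [])
     @ (if n \<ge> 8 then [8, 7, 6, 5, 4, 2, 3, 4, 5, 6, 7, 8] else [])"
| "theta_list _ = []"

definition aff_verts :: "dynkin \<Rightarrow> nat set" where
  "aff_verts X = insert 0 (verts X)"

text \<open>The affine simple root \<open>\<alpha>\<^sub>0\<close> pairs with the others like \<open>-\<theta>\<close>.\<close>

definition aff_ip :: "dynkin \<Rightarrow> nat \<Rightarrow> nat \<Rightarrow> int" where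
  "aff_ip X i j = (if i = 0 \<and> j = 0 then 2
     else if i = 0 then - (\<Sum>k\<leftarrow>theta_list X. ip X k j)
     else if j = 0 then - (\<Sum>k\<leftarrow>theta_list X. ip X i k)
     else ip X i j)"

text \<open>A representation on \<open>\<complex>\<^sup>d\<close> is given by the matrices of the Drinfeld-Jimbo generators
  \<open>E\<^sub>i\<close>, \<open>F\<^sub>i\<close>, \<open>K\<^sub>i\<close>, \<open>K\<^sub>i\<^sup>-\<^sup>1\<close>, indexed by the vertices of the affine Dynkin diagram.\<close>

record qrep =
  qdim :: nat
  qE :: "nat \<Rightarrow> complex mat"
  qF :: "nat \<Rightarrow> complex mat"
  qK :: "nat \<Rightarrow> complex mat"
  qKi :: "nat \<Rightarrow> complex mat"

abbreviation q2 :: "complex \<Rightarrow> complex" where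
  "q2 t \<equiv> t + inverse t"

abbreviation q3 :: "complex \<Rightarrow> complex" where
  "q3 t \<equiv> t ^ 2 + 1 + inverse t ^ 2"

definition q_serre :: "complex \<Rightarrow> int \<Rightarrow> nat \<Rightarrow> complex mat \<Rightarrow> complex mat \<Rightarrow> bool" where
  "q_serre t b d x y \<longleftrightarrow>
     (b = 0 \<longrightarrow> x * y - y * x = 0\<^sub>m d d) \<and>
     (b = -1 \<longrightarrow> x * x * y - q2 t \<cdot>\<^sub>m (x * y * x) + y * x * x = 0\<^sub>m d d) \<and>
     (b = -2 \<longrightarrow> x * x * x * y - q3 t \<cdot>\<^sub>m (x * x * y * x) + q3 t \<cdot>\<^sub>m (x * y * x * x)
        - y * x * x * x = 0\<^sub>m d d)"

definition is_qrep :: "complex \<Rightarrow> dynkin \<Rightarrow> qrep \<Rightarrow> bool" where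
  "is_qrep t X V \<longleftrightarrow> (let d = qdim V; E = qE V; F = qF V; K = qK V; Ki = qKi V in
     (\<forall>i\<in>aff_verts X. E i \<in> carrier_mat d d \<and> F i \<in> carrier_mat d d
        \<and> K i \<in> carrier_mat d d \<and> Ki i \<in> carrier_mat d d
        \<and> K i * Ki i = 1\<^sub>m d \<and> Ki i * K i = 1\<^sub>m d) \<and>
     (\<forall>i\<in>aff_verts X. \<forall>j\<in>aff_verts X.
        K i * K j = K j * K i
        \<and> K i * E j * Ki i = (t powi aff_ip X i j) \<cdot>\<^sub>m E j
        \<and> K i * F j * Ki i = (t powi (- aff_ip X i j)) \<cdot>\<^sub>m F j
        \<and> E i * F j - F j * E i =
            (if i = j then inverse (t - inverse t) \<cdot>\<^sub>m (K i - Ki i) else 0\<^sub>m d d)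
        \<and> (i \<noteq> j \<longrightarrow> q_serre t (aff_ip X i j) d (E i) (E j)
                  \<and> q_serre t (aff_ip X i j) d (F i) (F j))))"

definition is_hom :: "dynkin \<Rightarrow> qrep \<Rightarrow> qrep \<Rightarrow> complex mat \<Rightarrow> bool" where
  "is_hom X V W f \<longleftrightarrow> f \<in> carrier_mat (qdim W) (qdim V) \<and>
     (\<forall>i\<in>aff_verts X. f * qE V i = qE W i * f \<and> f * qF V i = qF W i * f
        \<and> f * qK V i = qK W i * f \<and> f * qKi V i = qKi W i * f)"

definition mat_image :: "complex mat \<Rightarrow> complex vec set" where
  "mat_image f = (\<lambda>v. f *\<^sub>v v) ` carrier_vec (dim_col f)"

definition is_mono :: "complex mat \<Rightarrow> bool" where
  "is_mono f \<longleftrightarrow> mat_kernel f = {0\<^sub>v (dim_col f)}"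

definition is_epi :: "complex mat \<Rightarrow> bool" where
  "is_epi f \<longleftrightarrow> mat_image f = carrier_vec (dim_row f)"

definition short_exact :: "dynkin \<Rightarrow> qrep \<Rightarrow> qrep \<Rightarrow> qrep \<Rightarrow> bool" where
  "short_exact X L M N \<longleftrightarrow> (\<exists>f g. is_hom X L M f \<and> is_hom X M N g
     \<and> is_mono f \<and> is_epi g \<and> mat_image f = mat_kernel g)"

definition simple_qrep :: "complex \<Rightarrow> dynkin \<Rightarrow> qrep \<Rightarrow> bool" where
  "simple_qrep t X V \<longleftrightarrow> is_qrep t X V \<and> qdim V \<noteq> 0 \<and>
     (\<forall>U f. is_qrep t X U \<and> is_hom X U V f \<and> is_mono f \<longrightarrow> qdim U = 0 \<or> qdim U = qdim V)"

definition simple_constituent :: "complex \<Rightarrow> dynkin \<Rightarrow> qrep \<Rightarrow> qrep \<Rightarrow> bool" where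
  "simple_constituent t X S V \<longleftrightarrow> simple_qrep t X S \<and>
     (\<exists>U f g. is_qrep t X U \<and> is_hom X U V f \<and> is_mono f \<and> is_hom X U S g \<and> is_epi g)"

definition kron :: "complex mat \<Rightarrow> complex mat \<Rightarrow> complex mat" where
  "kron A B = mat (dim_row A * dim_row B) (dim_col A * dim_col B) (\<lambda>(r, c).
     A $$ (r div dim_row B, c div dim_col B) * B $$ (r mod dim_row B, c mod dim_col B))"

text \<open>The tensor product with respect to the coproduct
  \<open>\<Delta>(E\<^sub>i) = E\<^sub>i \<otimes> 1 + K\<^sub>i \<otimes> E\<^sub>i\<close>, \<open>\<Delta>(F\<^sub>i) = F\<^sub>i \<otimes> K\<^sub>i\<^sup>-\<^sup>1 + 1 \<otimes> F\<^sub>i\<close>, \<open>\<Delta>(K\<^sub>i) = K\<^sub>i \<otimes> K\<^sub>i\<close>.\<close>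

definition tensor :: "qrep \<Rightarrow> qrep \<Rightarrow> qrep" where
  "tensor V W = \<lparr>qdim = qdim V * qdim W,
     qE = (\<lambda>i. kron (qE V i) (1\<^sub>m (qdim W)) + kron (qK V i) (qE W i)),
     qF = (\<lambda>i. kron (qF V i) (qKi W i) + kron (1\<^sub>m (qdim V)) (qF W i)),
     qK = (\<lambda>i. kron (qK V i) (qK W i)),
     qKi = (\<lambda>i. kron (qKi V i) (qKi W i))\<rparr>"

definition trivial_qrep :: qrep where
  "trivial_qrep = \<lparr>qdim = 1, qE = (\<lambda>_. 0\<^sub>m 1 1), qF = (\<lambda>_. 0\<^sub>m 1 1),
     qK = (\<lambda>_. 1\<^sub>m 1), qKi = (\<lambda>_. 1\<^sub>m 1)\<rparr>"


section \<open>The loop generators\<close>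

text \<open>Drinfeld's generators \<open>x\<^bsub>i,m\<^esub>\<^sup>\<plusminus>\<close> and \<open>\<phi>\<^bsub>i,m\<^esub>\<^sup>\<plusminus>\<close>, acting on a representation on which the
  canonical central element acts by 1.\<close>

record loop_gens =
  xp :: "nat \<Rightarrow> int \<Rightarrow> complex mat"
  xm :: "nat \<Rightarrow> int \<Rightarrow> complex mat"
  php :: "nat \<Rightarrow> int \<Rightarrow> complex mat"
  phm :: "nat \<Rightarrow> int \<Rightarrow> complex mat"

text \<open>With \<open>a(z) = \<Sum>\<^sub>m a\<^sub>m z\<^sup>-\<^sup>m\<close> and \<open>b(w) = \<Sum>\<^sub>n b\<^sub>n w\<^sup>-\<^sup>n\<close> the relation \<open>current_rel\<close> is the coefficientwise form of
  \<open>(z - s w) a(z) b(w) = (s z - w) b(w) a(z)\<close>.\<close>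

definition current_rel ::
  "complex \<Rightarrow> (int \<Rightarrow> complex mat) \<Rightarrow> (int \<Rightarrow> complex mat) \<Rightarrow> bool" where
  "current_rel s a b \<longleftrightarrow> (\<forall>m n.
     a (m + 1) * b n - s \<cdot>\<^sub>m (a m * b (n + 1)) = s \<cdot>\<^sub>m (b n * a (m + 1)) - b (n + 1) * a m)"

definition loop_serre ::
  "complex \<Rightarrow> int \<Rightarrow> nat \<Rightarrow> (int \<Rightarrow> complex mat) \<Rightarrow> (int \<Rightarrow> complex mat) \<Rightarrow> bool" where
  "loop_serre t b d x y \<longleftrightarrow>
     (b = 0 \<longrightarrow> (\<forall>m n. x m * y n - y n * x m = 0\<^sub>m d d)) \<and>
     (b = -1 \<longrightarrow> (\<forall>m m' n.
        (x m * x m' * y n - q2 t \<cdot>\<^sub>m (x m * y n * x m') + y n * x m * x m')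
        + (x m' * x m * y n - q2 t \<cdot>\<^sub>m (x m' * y n * x m) + y n * x m' * x m) = 0\<^sub>m d d))"

definition loop_relations :: "complex \<Rightarrow> dynkin \<Rightarrow> nat \<Rightarrow> loop_gens \<Rightarrow> bool" where
  "loop_relations t X d L \<longleftrightarrow>
     (\<forall>i\<in>verts X. \<forall>m.
        xp L i m \<in> carrier_mat d d \<and> xm L i m \<in> carrier_mat d d
        \<and> php L i m \<in> carrier_mat d d \<and> phm L i m \<in> carrier_mat d d
        \<and> (m < 0 \<longrightarrow> php L i m = 0\<^sub>m d d) \<and> (m > 0 \<longrightarrow> phm L i m = 0\<^sub>m d d)) \<and>
     (\<forall>i\<in>verts X. php L i 0 * phm L i 0 = 1\<^sub>m d \<and> phm L i 0 * php L i 0 = 1\<^sub>m d) \<and>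
     (\<forall>i\<in>verts X. \<forall>j\<in>verts X. \<forall>m n.
        php L i m * php L j n = php L j n * php L i m
        \<and> php L i m * phm L j n = phm L j n * php L i m
        \<and> phm L i m * phm L j n = phm L j n * phm L i m
        \<and> xp L i m * xm L j n - xm L j n * xp L i m =
            (if i = j then inverse (t - inverse t) \<cdot>\<^sub>m (php L i (m + n) - phm L i (m + n))
             else 0\<^sub>m d d)) \<and>
     (\<forall>i\<in>verts X. \<forall>j\<in>verts X. let b = ip X i j in
        current_rel (t powi b) (php L i) (xp L j)
        \<and> current_rel (t powi b) (phm L i) (xp L j)
        \<and> current_rel (t powi (- b)) (php L i) (xm L j)
        \<and> current_rel (t powi (- b)) (phm L i) (xm L j)
        \<and> current_rel (t powi b) (xp L i) (xp L j)
        \<and> current_rel (t powi (- b)) (xm L i) (xm L j)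
        \<and> (i \<noteq> j \<longrightarrow> loop_serre t b d (xp L i) (xp L j) \<and> loop_serre t b d (xm L i) (xm L j)))"

definition q_bracket :: "complex \<Rightarrow> complex mat \<Rightarrow> complex mat \<Rightarrow> complex mat" where
  "q_bracket t A B = A * B - inverse t \<cdot>\<^sub>m (B * A)"

text \<open>\<open>[a\<^sub>k, [\<dots>, [a\<^sub>2, b]]]\<close> with all brackets \<open>q_bracket t\<close>, for \<open>as = [a\<^sub>2, \<dots>, a\<^sub>k]\<close>.\<close>

definition nested_bracket :: "complex \<Rightarrow> complex mat list \<Rightarrow> complex mat \<Rightarrow> complex mat" where
  "nested_bracket t as b = foldl (\<lambda>c a. q_bracket t a c) b as"

text \<open>Drinfeld's isomorphism between the two presentations: with \<open>theta_list X = [i\<^sub>1, \<dots>, i\<^sub>r]\<close>,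
  \<open>E\<^sub>0 = [x\<^bsub>i\<^sub>r,0\<^esub>\<^sup>-, \<dots>, [x\<^bsub>i\<^sub>2,0\<^esub>\<^sup>-, x\<^bsub>i\<^sub>1,1\<^esub>\<^sup>-]] K\<^sub>\<theta>\<^sup>-\<^sup>1\<close> and
  \<open>F\<^sub>0 = (-t)\<^bsup>r-1\<^esup> K\<^sub>\<theta> [x\<^bsub>i\<^sub>r,0\<^esub>\<^sup>+, \<dots>, [x\<^bsub>i\<^sub>2,0\<^esub>\<^sup>+, x\<^bsub>i\<^sub>1,-1\<^esub>\<^sup>+]]\<close>. These are the formulas of Jing, "On Drinfeld
  realization of quantum affine algebras", at central charge 0.\<close>

definition is_loop_form :: "complex \<Rightarrow> dynkin \<Rightarrow> qrep \<Rightarrow> loop_gens \<Rightarrow> bool" where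
  "is_loop_form t X V L \<longleftrightarrow> loop_relations t X (qdim V) L \<and>
     (\<forall>i\<in>verts X. qE V i = xp L i 0 \<and> qF V i = xm L i 0 \<and> qK V i = php L i 0 \<and> qKi V i = phm L i 0) \<and>
     (let is = theta_list X;
          K\<theta> = foldr (\<lambda>i A. php L i 0 * A) is (1\<^sub>m (qdim V));
          K\<theta>i = foldr (\<lambda>i A. phm L i 0 * A) is (1\<^sub>m (qdim V)) in
       qE V 0 = nested_bracket t (map (\<lambda>i. xm L i 0) (tl is)) (xm L (hd is) 1) * K\<theta>i \<and>
       qF V 0 = ((- t) ^ (length is - 1)) \<cdot>\<^sub>m
         (K\<theta> * nested_bracket t (map (\<lambda>i. xp L i 0) (tl is)) (xp L (hd is) (-1))) \<and>
       qK V 0 = K\<theta>i \<and> qKi V 0 = K\<theta>)"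

text \<open>\<open>P\<close> is the tuple of Drinfeld polynomials of the simple representation \<open>V\<close>: on the highest weight
  vector, \<open>\<Sum>\<^sub>m \<phi>\<^bsub>i,\<plusminus>m\<^esub>\<^sup>\<plusminus> u\<^bsup>\<plusminus>m\<^esup>\<close> acts as the expansion of \<open>t\<^bsup>deg P\<^sub>i\<^esup> P\<^sub>i(u/t) / P\<^sub>i(ut)\<close> at \<open>u = 0\<close>, resp. at \<open>u = \<infinity>\<close>.
  The latter is a power series in \<open>1/u\<close>, obtained by reversing numerator and denominator.\<close>

definition has_drinfeld_polys :: "complex \<Rightarrow> dynkin \<Rightarrow> qrep \<Rightarrow> (nat \<Rightarrow> complex poly) \<Rightarrow> bool" where
  "has_drinfeld_polys t X V P \<longleftrightarrow> (\<forall>i\<in>verts X. poly (P i) 0 = 1) \<and>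
     (\<exists>L v. is_loop_form t X V L \<and> v \<in> carrier_vec (qdim V) \<and> v \<noteq> 0\<^sub>v (qdim V) \<and>
        (\<forall>i\<in>verts X. \<forall>m. xp L i m *\<^sub>v v = 0\<^sub>v (qdim V)) \<and>
        (\<forall>i\<in>verts X. \<forall>m.
           let a = P i \<circ>\<^sub>p [:0, inverse t:]; b = P i \<circ>\<^sub>p [:0, t:]; c = fps_const (t ^ Polynomial.degree (P i)) in
           php L i (int m) *\<^sub>v v = fps_nth (c * fps_of_poly a / fps_of_poly b) m \<cdot>\<^sub>v v \<and>
           phm L i (- int m) *\<^sub>v v =
             fps_nth (c * fps_of_poly (reflect_poly a) / fps_of_poly (reflect_poly b)) m \<cdot>\<^sub>v v))"

definition rep_z_objects :: "complex \<Rightarrow> dynkin \<Rightarrow> qrep set" where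
  "rep_z_objects t X = {V. is_qrep t X V \<and> (\<forall>S. simple_constituent t X S V \<longrightarrow>
     (\<exists>P. has_drinfeld_polys t X S P \<and>
        (\<forall>i\<in>verts X. \<forall>a. poly (P i) a = 0 \<longrightarrow> (\<exists>n::int. a = t powi n))))}"


section \<open>The Grothendieck ring\<close>

text \<open>The vector space with basis the representations in the category, with the bilinear
  multiplication induced by the tensor product; the Grothendieck ring is its quotient by the subspace
  spanned by \<open>[M] - [L] - [N]\<close> for the short exact sequences \<open>0 \<rightarrow> L \<rightarrow> M \<rightarrow> N \<rightarrow> 0\<close> in the category.\<close>

definition free_rep_ring :: "complex \<Rightarrow> dynkin \<Rightarrow> (qrep \<Rightarrow>\<^sub>0 complex) ring" where
  "free_rep_ring t X = \<lparr>carrier = {f. Poly_Mapping.keys f \<subseteq> rep_z_objects t X},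
     mult = (\<lambda>f g. \<Sum>V\<in>Poly_Mapping.keys f. \<Sum>W\<in>Poly_Mapping.keys g.
       Poly_Mapping.single (tensor V W) (Poly_Mapping.lookup f V * Poly_Mapping.lookup g W)),
     one = Poly_Mapping.single trivial_qrep 1, zero = 0, add = (+)\<rparr>"

inductive_set ses_relations :: "complex \<Rightarrow> dynkin \<Rightarrow> (qrep \<Rightarrow>\<^sub>0 complex) set"
  for t :: complex and X :: dynkin where
  zero: "0 \<in> ses_relations t X"
| add_multiple: "r \<in> ses_relations t X \<Longrightarrow>
    L \<in> rep_z_objects t X \<Longrightarrow> M \<in> rep_z_objects t X \<Longrightarrow> N \<in> rep_z_objects t X \<Longrightarrow>
    short_exact X L M N \<Longrightarrow>
    r + Poly_Mapping.single M c - Poly_Mapping.single L c - Poly_Mapping.single N c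
      \<in> ses_relations t X"

definition Rep_z :: "complex \<Rightarrow> dynkin \<Rightarrow> (qrep \<Rightarrow>\<^sub>0 complex) set ring" where
  "Rep_z t X = free_rep_ring t X Quot ses_relations t X"


section \<open>The \<open>t\<close>-character\<close>

text \<open>The Frenkel-Reshetikhin \<open>q\<close>-character in terms of l-weight spaces: the monomial
  \<open>\<Prod> Y\<^sub>i(zt\<^sup>n)\<^bsup>m(i,n)\<^esup>\<close> records the joint generalised eigenspace of the \<open>\<phi>\<^bsub>i,k\<^esub>\<^sup>\<plusminus>\<close> on which
  \<open>\<Sum>\<^sub>k \<phi>\<^bsub>i,\<plusminus>k\<^esub>\<^sup>\<plusminus> u\<^bsup>\<plusminus>k\<^esup>\<close> has as eigenvalue the expansion at \<open>u = 0\<close>, resp. \<open>u = \<infinity>\<close>, of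
  \<open>\<Prod>\<^sub>n (t (1 - u t\<^bsup>n-1\<^esup>) / (1 - u t\<^bsup>n+1\<^esup>))\<^bsup>m(i,n)\<^esup>\<close>.\<close>

definition l_weight_zero :: "complex \<Rightarrow> monom \<Rightarrow> nat \<Rightarrow> complex fps" where
  "l_weight_zero t m i = (\<Prod>n | (i, n) \<in> Poly_Mapping.keys m.
     ((fps_const t - fps_const (t powi n) * fps_X) / (1 - fps_const (t powi (n + 1)) * fps_X))
       powi (Poly_Mapping.lookup m (i, n)))"

text \<open>In terms of \<open>w = 1/u\<close>: \<open>t (1 - u t\<^bsup>n-1\<^esup>) / (1 - u t\<^bsup>n+1\<^esup>) = (1 - t\<^bsup>1-n\<^esup> w) / (t - t\<^bsup>-n\<^esup> w)\<close>.\<close>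

definition l_weight_infinity :: "complex \<Rightarrow> monom \<Rightarrow> nat \<Rightarrow> complex fps" where
  "l_weight_infinity t m i = (\<Prod>n | (i, n) \<in> Poly_Mapping.keys m.
     ((1 - fps_const (t powi (1 - n)) * fps_X) / (fps_const t - fps_const (t powi (- n)) * fps_X))
       powi (Poly_Mapping.lookup m (i, n)))"

definition gen_eigenspace :: "complex mat \<Rightarrow> complex \<Rightarrow> complex vec set" where
  "gen_eigenspace A c = {v \<in> carrier_vec (dim_row A).
     \<exists>k. ((A - c \<cdot>\<^sub>m 1\<^sub>m (dim_row A)) ^\<^sub>m k) *\<^sub>v v = 0\<^sub>v (dim_row A)}"

definition l_weight_space :: "complex \<Rightarrow> dynkin \<Rightarrow> nat \<Rightarrow> loop_gens \<Rightarrow> monom \<Rightarrow> complex vec set" where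
  "l_weight_space t X d L m = {v \<in> carrier_vec d. \<forall>i\<in>verts X. \<forall>k.
     v \<in> gen_eigenspace (php L i (int k)) (fps_nth (l_weight_zero t m i) k) \<and>
     v \<in> gen_eigenspace (phm L i (- int k)) (fps_nth (l_weight_infinity t m i) k)}"

text \<open>By Drinfeld's isomorphism the loop generators exist, and are unique, on the representations in
  the category.\<close>

definition l_weight_mult :: "complex \<Rightarrow> dynkin \<Rightarrow> qrep \<Rightarrow> monom \<Rightarrow> nat" where
  "l_weight_mult t X V m = vectorspace.dim (class_ring :: complex ring)
     (module_vec TYPE(complex) (qdim V)
       \<lparr>carrier := l_weight_space t X (qdim V) (SOME L. is_loop_form t X V L) m\<rparr>)"

definition t_char_rep :: "complex \<Rightarrow> dynkin \<Rightarrow> qrep \<Rightarrow> laurent" where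
  "t_char_rep t X V = (\<Sum>m | m \<in> monoms X \<and> l_weight_mult t X V m \<noteq> 0.
     Poly_Mapping.single m (of_nat (l_weight_mult t X V m)))"

text \<open>The induced map on classes: the common value of the linear extension of \<open>t_char_rep\<close> on the
  elements of a coset.\<close>

definition t_char :: "complex \<Rightarrow> dynkin \<Rightarrow> (qrep \<Rightarrow>\<^sub>0 complex) set \<Rightarrow> laurent" where
  "t_char t X a = the_elem
     ((\<lambda>f. \<Sum>V\<in>Poly_Mapping.keys f. const (Poly_Mapping.lookup f V) * t_char_rep t X V) ` a)"


section \<open>Consistency of the encodings\<close>

lemma orb_image:
  assumes "valid_folding F"
  shows "orb F ` verts (upper F) = verts (lower F)"
proof (cases F)
  case (A_to_C l)
  have "{1..l} \<subseteq> (\<lambda>i. min i (2 * l - i)) ` {1..2 * l - 1}"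
  proof
    fix i assume "i \<in> {1..l}"
    then show "i \<in> (\<lambda>i. min i (2 * l - i)) ` {1..2 * l - 1}"
      by (intro image_eqI[of _ _ i]) auto
  qed
  then show ?thesis using A_to_C by auto
next
  case (D_to_B l)
  have "{1..l} \<subseteq> (\<lambda>i. min i l) ` {1..l + 1}"
  proof
    fix i assume "i \<in> {1..l}"
    then show "i \<in> (\<lambda>i. min i l) ` {1..l + 1}"
      by (intro image_eqI[of _ _ i]) auto
  qed
  then show ?thesis using D_to_B assms by auto
next
  case E6_to_F4
  have "{1..6} = {1, 2, 3, 4, 5, 6 :: nat}" "{1..4} = {1, 2, 3, 4 :: nat}" by auto
  then show ?thesis using E6_to_F4 by auto
next
  case D4_to_G2
  have "{1..4} = {1, 2, 3, 4 :: nat}" "{1..2} = {1, 2 :: nat}" by auto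
  then show ?thesis using D4_to_G2 by auto
qed auto

lemma orb_eq_iff:
  assumes "valid_folding F" "i \<in> verts (upper F)" "j \<in> verts (upper F)"
  shows "orb F i = orb F j \<longleftrightarrow> (\<exists>k. (sigma F ^^ k) i = j)"
proof
  have inv: "orb F (sigma F i) = orb F i \<and> sigma F i \<in> verts (upper F)" if "i \<in> verts (upper F)" for i
    using assms(1) that by (cases F) (auto split: if_splits)
  assume "\<exists>k. (sigma F ^^ k) i = j"
  then obtain k where k: "(sigma F ^^ k) i = j" by blast
  have "orb F ((sigma F ^^ k) i) = orb F i \<and> (sigma F ^^ k) i \<in> verts (upper F)"
    using assms(2) inv by (induction k) auto
  then show "orb F i = orb F j" using k by simp
next
  assume o: "orb F i = orb F j"
  have "i = j \<or> sigma F i = j \<or> sigma F (sigma F i) = j"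
  proof (cases F)
    case (A_to_C l)
    then have "min i (2 * l - i) = min j (2 * l - j)" "i < 2 * l" "j < 2 * l"
      using assms o by auto
    then have "i = j \<or> 2 * l - i = j" by linarith
    then show ?thesis using A_to_C by auto
  next
    case (D_to_B l)
    then have "min i l = min j l" "i \<le> l + 1" "j \<le> l + 1"
      using assms o by auto
    then have "i = j \<or> (i = l \<and> j = l + 1) \<or> (i = l + 1 \<and> j = l)" by linarith
    then show ?thesis using D_to_B by auto
  next
    case E6_to_F4
    have "{1..6} = {1, 2, 3, 4, 5, 6 :: nat}" by auto
    then have "i \<in> {1, 2, 3, 4, 5, 6}" "j \<in> {1, 2, 3, 4, 5, 6}"
      using assms E6_to_F4 by simp_all
    then show ?thesis using o unfolding E6_to_F4 by (elim insertE emptyE) simp_all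
  next
    case D4_to_G2
    have "{1..4} = {1, 2, 3, 4 :: nat}" by auto
    then have "i \<in> {1, 2, 3, 4}" "j \<in> {1, 2, 3, 4}"
      using assms D4_to_G2 by simp_all
    then show ?thesis using o unfolding D4_to_G2 by (elim insertE emptyE) simp_all
  next
    case (Unfolded X)
    then show ?thesis using o by simp
  qed
  then have "(sigma F ^^ 0) i = j \<or> (sigma F ^^ 1) i = j \<or> (sigma F ^^ 2) i = j"
    by (simp add: numeral_2_eq_2)
  then show "\<exists>k. (sigma F ^^ k) i = j" by blast
qed

lemma cartan_lower:
  assumes "valid_folding F" "i \<in> verts (upper F)" "j \<in> verts (upper F)"
  shows "cartan (lower F) (orb F i) (orb F j)
    = (\<Sum>k | k \<in> verts (upper F) \<and> orb F k = orb F i. cartan (upper F) k j)"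
proof (cases F)
  case (A_to_C l)
  then have b: "l \<ge> 2" "1 \<le> i" "i < 2 * l" "1 \<le> j" "j < 2 * l"
    using assms by auto
  have "k \<in> verts (upper F) \<and> orb F k = orb F i \<longleftrightarrow> k \<in> (if i = l then {l} else {i, 2 * l - i})"
    for k
  proof -
    have "(1 \<le> k \<and> k \<le> 2 * l - 1 \<and> min k (2 * l - k) = min i (2 * l - i)) = (k = i \<or> k = 2 * l - i)"
      using b by linarith
    then show ?thesis using A_to_C b by auto
  qed
  then have s: "{k. k \<in> verts (upper F) \<and> orb F k = orb F i} = (if i = l then {l} else {i, 2 * l - i})"
    by blast
  define ca where "ca k = cartan (TypeA (2 * l - 1)) k j" for k
  have A: "ca k = (if k = j then 2 else if k + 1 = j \<or> j + 1 = k then -1 else 0)"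
    if "1 \<le> k" "k < 2 * l" for k
    using that b by (auto simp: ca_def cartan_def ip_def)
  have C: "cartan (TypeC l) a c = (if a = c then 2
      else if a + 1 = c then (if c = l then -2 else -1) else if c + 1 = a then -1 else 0)"
    if "1 \<le> a" "a \<le> l" "1 \<le> c" "c \<le> l" for a c
    using that by (auto simp: cartan_def ip_def)
  have "cartan (lower F) (orb F i) (orb F j) = cartan (TypeC l) (min i (2 * l - i)) (min j (2 * l - j))"
    using A_to_C by simp
  also have "\<dots> = (\<Sum>k\<in>(if i = l then {l} else {i, 2 * l - i}). ca k)"
  proof (cases "i = l")
    case True
    have "cartan (TypeC l) l c = ca l" if "c = min j (2 * l - j)" for c
    proof -
      have c: "1 \<le> c" "c \<le> l" "c = l \<longleftrightarrow> j = l" "c + 1 = l \<longleftrightarrow> l + 1 = j \<or> j + 1 = l"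
        using that b by linarith+
      have "cartan (TypeC l) l c = (if l = c then 2
          else if l + 1 = c then (if c = l then -2 else -1) else if c + 1 = l then -1 else 0)"
        using b c by (intro C) simp_all
      moreover have "ca l = (if l = j then 2 else if l + 1 = j \<or> j + 1 = l then -1 else 0)"
        using b by (intro A) simp_all
      ultimately show ?thesis using c by auto
    qed
    moreover have "min l (2 * l - l) = l" by simp
    ultimately show ?thesis using True by simp
  next
    case False
    define i' where "i' = 2 * l - i"
    define j' where "j' = 2 * l - j"
    have p: "i + i' = 2 * l" "j + j' = 2 * l" "1 \<le> i'" "1 \<le> j'" using b i'_def j'_def by auto
    have ne: "i \<noteq> i'" using False p by auto
    have C': "cartan (TypeC l) a c = ca i + ca i'"
      if "a = i \<and> i < l \<or> a = i' \<and> i' < l" "c = j \<and> j < l \<or> c = j' \<and> j' < l \<or> c = l \<and> j = l" for a c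
    proof -
      have "1 \<le> a" "a < l" "1 \<le> c" "c \<le> l" using that b p by auto
      then have 1: "cartan (TypeC l) a c = (if a = c then 2
          else if a + 1 = c then (if c = l then -2 else -1) else if c + 1 = a then -1 else 0)"
        by (simp add: C)
      have 2: "ca i = (if i = j then 2 else if i + 1 = j \<or> j + 1 = i then -1 else 0)"
        "ca i' = (if i' = j then 2 else if i' + 1 = j \<or> j + 1 = i' then -1 else 0)"
        using b p by (simp_all add: A)
      from that(2) show ?thesis
      proof (elim disjE conjE)
        assume c: "c = l" "j = l"
        show ?thesis using that(1) p c unfolding 1 2 by (elim disjE conjE) auto
      next
        assume c: "c = j" "j < l"
        show ?thesis using that(1) p c unfolding 1 2 by (elim disjE conjE) auto
      next
        assume c: "c = j'" "j' < l"
        show ?thesis using that(1) p c unfolding 1 2 by (elim disjE conjE) auto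
      qed
    qed
    have "cartan (TypeC l) (min i i') (min j j') = ca i + ca i'"
      by (rule C') (use p ne in linarith)+
    then show ?thesis using False ne unfolding i'_def j'_def by simp
  qed
  finally show ?thesis unfolding s ca_def using A_to_C by simp
next
  case (D_to_B l)
  then have b: "l \<ge> 3" "1 \<le> i" "i \<le> l + 1" "1 \<le> j" "j \<le> l + 1"
    using assms by auto
  have "k \<in> verts (upper F) \<and> orb F k = orb F i \<longleftrightarrow> k \<in> (if i < l then {i} else {l, l + 1})" for k
  proof -
    have "(1 \<le> k \<and> k \<le> l + 1 \<and> min k l = min i l) =
        (if i < l then k = i else k = l \<or> k = l + 1)"
      using b by (simp split: if_split) linarith
    then show ?thesis using D_to_B b by auto
  qed
  then have s: "{k. k \<in> verts (upper F) \<and> orb F k = orb F i} = (if i < l then {i} else {l, l + 1})"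
    by blast
  define cd where "cd k = cartan (TypeD (l + 1)) k j" for k
  have D: "cd k = (if k = j then 2
      else if k + 1 = j \<and> j \<le> l \<or> j + 1 = k \<and> k \<le> l \<or> k + 1 = l \<and> j = l + 1 \<or> j + 1 = l \<and> k = l + 1 then -1
      else 0)" if "1 \<le> k" "k \<le> l + 1" for k
  proof -
    have "(k, j) \<in> links (TypeD (l + 1)) \<or> (j, k) \<in> links (TypeD (l + 1)) \<longleftrightarrow>
        k + 1 = j \<and> j \<le> l \<or> j + 1 = k \<and> k \<le> l \<or> k + 1 = l \<and> j = l + 1 \<or> j + 1 = l \<and> k = l + 1"
      unfolding links.simps Un_iff mem_Collect_eq prod.case singleton_iff prod.inject
      using that b by linarith
    then show ?thesis by (simp add: cd_def cartan_def ip_def del: links.simps)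
  qed
  have B: "cartan (TypeB l) a c = (if a = c then 2
      else if a + 1 = c then -1 else if c + 1 = a then (if a = l then -2 else -1) else 0)"
    if "1 \<le> a" "a \<le> l" "1 \<le> c" "c \<le> l" for a c
    using that by (auto simp: cartan_def ip_def)
  have "cartan (TypeB l) (min i l) (min j l) = (\<Sum>k\<in>(if i < l then {i} else {l, l + 1}). cd k)"
  proof (cases "i < l")
    case True
    have "cartan (TypeB l) i (min j l) = cd i"
    proof (cases "j \<le> l")
      case jl: True
      then show ?thesis using True b D[of i] B[of i j] by auto
    next
      case False
      then have "j = l + 1" using b by simp
      then show ?thesis using True b D[of i] B[of i l] by auto
    qed
    then show ?thesis using True by simp
  next
    case False
    have "cartan (TypeB l) l (min j l) = cd l + cd (l + 1)"
    proof (cases "j \<le> l")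
      case True
      then show ?thesis using b D[of l] D[of "l + 1"] B[of l j] by auto
    next
      case False
      then have "j = l + 1" using b by simp
      then show ?thesis using b D[of l] D[of "l + 1"] B[of l l] by auto
    qed
    then show ?thesis using False by simp
  qed
  then show ?thesis unfolding s cd_def using D_to_B by simp
next
  case E6_to_F4
  have v: "{1..6} = {1, 2, 3, 4, 5, 6 :: nat}" by auto
  have i: "i \<in> {1, 2, 3, 4, 5, 6}" and j: "j \<in> {1, 2, 3, 4, 5, 6}"
    using assms(2, 3) unfolding E6_to_F4 upper.simps verts.simps v by blast+
  have "{k. k \<in> verts (upper F) \<and> orb F k = orb F i} =
      (if i = 2 then {2} else if i = 4 then {4} else if i = 3 \<or> i = 5 then {3, 5} else {1, 6})"
    using i unfolding E6_to_F4 upper.simps verts.simps v by (elim insertE emptyE) auto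
  then show ?thesis
    using i j by (elim insertE emptyE) (simp_all add: E6_to_F4 cartan_def ip_def)
next
  case D4_to_G2
  have v: "{1..4} = {1, 2, 3, 4 :: nat}" by auto
  have i: "i \<in> {1, 2, 3, 4}" and j: "j \<in> {1, 2, 3, 4}"
    using assms(2, 3) unfolding D4_to_G2 upper.simps verts.simps v by blast+
  have "{k. k \<in> verts (upper F) \<and> orb F k = orb F i} = (if i = 2 then {2} else {1, 3, 4})"
    using i unfolding D4_to_G2 upper.simps verts.simps v by (elim insertE emptyE) auto
  then show ?thesis
    using i j by (elim insertE emptyE) (simp_all add: D4_to_G2 cartan_def ip_def)
next
  case (Unfolded X)
  have "{k. k \<in> verts (upper F) \<and> orb F k = orb F i} = {i}"
    using assms Unfolded by auto
  then show ?thesis using Unfolded by simp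
qed

lemma lookup_screening_lift:
  assumes "finite M" "Poly_Mapping.keys f \<subseteq> M"
  shows "Poly_Mapping.lookup (screening_lift i f) n =
    (\<Sum>m\<in>M. Poly_Mapping.single m
       (of_int (Poly_Mapping.lookup m (i, n)) * Poly_Mapping.lookup f m))"
proof -
  have "Poly_Mapping.lookup (screening_lift i f) n =
    (\<Sum>m\<in>Poly_Mapping.keys f. \<Sum>l | (i, l) \<in> Poly_Mapping.keys m. 
      (Poly_Mapping.single m
       (of_int (Poly_Mapping.lookup m (i, l)) * Poly_Mapping.lookup f m) when l = n))"
    by (simp add: screening_lift_def lookup_sum lookup_single)
  also have "\<dots> = (\<Sum>m\<in>Poly_Mapping.keys f. Poly_Mapping.single m
       (of_int (Poly_Mapping.lookup m (i, n)) * Poly_Mapping.lookup f m))"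
  proof (rule sum.cong[OF refl])
    fix m :: monom
    have fin: "finite {l. (i, l) \<in> Poly_Mapping.keys m}"
      by (rule finite_subset[of _ "snd ` Poly_Mapping.keys m"]) (auto simp: image_iff, force)
    show "(\<Sum>l | (i, l) \<in> Poly_Mapping.keys m. 
      (Poly_Mapping.single m
       (of_int (Poly_Mapping.lookup m (i, l)) * Poly_Mapping.lookup f m) when l = n)) =
       Poly_Mapping.single m
       (of_int (Poly_Mapping.lookup m (i, n)) * Poly_Mapping.lookup f m)"
      using fin by (simp add: when_def sum.delta' not_in_keys_iff_lookup_eq_zero)
  qed
  also have "\<dots> = (\<Sum>m\<in>M. Poly_Mapping.single m
       (of_int (Poly_Mapping.lookup m (i, n)) * Poly_Mapping.lookup f m))"
    using assms by (intro sum.mono_neutral_left) (auto simp: not_in_keys_iff_lookup_eq_zero)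
  finally show ?thesis .
qed

lemma screening_lift_add:
  "screening_lift i (f + g) = screening_lift i f + screening_lift i g"
proof (rule poly_mapping_eqI)
  fix n
  let ?M = "Poly_Mapping.keys f \<union> Poly_Mapping.keys g"
  have "Poly_Mapping.keys (f + g) \<subseteq> ?M" by (rule Poly_Mapping.keys_add)
  then show "Poly_Mapping.lookup (screening_lift i (f + g)) n =
      Poly_Mapping.lookup (screening_lift i f + screening_lift i g) n"
    by (simp add: lookup_screening_lift[of ?M] lookup_add ring_distribs single_add sum.distrib)
qed

lemma lookup_screening_lift_single:
  "Poly_Mapping.lookup (screening_lift i (Poly_Mapping.single m c)) n =
     Poly_Mapping.single m (of_int (Poly_Mapping.lookup m (i, n)) * c)"
  by (subst lookup_screening_lift[of "{m}"]) auto

lemma laurent_induct [case_names single add]: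
  fixes f :: laurent
  assumes s: "\<And>m c. P (Poly_Mapping.single m c)" and a: "\<And>f g. P f \<Longrightarrow> P g \<Longrightarrow> P (f + g)"
  shows "P f"
proof (induction f rule: Poly_Mapping.update_induct)
  case const
  show ?case using s[of 0 0] by simp
next
  case (update f k c)
  have "Poly_Mapping.update k c f = f + Poly_Mapping.single k c"
    using update(1) by (intro poly_mapping_eqI)
      (auto simp: lookup_update lookup_add lookup_single when_def not_in_keys_iff_lookup_eq_zero)
  then show ?case using a[OF update(3) s] by simp
qed

lemma screening_lift_mult:
  "Poly_Mapping.lookup (screening_lift i (f * g)) n =
     f * Poly_Mapping.lookup (screening_lift i g) n + g * Poly_Mapping.lookup (screening_lift i f) n"
proof (induction f rule: laurent_induct)
  case (single a c)
  show ?case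
  proof (induction g rule: laurent_induct)
    case (single b d)
    show ?case
      by (simp add: mult_single lookup_screening_lift_single lookup_add single_add[symmetric]
            algebra_simps)
  next
    case (add g g')
    then show ?case by (simp add: screening_lift_add lookup_add algebra_simps)
  qed
next
  case (add f f')
  then show ?case by (simp add: screening_lift_add lookup_add algebra_simps)
qed

lemma screening_lift_Y:
  "screening_lift i (of_monom (Y_monom j n)) =
     (if i = j then Poly_Mapping.single n (of_monom (Y_monom j n)) else 0)"
  by (rule poly_mapping_eqI)
     (auto simp: of_monom_def Y_monom_def lookup_screening_lift_single lookup_single when_def)

lemma screening_lift_Y_inverse:
  "screening_lift i (of_monom (- Y_monom j n)) =
     (if i = j then Poly_Mapping.single n (- of_monom (- Y_monom j n)) else 0)"
  by (rule poly_mapping_eqI)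
     (auto simp: of_monom_def Y_monom_def lookup_screening_lift_single lookup_single when_def
        single_uminus)

end

theory Submission
  imports Defs
begin

text \<open>The \<open>i\<close>th factor of the intersection is the kernel of \<open>S\<^sub>i\<^sup>-\<close>: both are spanned by elements with highest
  monomials the \<open>i\<close>-dominant ones, because a nonzero element of the kernel has an \<open>i\<close>-dominant monomial.
  Since the orbit sums of the columns of the Cartan matrix of \<open>\<gg>'\<close> give the one of \<open>\<gg>\<close>, folding maps \<open>A\<^sub>i\<close> to
  \<open>A\<^bsub>orb i\<^esub>\<close> and intertwines the sum of the \<open>S\<^sub>i\<^sup>-\<close> over an orbit with the operator of the orbit, so it
  maps one intersection into the other.

  For surjectivity it suffices to find, for each dominant monomial of \<open>\<gg>'\<close>, an element of the upper
  intersection with this highest monomial. The Frenkel-Mukhin algorithm produces it as a formal sum; its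
  steps are consistent because of explicit elements in rank two. Going down an \<open>\<alpha>\<^sub>i\<close>-string from its top
  does not increase the norm of the weight, hence all weights stay in a ball and the sum is finite.\<close>

text \<open>The upper elements are built from monomials alone, not from representations, so nothing
  says in advance that the algorithm stops; this obstacle shapes the proof. Its remedy is a vector
  \<open>d\<close>, positive and with positive pairing with every column of the Cartan matrix. The
  grading \<open>pairing d\<close> drops along \<open>A\<^sub>i\<close> inverse for all
  \<open>i\<close> at once, so a top monomial of an element of the intersection is dominant for
  every vertex. The same \<open>d\<close> exhibits the Cartan form as a positive combination of
  squares plus nonnegative terms, so a bound on the norm becomes a bound on the degree.\<close>

abbreviation cf :: "('a \<Rightarrow>\<^sub>0 'b::zero) \<Rightarrow> 'a \<Rightarrow> 'b" where
  "cf \<equiv> Poly_Mapping.lookup"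

abbreviation supp :: "('a \<Rightarrow>\<^sub>0 'b::zero) \<Rightarrow> 'a set" where
  "supp \<equiv> Poly_Mapping.keys"

section \<open>Monomials\<close>

lemma finite_verts [simp]: "finite (verts X)"
  by (cases X) auto

text \<open>The spectral parameters \<open>n\<close> are forgotten: this is a linear functional of
  the weight of \<open>m\<close>, in which each \<open>Y\<^sub>j\<close> counts as the fundamental
  weight of \<open>j\<close>. Accordingly \<open>wt i\<close> is the pairing with the simple coroot
  of \<open>i\<close>.\<close>

definition pairing :: "(nat \<Rightarrow> int) \<Rightarrow> monom \<Rightarrow> int" where
  "pairing d m = (\<Sum>k\<in>supp m. d (fst k) * cf m k)"

definition wt :: "nat \<Rightarrow> monom \<Rightarrow> int" where
  "wt i = pairing (\<lambda>j. of_bool (j = i))"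

lemma pairing_superset:
  "finite S \<Longrightarrow> supp m \<subseteq> S \<Longrightarrow> pairing d m = (\<Sum>k\<in>S. d (fst k) * cf m k)"
  unfolding pairing_def by (rule sum.mono_neutral_left) (auto simp: in_keys_iff)

lemma pairing_zero [simp]: "pairing d 0 = 0"
  by (simp add: pairing_def)

lemma pairing_add: "pairing d (a + b) = pairing d a + pairing d b"
  using pairing_superset[of "supp a \<union> supp b" a d] pairing_superset[of "supp a \<union> supp b" b d]
    pairing_superset[of "supp a \<union> supp b" "a + b" d] Poly_Mapping.keys_add[of a b]
  by (simp add: lookup_add distrib_left sum.distrib)

lemma pairing_uminus: "pairing d (- a) = - pairing d a"
  using pairing_add[of d a "- a"] by simp

lemma pairing_diff: "pairing d (a - b) = pairing d a - pairing d b"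
  using pairing_add[of d a "- b"] by (simp add: pairing_uminus)

lemma pairing_single: "pairing d (Poly_Mapping.single (j, n) u) = d j * u"
  by (simp add: pairing_def)

lemma pairing_sum: "pairing d (\<Sum>x\<in>S. f x) = (\<Sum>x\<in>S. pairing d (f x))"
  by (induction S rule: infinite_finite_induct) (auto simp: pairing_add)

lemma pairing_sum_list: "pairing d (\<Sum>x\<leftarrow>xs. f x) = (\<Sum>x\<leftarrow>xs. pairing d (f x))"
  by (induction xs) (auto simp: pairing_add)

lemmas wt_simps = pairing_add[of "\<lambda>j. of_bool (j = _)", folded wt_def]
  pairing_diff[of "\<lambda>j. of_bool (j = _)", folded wt_def]
  pairing_sum_list[of "\<lambda>j. of_bool (j = _)", folded wt_def]

lemma wt_zero [simp]: "wt i 0 = 0"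
  by (simp add: wt_def)

lemma wt_single: "wt i (Poly_Mapping.single (j, n) u) = (if j = i then u else 0)"
  by (simp add: wt_def pairing_single)

lemma supp_monoms: "m \<in> monoms X \<Longrightarrow> k \<in> supp m \<Longrightarrow> fst k \<in> verts X"
  unfolding monoms_def by auto

lemma monoms_zero [simp]: "0 \<in> monoms X"
  by (simp add: monoms_def)

lemma monoms_add: "a \<in> monoms X \<Longrightarrow> b \<in> monoms X \<Longrightarrow> a + b \<in> monoms X"
  unfolding monoms_def mem_Collect_eq by (rule order_trans[OF Poly_Mapping.keys_add Un_least])

lemma monoms_uminus: "a \<in> monoms X \<Longrightarrow> - a \<in> monoms X"
  unfolding monoms_def by (auto simp: in_keys_iff)

lemma monoms_diff: "a \<in> monoms X \<Longrightarrow> b \<in> monoms X \<Longrightarrow> a - b \<in> monoms X"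
  using monoms_add[OF _ monoms_uminus, of a X b] by simp

lemma monoms_single: "j \<in> verts X \<Longrightarrow> Poly_Mapping.single (j, n) u \<in> monoms X"
  unfolding monoms_def by auto

lemma monoms_sum: "(\<And>x. x \<in> S \<Longrightarrow> f x \<in> monoms X) \<Longrightarrow> (\<Sum>x\<in>S. f x) \<in> monoms X"
  by (induction S rule: infinite_finite_induct) (auto intro: monoms_add)

lemma monoms_sum_list: "(\<And>x. x \<in> set xs \<Longrightarrow> f x \<in> monoms X) \<Longrightarrow> (\<Sum>x\<leftarrow>xs. f x) \<in> monoms X"
  by (induction xs) (auto intro: monoms_add)

lemma monoms_A: "i \<in> verts X \<Longrightarrow> A_monom X i n \<in> monoms X"
  unfolding A_monom_def Y_monom_def by (intro monoms_add monoms_sum monoms_single) auto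

lemma pairing_eq_sum_wt:
  assumes "m \<in> monoms X"
  shows "pairing d m = (\<Sum>i\<in>verts X. d i * wt i m)"
proof -
  have "pairing d m = (\<Sum>k\<in>supp m. \<Sum>i\<in>verts X. d i * (of_bool (fst k = i) * cf m k))"
    unfolding pairing_def
  proof (rule sum.cong[OF refl])
    fix k assume "k \<in> supp m"
    then have "d (fst k) * cf m k = (\<Sum>i\<in>verts X. if i = fst k then d i * cf m k else 0)"
      using supp_monoms[OF assms] by simp
    also have "\<dots> = (\<Sum>i\<in>verts X. d i * (of_bool (fst k = i) * cf m k))"
      by (intro sum.cong) auto
    finally show "d (fst k) * cf m k = (\<Sum>i\<in>verts X. d i * (of_bool (fst k = i) * cf m k))" .
  qed
  then show ?thesis
    unfolding wt_def pairing_def sum_distrib_left by (subst (asm) sum.swap)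
qed

lemma lookup_A_monom:
  "cf (A_monom X i n) (j, k) =
    (if j = i then of_bool (k = n + 1) + of_bool (k = n - 1)
     else if j \<in> verts X \<and> k = n then cartan X j i else 0)"
proof -
  have "(\<Sum>l\<in>verts X - {i}. cf (Poly_Mapping.single (l, n) (- incidence X l i)) (j, k)) =
      (\<Sum>l\<in>verts X - {i}. if l = j then (if k = n then cartan X j i else 0) else 0)"
    by (intro sum.cong refl) (auto simp: lookup_single when_def incidence_def)
  then show ?thesis
    by (auto simp: A_monom_def Y_monom_def lookup_add lookup_sum lookup_single when_def)
qed

lemma pairing_A_monom:
  "pairing d (A_monom X i n) = 2 * d i + (\<Sum>j\<in>verts X - {i}. d j * cartan X j i)"
  unfolding A_monom_def Y_monom_def
  by (auto simp: pairing_add pairing_sum pairing_single incidence_def intro!: sum.cong)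

lemma wt_A_monom_self: "wt i (A_monom X i n) = 2"
  unfolding wt_def pairing_A_monom by simp

lemma cartan_self: "cartan X i i = 2"
  by (cases X) (auto simp: cartan_def ip_def)

lemma pairing_A_monom':
  assumes "i \<in> verts X"
  shows "pairing d (A_monom X i n) = (\<Sum>j\<in>verts X. d j * cartan X j i)"
  using assms unfolding pairing_A_monom by (subst sum.remove[of _ i]) (auto simp: cartan_self)

lemma wt_A_monom:
  assumes "i \<in> verts X" "j \<in> verts X"
  shows "wt j (A_monom X i n) = cartan X j i"
proof -
  have "wt j (A_monom X i n) = (\<Sum>l\<in>verts X. if l = j then cartan X j i else 0)"
    unfolding wt_def pairing_A_monom'[OF assms(1)] by (intro sum.cong) auto
  then show ?thesis using assms by simp
qed

definition idom :: "nat \<Rightarrow> monom \<Rightarrow> bool" where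
  "idom i m \<longleftrightarrow> (\<forall>n. 0 \<le> cf m (i, n))"

lemma idom_wt: "idom i m \<Longrightarrow> 0 \<le> wt i m"
  unfolding wt_def pairing_def idom_def
  by (intro sum_nonneg) (auto simp: of_bool_def split: if_splits)

section \<open>Laurent polynomials\<close>

lemma carrier_laurent: "f \<in> carrier (laurent_ring X) \<longleftrightarrow> supp f \<subseteq> monoms X"
  by (simp add: laurent_ring_def)

lemma laurent_ring_simps [simp]:
  "\<one>\<^bsub>laurent_ring X\<^esub> = 1" "\<zero>\<^bsub>laurent_ring X\<^esub> = 0"
  "f \<oplus>\<^bsub>laurent_ring X\<^esub> g = f + g" "f \<otimes>\<^bsub>laurent_ring X\<^esub> g = f * g"
  by (simp_all add: laurent_ring_def)

lemma carrier_one: "1 \<in> carrier (laurent_ring X)"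
  by (simp add: carrier_laurent)

lemma carrier_add:
  "f \<in> carrier (laurent_ring X) \<Longrightarrow> g \<in> carrier (laurent_ring X) \<Longrightarrow> f + g \<in> carrier (laurent_ring X)"
  unfolding carrier_laurent by (rule order_trans[OF Poly_Mapping.keys_add Un_least])

lemma carrier_uminus: "f \<in> carrier (laurent_ring X) \<Longrightarrow> - f \<in> carrier (laurent_ring X)"
  unfolding carrier_laurent by (auto simp: in_keys_iff)

lemma carrier_mult:
  "f \<in> carrier (laurent_ring X) \<Longrightarrow> g \<in> carrier (laurent_ring X) \<Longrightarrow> f * g \<in> carrier (laurent_ring X)"
  unfolding carrier_laurent by (rule order_trans[OF keys_mult]) (auto intro: monoms_add)

lemma carrier_single: "m \<in> monoms X \<Longrightarrow> Poly_Mapping.single m c \<in> carrier (laurent_ring X)"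
  by (simp add: carrier_laurent)

lemma carrier_of_monom: "m \<in> monoms X \<Longrightarrow> of_monom m \<in> carrier (laurent_ring X)"
  by (simp add: of_monom_def carrier_single)

lemma laurent_a_inv: 
  assumes "f \<in> carrier (laurent_ring X)"
  shows "\<ominus>\<^bsub>laurent_ring X\<^esub> f = - f"
  unfolding a_inv_def m_inv_def using assms
  by (intro the_equality) (auto simp: carrier_uminus eq_neg_iff_add_eq_0 add.commute)

lemma lookup_const_mult [simp]: "cf (const c * f) m = c * cf f m"
proof -
  have "Poly_Mapping.map ((*) c) f = const c * f"
    unfolding const_def by (rule mult_map_scale_conv_mult)
  then have "cf (const c * f) m = cf (Poly_Mapping.map ((*) c) f) m" by simp
  also have "\<dots> = c * cf f m" by (simp add: Poly_Mapping.map.rep_eq when_def)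
  finally show ?thesis .
qed

lemma of_monom_add: "of_monom (a + b) = of_monom a * of_monom b"
  by (simp add: of_monom_def mult_single)

lemma of_monom_zero [simp]: "of_monom 0 = 1"
  by (simp add: of_monom_def)

lemma lookup_of_monom: "cf (of_monom m) k = of_bool (k = m)"
  by (auto simp: of_monom_def lookup_single when_def)

lemma supp_of_monom [simp]: "supp (of_monom m) = {m}"
  by (simp add: of_monom_def)

lemma lookup_mult_of_monom: "cf (f * of_monom a) m = cf f (m - a)"
proof (induction f rule: laurent_induct)
  case (single k c)
  then show ?case
    by (auto simp: of_monom_def mult_single lookup_single when_def)
next
  case (add f g)
  then show ?case by (simp add: lookup_add distrib_right)
qed

definition cut :: "(monom \<Rightarrow> bool) \<Rightarrow> laurent \<Rightarrow> laurent" where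
  "cut P f = Poly_Mapping.mapp (\<lambda>m c. if P m then c else 0) f"

lemma lookup_cut: "cf (cut P f) m = (if P m then cf f m else 0)"
  by (auto simp: cut_def lookup_mapp when_def in_keys_iff)

lemma supp_cut: "supp (cut P f) = {m \<in> supp f. P m}"
  by (auto simp: in_keys_iff lookup_cut split: if_splits)

text \<open>The coefficient family is itself stored as a Laurent polynomial, which gives it finite
  support and an additive structure.\<close>

definition lincomb :: "(monom \<Rightarrow> laurent) \<Rightarrow> laurent \<Rightarrow> laurent" where
  "lincomb e l = (\<Sum>m\<in>supp l. const (cf l m) * e m)"

lemma lincomb_superset:
  "finite S \<Longrightarrow> supp l \<subseteq> S \<Longrightarrow> lincomb e l = (\<Sum>m\<in>S. const (cf l m) * e m)"
  unfolding lincomb_def 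
  by (rule sum.mono_neutral_left) (auto simp: in_keys_iff const_def)

lemma lookup_lincomb: "cf (lincomb e l) k = (\<Sum>m\<in>supp l. cf l m * cf (e m) k)"
  by (simp add: lincomb_def lookup_sum)

lemma lincomb_add: "lincomb e (l + l') = lincomb e l + lincomb e l'"
proof (rule poly_mapping_eqI)
  fix k
  have *: "cf (lincomb e h) k = (\<Sum>m\<in>supp l \<union> supp l'. cf h m * cf (e m) k)"
    if "supp h \<subseteq> supp l \<union> supp l'" for h
    using lincomb_superset[OF _ that] by (simp add: lookup_sum)
  show "cf (lincomb e (l + l')) k = cf (lincomb e l + lincomb e l') k"
    using *[of "l + l'"] *[of l] *[of l'] Poly_Mapping.keys_add[of l l']
    by (simp add: lookup_add distrib_right sum.distrib)
qed

lemma lincomb_const: "lincomb e (const c * l) = const c * lincomb e l"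
proof (rule poly_mapping_eqI)
  fix k
  have "supp (const c * l) \<subseteq> supp l" by (auto simp: in_keys_iff)
  then show "cf (lincomb e (const c * l)) k = cf (const c * lincomb e l) k"
    using lincomb_superset[of "supp l" "const c * l" e]
    by (simp add: lookup_sum lookup_lincomb sum_distrib_left mult.assoc)
qed

lemma lincomb_single: "lincomb e (of_monom m) = e m"
  unfolding lincomb_def by (rule poly_mapping_eqI) (simp add: lookup_sum lookup_of_monom)

text \<open>Remove the leading good monomials of \<open>f\<close> degree by degree.\<close>

lemma triangular_span:
  fixes deg :: "monom \<Rightarrow> int"
  assumes diff: "\<And>f g. f \<in> S \<Longrightarrow> g \<in> S \<Longrightarrow> f - g \<in> S" and "V \<subseteq> S"
    and V_zero: "0 \<in> V" and V_add: "\<And>f g. f \<in> V \<Longrightarrow> g \<in> V \<Longrightarrow> f + g \<in> V"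
    and V_const: "\<And>f c. f \<in> V \<Longrightarrow> const c * f \<in> V"
    and good: "\<And>f. f \<in> S \<Longrightarrow> f \<noteq> 0 \<Longrightarrow> \<exists>m\<in>supp f. G m"
    and lead: "\<And>m f. f \<in> S \<Longrightarrow> m \<in> supp f \<Longrightarrow> G m \<Longrightarrow>
      0 \<le> deg m \<and> (\<exists>e\<in>V. cf e m = 1 \<and> (\<forall>k\<in>supp e. k = m \<or> deg k < deg m))"
  shows "S \<subseteq> V"
proof -
  \<comment> \<open>The bound concerns good monomials only. At bound 0 none is left, since good
    monomials of elements of \<open>S\<close> have nonnegative degree, and then \<open>good\<close>
    forces \<open>f = 0\<close>.\<close>
  have *: "f \<in> V" if "f \<in> S" "\<And>m. m \<in> supp f \<Longrightarrow> G m \<Longrightarrow> deg m < int n" for f and n :: nat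
    using that
  proof (induction n arbitrary: f)
    case 0
    have "f = 0"
    proof (rule ccontr)
      assume "f \<noteq> 0"
      then obtain m where m: "m \<in> supp f" "G m" using good[OF 0(1)] by blast
      then show False using 0(2)[of m] lead[OF 0(1) m] by simp
    qed
    then show ?case using V_zero by simp
  next
    case (Suc n)
    define L where "L = {m \<in> supp f. G m \<and> deg m = int n}"
    have "\<forall>m\<in>L. \<exists>e\<in>V. cf e m = 1 \<and> (\<forall>k\<in>supp e. k = m \<or> deg k < deg m)"
      using lead[OF Suc.prems(1)] unfolding L_def by blast
    then obtain e where e: "\<And>m. m \<in> L \<Longrightarrow> e m \<in> V" "\<And>m. m \<in> L \<Longrightarrow> cf (e m) m = 1"
      "\<And>m k. m \<in> L \<Longrightarrow> k \<in> supp (e m) \<Longrightarrow> k = m \<or> deg k < deg m"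
      by metis
    define g where "g = (\<Sum>m\<in>L. const (cf f m) * e m)"
    have fin: "finite L" unfolding L_def by simp
    have "(\<Sum>m\<in>A. const (cf f m) * e m) \<in> V" if "A \<subseteq> L" for A
      using finite_subset[OF that fin] that
      by (induction A rule: finite_induct) (auto intro: V_zero V_add V_const e(1))
    then have g: "g \<in> V" unfolding g_def by blast
    have "f - g \<in> V"
    proof (rule Suc.IH)
      show "f - g \<in> S" using diff Suc.prems(1) g \<open>V \<subseteq> S\<close> by blast
      fix k assume k: "k \<in> supp (f - g)" "G k"
      have ck: "cf (f - g) k = cf f k - (\<Sum>m\<in>L. cf f m * cf (e m) k)"
        by (simp add: g_def lookup_minus lookup_sum)
      show "deg k < int n"
      proof (cases "k \<in> L")
        case True
        \<comment> \<open>All members of \<open>L\<close> have the same degree, so none of them is a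
          lower term of the element belonging to another.\<close>
        have "(\<Sum>m\<in>L. cf f m * cf (e m) k) = (\<Sum>m\<in>L. if m = k then cf f k else 0)"
        proof (rule sum.cong[OF refl])
          fix m assume "m \<in> L"
          then show "cf f m * cf (e m) k = (if m = k then cf f k else 0)"
            using True e(2,3)[of m] e(3)[of m k] by (auto simp: L_def in_keys_iff)
        qed
        then have "cf (f - g) k = 0" using ck True fin by simp
        then show ?thesis using k by (simp add: in_keys_iff)
      next
        case False
        show ?thesis
        proof (cases "k \<in> supp f")
          case True
          then show ?thesis using Suc.prems(2)[of k] k(2) False unfolding L_def by fastforce
        next
          case nf: False
          then have "(\<Sum>m\<in>L. cf f m * cf (e m) k) \<noteq> 0"
            using k(1) ck by (simp add: in_keys_iff)
          then obtain m where "m \<in> L" "cf (e m) k \<noteq> 0"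
            by (metis (no_types, lifting) mult_eq_0_iff sum.neutral)
          then show ?thesis using e(3)[of m k] False by (auto simp: in_keys_iff L_def)
        qed
      qed
    qed
    then show ?case using V_add[of "f - g" g] g by simp
  qed
  show ?thesis
  proof
    fix f assume f: "f \<in> S"
    define N where "N = Max (insert 0 (deg ` supp f))"
    have "deg m \<le> N" if "m \<in> supp f" for m using that unfolding N_def by simp
    moreover have "0 \<le> N" unfolding N_def by simp
    ultimately show "f \<in> V" by (intro *[OF f, of "nat (N + 1)"]) force
  qed
qed

section \<open>The kernel of a screening operator\<close>

definition ker_screening :: "dynkin \<Rightarrow> nat \<Rightarrow> laurent set" where
  "ker_screening X i =
    {f \<in> carrier (laurent_ring X). screening_lift i f \<in> screening_relations X i}"

section \<open>The submodule of relations\<close>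

lemma relations_add:
  assumes r: "r \<in> screening_relations X i" and s: "s \<in> screening_relations X i"
  shows "r + s \<in> screening_relations X i"
  using s
proof (induction rule: screening_relations.induct)
  case zero
  then show ?case using r by simp
next
  case (add_multiple s a m)
  from screening_relations.add_multiple[OF add_multiple(3,2)] show ?case
    by (simp add: add.assoc add_diff_eq)
qed

text \<open>The multiple of \<open>s\<close> by \<open>f\<close> is described through its
  coefficients; a generator with coefficient \<open>a\<close> turns into the one with coefficient
  \<open>f * a\<close>.\<close>

lemma relations_mult:
  assumes "s \<in> screening_relations X i" and f: "f \<in> carrier (laurent_ring X)"
    and "\<And>n. cf s' n = f * cf s n"
  shows "s' \<in> screening_relations X i"
  using assms(1,3)
proof (induction arbitrary: s' rule: screening_relations.induct)
  case zero
  then have "s' = 0" by (intro poly_mapping_eqI) simp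
  then show ?case using screening_relations.zero by simp
next
  case (add_multiple s a m)
  define r where "r = Poly_Mapping.map ((*) f) s"
  have r: "cf r n = f * cf s n" for n by (simp add: r_def Poly_Mapping.map.rep_eq when_def)
  have "s' = r + Poly_Mapping.single (m + 2) (f * a)
      - Poly_Mapping.single m (f * a * of_monom (A_monom X i (m + 1)))"
    by (rule poly_mapping_eqI)
      (simp add: add_multiple(4) r lookup_add lookup_minus lookup_single when_def algebra_simps)
  then show ?case
    using screening_relations.add_multiple[OF add_multiple(3)[OF r] carrier_mult[OF f add_multiple(2)]]
    by simp
qed

lemma relations_uminus:
  "s \<in> screening_relations X i \<Longrightarrow> - s \<in> screening_relations X i"
  by (rule relations_mult[of s X i "-1"]) (auto intro: carrier_uminus carrier_one)

lemma relations_sum: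
  "(\<And>x. x \<in> S \<Longrightarrow> f x \<in> screening_relations X i) \<Longrightarrow> (\<Sum>x\<in>S. f x) \<in> screening_relations X i"
  by (induction S rule: infinite_finite_induct) (auto intro: screening_relations.zero relations_add)

text \<open>The relations form an additive group. This replaces the equality of cosets in
  \<open>K_minus\<close> by the membership in \<open>ker_screening\<close>.\<close>

lemma screening_eq_iff:
  "screening X i f = screening_relations X i \<longleftrightarrow> screening_lift i f \<in> screening_relations X i"
proof
  assume "screening X i f = screening_relations X i"
  moreover have "screening_lift i f + 0 \<in> screening X i f"
    unfolding screening_def using screening_relations.zero by blast
  ultimately show "screening_lift i f \<in> screening_relations X i" by simp
next
  assume l: "screening_lift i f \<in> screening_relations X i"
  have "x \<in> screening X i f" if "x \<in> screening_relations X i" for x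
  proof -
    have "- screening_lift i f + x \<in> screening_relations X i"
      using relations_add relations_uminus l that by blast
    moreover have "x = screening_lift i f + (- screening_lift i f + x)" by simp
    ultimately show ?thesis unfolding screening_def by blast
  qed
  then show "screening X i f = screening_relations X i"
    unfolding screening_def using relations_add l by blast
qed

section \<open>The kernel is a subring\<close>

lemma ker_carrier: "f \<in> ker_screening X i \<Longrightarrow> f \<in> carrier (laurent_ring X)"
  by (simp add: ker_screening_def)

lemma ker_supp: "f \<in> ker_screening X i \<Longrightarrow> m \<in> supp f \<Longrightarrow> m \<in> monoms X"
  by (auto dest!: ker_carrier simp: carrier_laurent)

lemma ker_add:
  "f \<in> ker_screening X i \<Longrightarrow> g \<in> ker_screening X i \<Longrightarrow> f + g \<in> ker_screening X i"
  unfolding ker_screening_def by (auto simp: screening_lift_add intro: carrier_add relations_add)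

lemma ker_mult:
  assumes "f \<in> ker_screening X i" "g \<in> ker_screening X i"
  shows "f * g \<in> ker_screening X i"
proof -
  define s where "s = Poly_Mapping.map ((*) f) (screening_lift i g)"
  define r where "r = Poly_Mapping.map ((*) g) (screening_lift i f)"
  have s: "cf s n = f * cf (screening_lift i g) n"
    and r: "cf r n = g * cf (screening_lift i f) n" for n
    by (simp_all add: s_def r_def Poly_Mapping.map.rep_eq when_def)
  have "screening_lift i (f * g) = s + r"
    by (rule poly_mapping_eqI) (simp add: screening_lift_mult s r lookup_add)
  moreover have "s \<in> screening_relations X i" "r \<in> screening_relations X i"
    using assms relations_mult[OF _ _ s] relations_mult[OF _ _ r]
    unfolding ker_screening_def by auto
  ultimately show ?thesis
    using assms relations_add carrier_mult unfolding ker_screening_def by auto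
qed

lemma ker_single:
  assumes "m \<in> monoms X" "\<And>n. cf m (i, n) = 0"
  shows "Poly_Mapping.single m c \<in> ker_screening X i"
proof -
  have "screening_lift i (Poly_Mapping.single m c) = 0"
    by (rule poly_mapping_eqI) (simp add: lookup_screening_lift_single assms)
  then show ?thesis
    using assms by (simp add: ker_screening_def screening_relations.zero carrier_single)
qed

lemma ker_of_monom:
  "m \<in> monoms X \<Longrightarrow> (\<And>n. cf m (i, n) = 0) \<Longrightarrow> of_monom m \<in> ker_screening X i"
  unfolding of_monom_def by (rule ker_single)

lemma ker_const: "const c \<in> ker_screening X i"
  unfolding const_def by (rule ker_single) auto

lemma ker_zero: "0 \<in> ker_screening X i"
  using ker_const[of 0] by (simp add: const_def)

lemma ker_one: "1 \<in> ker_screening X i"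
  using ker_const[of 1] by (simp add: const_def)

lemma ker_uminus: "f \<in> ker_screening X i \<Longrightarrow> - f \<in> ker_screening X i"
  using ker_mult[OF ker_const[of "-1"], of f] by (simp add: const_def single_uminus)

lemma ker_diff:
  "f \<in> ker_screening X i \<Longrightarrow> g \<in> ker_screening X i \<Longrightarrow> f - g \<in> ker_screening X i"
  using ker_add[OF _ ker_uminus, of f X i g] by simp

lemma ker_sum:
  "(\<And>x. x \<in> S \<Longrightarrow> f x \<in> ker_screening X i) \<Longrightarrow> (\<Sum>x\<in>S. f x) \<in> ker_screening X i"
  by (induction S rule: infinite_finite_induct) (auto intro: ker_zero ker_add)

text \<open>With \<open>b\<close> the quotient of \<open>m\<close> by \<open>A\<^sub>i\<close>, the
  derivation yields \<open>m S(n) - b S(n+2)\<close>, which is \<open>-b\<close> times the generator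
  \<open>S(n+2) - A S(n)\<close>. Other variables are allowed in \<open>m\<close>, because in rank
  two the lemma is applied to monomials further down.\<close>

lemma ker_string:
  assumes "m \<in> monoms X" "i \<in> verts X"
    and m: "\<And>k. cf m (i, k) = of_bool (k = n)"
  shows "of_monom m * (1 + of_monom (- A_monom X i (n + 1))) \<in> ker_screening X i"
proof -
  define b where "b = m - A_monom X i (n + 1)"
  have b: "b \<in> monoms X" unfolding b_def using assms by (intro monoms_diff monoms_A)
  have cb: "cf b (i, k) = - of_bool (k = n + 2)" for k
    by (simp add: b_def lookup_minus m lookup_A_monom)
  have 1: "of_monom m * (1 + of_monom (- A_monom X i (n + 1))) = of_monom m + of_monom b"
    by (simp add: b_def distrib_left of_monom_add[symmetric])
  have 2: "- of_monom b \<in> carrier (laurent_ring X)"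
    by (intro carrier_uminus carrier_of_monom b)
  have 3: "of_monom b * of_monom (A_monom X i (n + 1)) = of_monom m"
    by (simp add: b_def of_monom_add[symmetric])
  have "screening_lift i (of_monom m + of_monom b) =
    0 + Poly_Mapping.single (n + 2) (- of_monom b)
      - Poly_Mapping.single n (- of_monom b * of_monom (A_monom X i (n + 1)))"
  proof (rule poly_mapping_eqI)
    fix k
    have "cf (screening_lift i (of_monom m + of_monom b)) k =
        (if k = n then of_monom m else 0) - (if k = n + 2 then of_monom b else 0)"
      by (simp add: screening_lift_add lookup_add of_monom_def lookup_screening_lift_single m cb single_uminus)
    then show "cf (screening_lift i (of_monom m + of_monom b)) k =
      cf (0 + Poly_Mapping.single (n + 2) (- of_monom b)
      - Poly_Mapping.single n (- of_monom b * of_monom (A_monom X i (n + 1)))) k"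
      by (simp add: lookup_minus lookup_single 3 when_def)
  qed
  then show ?thesis
    unfolding 1 ker_screening_def
    using screening_relations.add_multiple[OF screening_relations.zero 2, where m = n and i = i] b assms
    by (auto intro!: carrier_add carrier_of_monom)
qed

section \<open>Comparison with the factors of the intersection\<close>

lemma corner_subset_ker:
  assumes "i \<in> verts X"
  shows "corner_factor X i \<subseteq> ker_screening X i"
proof
  fix h assume "h \<in> corner_factor X i"
  then show "h \<in> ker_screening X i"
    unfolding corner_factor_def
  proof (induction rule: generate_ring.induct)
    case one
    then show ?case by (simp add: ker_one)
  next
    case (incl h)
    have Y: "Y_monom j n \<in> monoms X" if "j \<in> verts X" for j n
      unfolding Y_monom_def by (rule monoms_single[OF that])
    have "of_monom (Y_monom j n) \<in> ker_screening X i" "of_monom (- Y_monom j n) \<in> ker_screening X i"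
      if "j \<in> verts X" "j \<noteq> i" for j n
      using that Y by (auto intro!: ker_of_monom monoms_uminus simp: Y_monom_def lookup_single)
    moreover have "of_monom (Y_monom i n) * (1 + of_monom (- A_monom X i (n + 1))) \<in> ker_screening X i" for n
      using assms Y by (intro ker_string) (auto simp: Y_monom_def lookup_single when_def)
    ultimately show ?case using incl ker_const by auto
  next
    case (a_inv h)
    then show ?case by (simp add: laurent_a_inv ker_carrier ker_uminus)
  next
    case (eng_add h1 h2)
    then show ?case by (simp add: ker_add)
  next
    case (eng_mult h1 h2)
    then show ?case by (simp add: ker_mult)
  qed
qed

lemma corner_const: "const c \<in> corner_factor X i"
  unfolding corner_factor_def by (rule generate_ring.incl) auto

lemma corner_add: "f \<in> corner_factor X i \<Longrightarrow> g \<in> corner_factor X i \<Longrightarrow> f + g \<in> corner_factor X i"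
  using generate_ring.eng_add[of f "laurent_ring X"] unfolding corner_factor_def by simp

lemma corner_mult: "f \<in> corner_factor X i \<Longrightarrow> g \<in> corner_factor X i \<Longrightarrow> f * g \<in> corner_factor X i"
  using generate_ring.eng_mult[of f "laurent_ring X"] unfolding corner_factor_def by simp

subsection \<open>Dominant monomials\<close>

text \<open>A coordinate on the quotient module: sending \<open>S\<^sub>i\<^sup>-(zt\<^sup>k)\<close> to the monomial \<open>a k\<close> for \<open>k\<close> of one
  parity, and to 0 for the other parity, kills the relations.\<close>

lemma ker_equation:
  assumes f: "f \<in> ker_screening X i" and a: "\<And>k. a (k + 2) = a k + A_monom X i (k + 1)"
    and K: "finite K" "\<And>m k. m \<in> supp f \<Longrightarrow> cf m (i, k) \<noteq> 0 \<Longrightarrow> k \<in> K"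
  shows "(\<Sum>k\<in>{k\<in>K. even (k - p)}. of_int (cf (M - a k) (i, k)) * cf f (M - a k)) = 0"
proof -
  define e where "e k = (if even (k - p) then of_monom (a k) else 0)" for k
  define \<Psi> where "\<Psi> s = (\<Sum>k\<in>supp s. cf s k * e k)" for s :: screening_module
  have sup: "\<Psi> s = (\<Sum>k\<in>S. cf s k * e k)" if "finite S" "supp s \<subseteq> S" for s S
    unfolding \<Psi>_def using that by (intro sum.mono_neutral_left) (auto simp: in_keys_iff)
  \<comment> \<open>The two terms of a generator cancel: \<open>m\<close> and \<open>m + 2\<close>
    have the same parity, and \<open>a (m + 2)\<close> is obtained from \<open>a m\<close> by adding
    exactly the \<open>A_monom\<close> of the relation.\<close>
  have "\<Psi> s = 0" if "s \<in> screening_relations X i" for s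
    using that
  proof (induction rule: screening_relations.induct)
    case zero
    then show ?case by (simp add: \<Psi>_def)
  next
    case (add_multiple r b m)
    define u where "u = r + Poly_Mapping.single (m + 2) b
      - Poly_Mapping.single m (b * of_monom (A_monom X i (m + 1)))"
    define S where "S = supp r \<union> {m, m + 2}"
    have u: "cf u k = cf r k + (if k = m + 2 then b else 0)
      - (if k = m then b * of_monom (A_monom X i (m + 1)) else 0)" for k
      by (auto simp: u_def lookup_add lookup_minus lookup_single when_def)
    have fin: "finite S" and rS: "supp r \<subseteq> S" unfolding S_def by auto
    have "supp u \<subseteq> S" by (auto simp: in_keys_iff u S_def split: if_splits)
    then have "\<Psi> u = (\<Sum>k\<in>S. cf u k * e k)" using sup fin by blast
    also have "\<dots> = (\<Sum>k\<in>S. cf r k * e k) + (\<Sum>k\<in>S. if k = m + 2 then b * e k else 0)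
       - (\<Sum>k\<in>S. if k = m then b * of_monom (A_monom X i (m + 1)) * e k else 0)"
      unfolding sum.distrib[symmetric] sum_subtractf[symmetric]
      by (rule sum.cong) (auto simp: u algebra_simps)
    also have "(\<Sum>k\<in>S. cf r k * e k) = 0"
      using sup[OF fin rS] add_multiple(3) by simp
    also have "(\<Sum>k\<in>S. if k = m + 2 then b * e k else 0) = b * e (m + 2)"
      using fin by (subst sum.delta) (auto simp: S_def)
    also have "(\<Sum>k\<in>S. if k = m then b * of_monom (A_monom X i (m + 1)) * e k else 0) =
        b * of_monom (A_monom X i (m + 1)) * e m"
      using fin by (subst sum.delta) (auto simp: S_def)
    also have "0 + b * e (m + 2) - b * of_monom (A_monom X i (m + 1)) * e m = 0"
      by (simp add: e_def a of_monom_add algebra_simps)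
    finally show ?case unfolding u_def .
  qed
  then have "\<Psi> (screening_lift i f) = 0" using f unfolding ker_screening_def by blast
  have lift: "cf (cf (screening_lift i f) k) m = of_int (cf m (i, k)) * cf f m" for k m
  proof -
    have "cf (cf (screening_lift i f) k) m =
        (\<Sum>l\<in>supp f. if l = m then of_int (cf m (i, k)) * cf f m else 0)"
      unfolding lookup_screening_lift[OF finite_keys order_refl] lookup_sum
      by (intro sum.cong refl) (auto simp: lookup_single when_def)
    then show ?thesis by (simp add: in_keys_iff)
  qed
  have "k \<in> K" if k: "k \<in> supp (screening_lift i f)" for k
  proof -
    have "cf (screening_lift i f) k \<noteq> 0" using k by (simp add: in_keys_iff)
    then obtain m where "cf (cf (screening_lift i f) k) m \<noteq> 0"
      by (metis poly_mapping_eqI lookup_zero)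
    then show ?thesis using K(2)[of m k] by (auto simp: lift in_keys_iff)
  qed
  then have "(\<Sum>k\<in>K. cf (screening_lift i f) k * e k) = 0"
    using \<open>\<Psi> (screening_lift i f) = 0\<close> sup[OF K(1), of "screening_lift i f"] by auto
  then have "0 = cf (\<Sum>k\<in>K. cf (screening_lift i f) k * e k) M" by simp
  also have "\<dots> = (\<Sum>k\<in>K. if even (k - p) then of_int (cf (M - a k) (i, k)) * cf f (M - a k) else 0)"
    unfolding lookup_sum
    by (intro sum.cong refl) (auto simp: e_def lookup_mult_of_monom lift)
  also have "\<dots> = (\<Sum>k\<in>{k\<in>K. even (k - p)}. of_int (cf (M - a k) (i, k)) * cf f (M - a k))"
    using K(1) by (simp add: sum.inter_filter)
  finally show ?thesis by simp
qed

text \<open>The recursion has step two, so there are two independent chains, one for each parity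
  \<open>p\<close>. The value \<open>b p r\<close> is the signed sum of the increments between
  \<open>p\<close> and \<open>2 * r + p\<close>, which reaches negative indices as well.\<close>

lemma chain_exists:
  fixes s :: "int \<Rightarrow> 'a::ab_group_add"
  obtains a where "\<And>k. a (k + 2) = a k + s (k + 1)"
proof -
  define b where "b p r = (\<Sum>l\<in>{0..<r}. s (2 * l + p + 1)) - (\<Sum>l\<in>{r..<0}. s (2 * l + p + 1))"
    for p r :: int
  have b: "b p (r + 1) = b p r + s (2 * r + p + 1)" for p r
  proof (cases "0 \<le> r")
    case True
    then have "{0..<r + 1} = insert r {0..<r}" "{r..<0} = {}" "{r + 1..<0} = {}" by auto
    then show ?thesis by (simp add: b_def add.commute)
  next
    case False
    then have "{r..<0} = insert r {r + 1..<0}" "{0..<r} = {}" "{0..<r + 1} = {}" by auto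
    then show ?thesis by (simp add: b_def)
  qed
  show ?thesis
  proof
    fix k :: int
    have "(k + 2) div 2 = k div 2 + 1" "(k + 2) mod 2 = k mod 2" "2 * (k div 2) + k mod 2 = k"
      by simp_all
    then show "b ((k + 2) mod 2) ((k + 2) div 2) = b (k mod 2) (k div 2) + s (k + 1)"
      using b[of "k mod 2" "k div 2"] by simp
  qed
qed

text \<open>The exponent of \<open>Y\<^sub>i(zt\<^bsup>n\<^sub>0\<^esup>)\<close> in the chain \<open>a\<close> only jumps once after \<open>n\<^sub>0\<close>. Hence, for the smallest
  index \<open>n\<^sub>0\<close>, the smallest exponent in \<open>f\<close> is 0, and the part of \<open>f\<close> with the largest exponent satisfies
  the equations for the remaining indices.\<close>

lemma equations_dominant:
  fixes f :: laurent
  assumes a: "\<And>k. a (k + 2) = a k + A_monom X i (k + 1)"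
    and "f \<noteq> 0" and "\<And>m k. m \<in> supp f \<Longrightarrow> k < n0 \<or> n0 + int N \<le> k \<Longrightarrow> 0 \<le> cf m (i, k)"
    and "\<And>p M. (\<Sum>k\<in>{k\<in>{n0..<n0 + int N}. even (k - p)}.
      of_int (cf (M - a k) (i, k)) * cf f (M - a k)) = 0"
  shows "\<exists>m\<in>supp f. idom i m"
  using assms(2-4)
proof (induction N arbitrary: n0 f)
  case 0
  then have "supp f \<noteq> {}" by simp
  then obtain m where "m \<in> supp f" by blast
  moreover have "k < n0 \<or> n0 + int 0 \<le> k" for k by auto
  ultimately show ?case using 0(2) unfolding idom_def by blast
next
  case (Suc N)
  have jump: "cf (a (n0 + 2 + 2 * int j)) (i, n0) = cf (a n0) (i, n0) + 1"
    and stay: "cf (a (n0 + 1 + 2 * int j)) (i, n0) = cf (a (n0 + 1)) (i, n0)" for j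
  proof (induction j)
    case 0
    { case 1 show ?case using a[of n0] by (simp add: lookup_add lookup_A_monom) }
    { case 2 show ?case by simp }
  next
    case (Suc j)
    { case 1 show ?case using Suc(1) a[of "n0 + 2 + 2 * int j"]
        by (simp add: lookup_add lookup_A_monom algebra_simps) }
    { case 2 show ?case using Suc(2) a[of "n0 + 1 + 2 * int j"]
        by (simp add: lookup_add lookup_A_monom algebra_simps) }
  qed
  have jump: "cf (a k) (i, n0) = cf (a n0) (i, n0) + 1" if "n0 < k" "even (k - n0)" for k
  proof -
    obtain j where "k - n0 = 2 * j" using \<open>even (k - n0)\<close> by (rule evenE)
    then have "k = n0 + 2 + 2 * int (nat (j - 1))" using \<open>n0 < k\<close> by simp
    then show ?thesis using jump by metis
  qed
  have stay: "cf (a k) (i, n0) = cf (a (n0 + 1)) (i, n0)" if "n0 < k" "odd (k - n0)" for k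
  proof -
    obtain j where "k - n0 = 2 * j + 1" using \<open>odd (k - n0)\<close> by (rule oddE)
    then have "k = n0 + 1 + 2 * int (nat j)" using \<open>n0 < k\<close> by simp
    then show ?thesis using stay by metis
  qed
  have split: "(\<Sum>k\<in>{k\<in>{n0..<n0 + int (Suc N)}. even (k - p)}. h k) =
      (if even (n0 - p) then h n0 else 0) + (\<Sum>k\<in>{k\<in>{n0 + 1..<n0 + 1 + int N}. even (k - p)}. h k)"
    for p and h :: "int \<Rightarrow> complex"
  proof -
    have *: "{n0..<n0 + int (Suc N)} = insert n0 {n0 + 1..<n0 + 1 + int N}" by auto
    show ?thesis
      unfolding * by (subst (1 2) sum.inter_filter) auto
  qed
  let ?eq = "\<lambda>f M k. of_int (cf (M - a k) (i, k)) * cf f (M - a k) :: complex"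
  let ?u = "\<lambda>m. cf m (i, n0)"
  have ne: "supp f \<noteq> {}" using Suc.prems(1) by simp
  have nonneg: "0 \<le> ?u m" if "m \<in> supp f" for m
  proof -
    define q where "q = Min (?u ` supp f)"
    have q: "q \<le> ?u k" if "k \<in> supp f" for k using that unfolding q_def by simp
    have "q \<in> ?u ` supp f" unfolding q_def using ne by (intro Min_in) auto
    then obtain b where b: "b \<in> supp f" "?u b = q" by blast
    \<comment> \<open>For this choice of the monomial the terms with larger index of the same parity
      look at the exponent \<open>q - 1\<close>, below the minimum. What remains is \<open>q\<close>
      times the nonzero coefficient of \<open>b\<close>.\<close>
    have "?eq f (b + a n0) k = 0" if "k \<in> {n0 + 1..<n0 + 1 + int N}" "even (k - n0)" for k
    proof -
      have "?u (b + a n0 - a k) = q - 1"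
        using that jump[of k] b by (simp add: lookup_add lookup_minus)
      then have "b + a n0 - a k \<notin> supp f" using q by fastforce
      then show ?thesis by (simp add: in_keys_iff)
    qed
    then have "?eq f (b + a n0) n0 = 0"
      using Suc.prems(3)[where M = "b + a n0" and p = n0] unfolding split by (simp add: sum.neutral)
    then have "q = 0" using b by (simp add: in_keys_iff)
    then show ?thesis using q that by simp
  qed
  define q where "q = Max (?u ` supp f)"
  define g where "g = cut (\<lambda>m. ?u m = q) f"
  have q: "?u k \<le> q" if "k \<in> supp f" for k using that unfolding q_def by simp
  have "q \<in> ?u ` supp f" unfolding q_def using ne by (intro Max_in) auto
  then have "supp g \<noteq> {}" unfolding g_def supp_cut by auto
  have "\<exists>m\<in>supp g. idom i m"
  proof (rule Suc.IH)
    show "g \<noteq> 0" using \<open>supp g \<noteq> {}\<close> by auto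
    show "0 \<le> cf m (i, k)" if "m \<in> supp g" "k < n0 + 1 \<or> n0 + 1 + int N \<le> k" for m k
    proof (cases "k = n0")
      case True
      then show ?thesis using nonneg[of m] that unfolding g_def supp_cut by simp
    next
      case False
      then show ?thesis using Suc.prems(2)[of m k] that unfolding g_def supp_cut by auto
    qed
    fix p M
    let ?K = "{k\<in>{n0 + 1..<n0 + 1 + int N}. even (k - p)}"
    \<comment> \<open>For all \<open>k\<close> in \<open>?K\<close> the exponent of the variable
      with index \<open>n0\<close> in \<open>a k\<close> is this one number, by \<open>jump\<close>
      or \<open>stay\<close> according to the parity. So the equation for \<open>M\<close> only sees
      one slice of \<open>f\<close>.\<close>
    define c where "c = (if even (n0 - p) then cf (a n0) (i, n0) + 1 else cf (a (n0 + 1)) (i, n0))"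
    have c: "?u (M - a k) = ?u M - c" if "k \<in> ?K" for k
      using that jump[of k] stay[of k] by (auto simp: lookup_minus c_def)
    show "(\<Sum>k\<in>?K. ?eq g M k) = 0"
    proof (cases "?u M - c = q")
      case False
      then show ?thesis by (intro sum.neutral) (auto simp: g_def lookup_cut c)
    next
      case True
      \<comment> \<open>The chain has not jumped yet at \<open>n0\<close>, so this term looks at the
        exponent \<open>q + 1\<close>, above the maximum.\<close>
      have "?eq f M n0 = 0" if "even (n0 - p)"
      proof -
        have "?u (M - a n0) = q + 1" using True that by (simp add: c_def lookup_minus)
        then have "M - a n0 \<notin> supp f" using q by fastforce
        then show ?thesis by (simp add: in_keys_iff)
      qed
      then have "(\<Sum>k\<in>?K. ?eq f M k) = 0"
        using Suc.prems(3)[where M = M and p = p] unfolding split by (auto split: if_splits)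
      moreover have "(\<Sum>k\<in>?K. ?eq g M k) = (\<Sum>k\<in>?K. ?eq f M k)"
        using True by (intro sum.cong refl) (simp add: g_def lookup_cut c)
      ultimately show ?thesis by simp
    qed
  qed
  then show ?case unfolding g_def supp_cut by auto
qed

lemma ker_dominant:
  assumes f: "f \<in> ker_screening X i" "f \<noteq> 0"
  shows "\<exists>m\<in>supp f. idom i m"
proof -
  obtain a where a: "\<And>k. a (k + 2) = a k + A_monom X i (k + 1)"
    using chain_exists[of "A_monom X i"] by blast
  \<comment> \<open>All spectral parameters that occur in \<open>f\<close>; 0 is inserted so that
    \<open>Min\<close> and \<open>Max\<close> make sense. Outside the window from
    \<open>Min T\<close> to \<open>Max T\<close> the exponents vanish.\<close>
  define T where "T = insert 0 (snd ` (\<Union>m\<in>supp f. supp m))"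
  have fin: "finite T" unfolding T_def by simp
  define N where "N = nat (Max T - Min T + 1)"
  have "0 \<in> T" by (simp add: T_def)
  then have "Min T \<le> Max T" using order_trans[OF Min_le Max_ge] fin by blast
  then have N: "Min T + int N = Max T + 1" unfolding N_def by simp
  have T: "k \<in> T" if "m \<in> supp f" "cf m (i, k) \<noteq> 0" for m k
  proof -
    have "(i, k) \<in> (\<Union>m\<in>supp f. supp m)" using that by (auto simp: in_keys_iff)
    then show ?thesis unfolding T_def by force
  qed
  have K: "k \<in> {Min T..<Min T + int N}" if "m \<in> supp f" "cf m (i, k) \<noteq> 0" for m k
    using T[OF that] fin N by simp
  show ?thesis
  proof (rule equations_dominant[OF a f(2), of "Min T" N])
    show "0 \<le> cf m (i, k)" if "m \<in> supp f" "k < Min T \<or> Min T + int N \<le> k" for m k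
      using K[of m k] that by (cases "cf m (i, k) = 0") auto
    show "(\<Sum>k\<in>{k\<in>{Min T..<Min T + int N}. even (k - p)}.
      of_int (cf (M - a k) (i, k)) * cf f (M - a k)) = 0" for p M
      by (rule ker_equation[OF f(1) a]) (use K in auto)
  qed
qed

subsection \<open>Strings\<close>

lemma supp_multE:
  assumes "k \<in> supp (f * g :: laurent)"
  obtains a b where "a \<in> supp f" "b \<in> supp g" "k = a + b"
  using assms keys_mult[of f g] by blast

lemma supp_addE:
  assumes "k \<in> supp (f + g :: laurent)"
  obtains "k \<in> supp f" | "k \<in> supp g"
  using assms Poly_Mapping.keys_add[of f g] by blast

text \<open>For constructions that are multiplicative in the monomial: a monomial is the product of
  powers of its variables, so these powers are all that has to be treated.\<close>

lemma exists_for_monom: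
  fixes m :: monom
  assumes one: "P 0 1" and mult: "\<And>a b e f. P a e \<Longrightarrow> P b f \<Longrightarrow> P (a + b) (e * f)"
    and single: "\<And>k. k \<in> supp m \<Longrightarrow> \<exists>e::laurent. P (Poly_Mapping.single k (cf m k)) e"
  shows "\<exists>e. P m e"
proof -
  have "\<exists>e. P (\<Sum>k\<in>K. Poly_Mapping.single k (cf m k)) e" if "K \<subseteq> supp m" for K
    using finite_subset[OF that finite_keys] that
  proof (induction K rule: finite_induct)
    case empty
    then show ?case using one by auto
  next
    case (insert k K)
    then obtain e f where "P (\<Sum>k\<in>K. Poly_Mapping.single k (cf m k)) e"
      "P (Poly_Mapping.single k (cf m k)) f" using single by blast
    then have "P (\<Sum>k\<in>insert k K. Poly_Mapping.single k (cf m k)) (f * e)"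
      using insert mult by simp
    then show ?case by blast
  qed
  moreover have "(\<Sum>k\<in>supp m. Poly_Mapping.single k (cf m k)) = m"
    by (rule poly_mapping_eqI) (simp add: lookup_sum lookup_single when_def in_keys_iff)
  ultimately show ?thesis by (metis order_refl)
qed

text \<open>Used with \<open>c = 1\<close> and, for inverse variables, with
  \<open>c = -1\<close>.\<close>

lemma power_for_monom:
  fixes e :: laurent and c :: int
  assumes one: "P 0 1" and mult: "\<And>a b e f. P a e \<Longrightarrow> P b f \<Longrightarrow> P (a + b) (e * f)"
    and "P (Poly_Mapping.single k c) e"
  shows "P (Poly_Mapping.single k (int n * c)) (e ^ n)"
proof (induction n)
  case 0
  then show ?case using one by simp
next
  case (Suc n)
  then show ?case using mult[OF assms(3) Suc] by (simp add: single_add[symmetric] algebra_simps)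
qed

text \<open>The shape of \<open>m \<Prod>\<^sub>n (1 + A\<^sub>i(zt\<^bsup>n+1\<^esup>)\<^sup>-\<^sup>1)\<^bsup>m(i,n)\<^esup>\<close> for \<open>i\<close>-dominant \<open>m\<close>.\<close>

definition string_shape :: "dynkin \<Rightarrow> nat \<Rightarrow> monom \<Rightarrow> laurent \<Rightarrow> bool" where
  "string_shape X i m f \<longleftrightarrow> 0 \<le> wt i m \<and> (\<forall>k\<in>supp (f - of_monom m).
     \<exists>xs. xs \<noteq> [] \<and> int (length xs) \<le> wt i m \<and> k = m - (\<Sum>x\<leftarrow>xs. A_monom X i x))"

lemma string_shape_of_monom: "wt i m = 0 \<Longrightarrow> string_shape X i m (of_monom m)"
  by (simp add: string_shape_def)

lemma string_shape_mult:
  assumes "string_shape X i a e" "string_shape X i b f"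
  shows "string_shape X i (a + b) (e * f)"
proof -
  let ?e = "e - of_monom a" and ?f = "f - of_monom b"
  have e: "\<exists>xs. xs \<noteq> [] \<and> int (length xs) \<le> wt i a \<and> k = a - (\<Sum>x\<leftarrow>xs. A_monom X i x)"
    if "k \<in> supp ?e" for k using assms(1) that by (auto simp: string_shape_def)
  have f: "\<exists>xs. xs \<noteq> [] \<and> int (length xs) \<le> wt i b \<and> k = b - (\<Sum>x\<leftarrow>xs. A_monom X i x)"
    if "k \<in> supp ?f" for k using assms(2) that by (auto simp: string_shape_def)
  have nn: "0 \<le> wt i a" "0 \<le> wt i b" using assms by (auto simp: string_shape_def)
  \<comment> \<open>With the product of the leading monomials removed, every remaining term takes a
    nonempty list from at least one of the factors.\<close>
  have *: "e * f - of_monom (a + b) = ?e * ?f + (?e * of_monom b + of_monom a * ?f)"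
    by (simp add: of_monom_add algebra_simps)
  have "\<exists>xs. xs \<noteq> [] \<and> int (length xs) \<le> wt i (a + b) \<and> k = a + b - (\<Sum>x\<leftarrow>xs. A_monom X i x)"
    if "k \<in> supp (e * f - of_monom (a + b))" for k
    using that unfolding *
  proof (elim supp_addE supp_multE)
    fix x y assume "x \<in> supp ?e" "y \<in> supp ?f" and k: "k = x + y"
    then obtain xs ys where "xs \<noteq> []" "int (length xs) \<le> wt i a" "x = a - (\<Sum>x\<leftarrow>xs. A_monom X i x)"
      "int (length ys) \<le> wt i b" "y = b - (\<Sum>x\<leftarrow>ys. A_monom X i x)" using e f by meson
    then show ?thesis using k by (intro exI[of _ "xs @ ys"]) (simp add: wt_simps)
  next
    fix x y assume "x \<in> supp ?e" "y \<in> supp (of_monom b)" and k: "k = x + y"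
    then obtain xs where "xs \<noteq> []" "int (length xs) \<le> wt i a" "x = a - (\<Sum>x\<leftarrow>xs. A_monom X i x)"
      "y = b" using e by auto
    then show ?thesis using k nn by (intro exI[of _ xs]) (simp add: wt_simps)
  next
    fix x y assume "x \<in> supp (of_monom a)" "y \<in> supp ?f" and k: "k = x + y"
    then obtain xs where "xs \<noteq> []" "int (length xs) \<le> wt i b" "y = b - (\<Sum>x\<leftarrow>xs. A_monom X i x)"
      "x = a" using f by auto
    then show ?thesis using k nn by (intro exI[of _ xs]) (simp add: wt_simps)
  qed
  then show ?thesis using nn by (simp add: string_shape_def wt_simps)
qed

lemma string_shape_supp:
  assumes "string_shape X i m f" "k \<in> supp f" "k \<noteq> m"
  obtains xs where "xs \<noteq> []" "int (length xs) \<le> wt i m" "k = m - (\<Sum>x\<leftarrow>xs. A_monom X i x)"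
proof -
  have "k \<in> supp (f - of_monom m)"
    using assms(2,3) by (simp add: in_keys_iff lookup_minus lookup_of_monom)
  then show ?thesis using assms(1) that unfolding string_shape_def by blast
qed

lemma sum_list_pos:
  fixes f :: "'a \<Rightarrow> int"
  shows "xs \<noteq> [] \<Longrightarrow> (\<And>x. 0 < f x) \<Longrightarrow> 0 < (\<Sum>x\<leftarrow>xs. f x)"
proof (induction xs)
  case (Cons a xs)
  then show ?case by (cases "xs = []") (auto intro: add_pos_pos)
qed simp

lemma string_shape_less:
  assumes "string_shape X i m f" "k \<in> supp f" "k \<noteq> m" and d: "\<And>n. 0 < pairing d (A_monom X i n)"
  shows "pairing d k < pairing d m"
proof -
  obtain xs where xs: "xs \<noteq> []" "k = m - (\<Sum>x\<leftarrow>xs. A_monom X i x)"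
    using string_shape_supp[OF assms(1-3)] by blast
  have "0 < (\<Sum>x\<leftarrow>xs. pairing d (A_monom X i x))" using xs(1) d by (rule sum_list_pos)
  then show ?thesis unfolding xs(2) by (simp add: pairing_diff pairing_sum_list)
qed

text \<open>The monomial \<open>m\<close> cannot recur among the lower terms: a nonempty sum of
  \<open>A_monom X i\<close> has positive \<open>wt i\<close>.\<close>

lemma string_shape_lead:
  assumes "string_shape X i m f"
  shows "cf f m = 1"
proof (rule ccontr)
  assume "cf f m \<noteq> 1"
  then have "m \<in> supp (f - of_monom m)" by (simp add: in_keys_iff lookup_minus lookup_of_monom)
  then obtain xs where xs: "xs \<noteq> []" "m = m - (\<Sum>x\<leftarrow>xs. A_monom X i x)"
    using assms unfolding string_shape_def by blast
  have "0 < (\<Sum>x\<leftarrow>xs. wt i (A_monom X i x))"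
    using xs(1) by (rule sum_list_pos) (simp add: wt_A_monom_self)
  moreover have "wt i m = wt i m - (\<Sum>x\<leftarrow>xs. wt i (A_monom X i x))"
    using arg_cong[OF xs(2), of "wt i"] by (simp only: wt_simps)
  ultimately show False by simp
qed

lemma exists_string:
  assumes "i \<in> verts X" "m \<in> monoms X" "idom i m"
  shows "\<exists>e\<in>corner_factor X i. string_shape X i m e"
proof -
  define P where "P m e \<longleftrightarrow> string_shape X i m e \<and> e \<in> corner_factor X i" for m e
  have one: "P 0 1"
    using string_shape_of_monom[of i 0 X] corner_const[of 1 X i] by (simp add: P_def const_def)
  have mult: "P (a + b) (e * f)" if "P a e" "P b f" for a b e f
    using that string_shape_mult corner_mult unfolding P_def by blast
  have gen: "of_monom (Y_monom j n) \<in> corner_factor X i" "of_monom (- Y_monom j n) \<in> corner_factor X i"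
    if "j \<in> verts X - {i}" for j n
    unfolding corner_factor_def by (rule generate_ring.incl; use that in blast)+
  have "\<exists>e. P m e"
  proof (rule exists_for_monom[of P, OF one mult])
    fix k assume k: "k \<in> supp m"
    obtain j n where jn: "k = (j, n)" by (cases k)
    have j: "j \<in> verts X" using supp_monoms[OF assms(2) k] jn by simp
    let ?c = "cf m k"
    show "\<exists>e. P (Poly_Mapping.single k ?c) e"
    proof (cases "j = i")
      case True
      let ?T = "of_monom (Y_monom i n) * (1 + of_monom (- A_monom X i (n + 1)))"
      have "?T \<in> corner_factor X i"
        unfolding corner_factor_def by (rule generate_ring.incl) blast
      moreover have T: "?T - of_monom (Poly_Mapping.single k 1) =
          of_monom (Poly_Mapping.single k 1 - (\<Sum>x\<leftarrow>[n + 1]. A_monom X i x))"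
        using True jn by (simp add: Y_monom_def distrib_left of_monom_add[symmetric])
      then have "string_shape X i (Poly_Mapping.single k 1) ?T"
        unfolding string_shape_def T supp_of_monom using True jn
        by (auto simp: wt_single intro!: exI[of _ "[n + 1]"])
      ultimately have "P (Poly_Mapping.single k 1) ?T" unfolding P_def by blast
      from power_for_monom[of P, OF one mult this, of "nat ?c"] show ?thesis
        using assms(3) True jn unfolding idom_def by auto
    next
      case False
      have "P (Poly_Mapping.single k 1) (of_monom (Y_monom j n))"
        "P (Poly_Mapping.single k (- 1)) (of_monom (- Y_monom j n))"
        using False j jn gen[of j n]
        by (auto simp: P_def Y_monom_def single_uminus[symmetric] wt_single intro!: string_shape_of_monom)
      from power_for_monom[of P, OF one mult this(1), of "nat ?c"]
        power_for_monom[of P, OF one mult this(2), of "nat (- ?c)"]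
      show ?thesis by (cases "0 \<le> ?c") auto
    qed
  qed
  then show ?thesis unfolding P_def by blast
qed

section \<open>Expansion of the kernel in strings\<close>

definition E_string :: "dynkin \<Rightarrow> nat \<Rightarrow> monom \<Rightarrow> laurent" where
  "E_string X i m = (SOME e. e \<in> corner_factor X i \<and> string_shape X i m e)"

lemma E_string:
  assumes "i \<in> verts X" "m \<in> monoms X" "idom i m"
  shows "E_string X i m \<in> corner_factor X i" "string_shape X i m (E_string X i m)"
  using someI_ex[of "\<lambda>e. e \<in> corner_factor X i \<and> string_shape X i m e"] exists_string[OF assms]
  unfolding E_string_def by blast+

definition string_span :: "dynkin \<Rightarrow> nat \<Rightarrow> laurent set" where
  "string_span X i = lincomb (E_string X i) ` {l. \<forall>m\<in>supp l. m \<in> monoms X \<and> idom i m}"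

lemma string_span_corner:
  assumes "i \<in> verts X"
  shows "string_span X i \<subseteq> corner_factor X i"
proof
  fix f assume "f \<in> string_span X i"
  then obtain l where l: "\<forall>m\<in>supp l. m \<in> monoms X \<and> idom i m" "f = lincomb (E_string X i) l"
    unfolding string_span_def by blast
  have "(\<Sum>m\<in>S. const (cf l m) * E_string X i m) \<in> corner_factor X i" if "S \<subseteq> supp l" for S
    using finite_subset[OF that finite_keys] that
  proof (induction S rule: finite_induct)
    case empty
    then show ?case using corner_const[of 0 X i] by (simp add: const_def)
  next
    case (insert m S)
    then show ?case
      using l(1) by (auto intro!: corner_add corner_mult corner_const E_string assms)
  qed
  then show "f \<in> corner_factor X i" unfolding l(2) lincomb_def by blast
qed

text \<open>Strings are subtracted from the top in \<open>wt i\<close>. This ends because dominant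
  monomials have nonnegative weight, and a remainder without dominant monomials is 0 by
  \<open>ker_dominant\<close>.\<close>

lemma ker_subset_string_span:
  assumes i: "i \<in> verts X"
  shows "ker_screening X i \<subseteq> string_span X i"
proof (rule triangular_span[where deg = "wt i" and G = "idom i"])
  show "string_span X i \<subseteq> ker_screening X i"
    using string_span_corner[OF i] corner_subset_ker[OF i] by blast
  show "0 \<in> string_span X i"
    unfolding string_span_def by (rule image_eqI[of _ _ 0]) (simp_all add: lincomb_def)
  show "f + g \<in> string_span X i" if fg: "f \<in> string_span X i" "g \<in> string_span X i" for f g
  proof -
    obtain l l' where l: "\<forall>m\<in>supp l. m \<in> monoms X \<and> idom i m" "f = lincomb (E_string X i) l"
      "\<forall>m\<in>supp l'. m \<in> monoms X \<and> idom i m" "g = lincomb (E_string X i) l'"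
      using fg unfolding string_span_def by blast
    show ?thesis unfolding string_span_def l(2,4) lincomb_add[symmetric]
      by (rule imageI) (use l(1,3) in \<open>auto elim!: supp_addE\<close>)
  qed
  show "const c * f \<in> string_span X i" if f: "f \<in> string_span X i" for f c
  proof -
    obtain l where l: "\<forall>m\<in>supp l. m \<in> monoms X \<and> idom i m" "f = lincomb (E_string X i) l"
      using f unfolding string_span_def by blast
    show ?thesis unfolding string_span_def l(2) lincomb_const[symmetric]
      by (rule imageI) (use l(1) in \<open>auto simp: in_keys_iff\<close>)
  qed
  show "\<exists>m\<in>supp f. idom i m" if "f \<in> ker_screening X i" "f \<noteq> 0" for f
    using ker_dominant[OF that] .
  show "0 \<le> wt i m \<and> (\<exists>e\<in>string_span X i. cf e m = 1 \<and> (\<forall>k\<in>supp e. k = m \<or> wt i k < wt i m))"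
    if "f \<in> ker_screening X i" "m \<in> supp f" "idom i m" for m f
  proof (intro conjI bexI)
    have m: "m \<in> monoms X" using ker_supp that by blast
    note E = E_string(2)[OF i m that(3)]
    show "0 \<le> wt i m" using idom_wt that by blast
    show "cf (E_string X i m) m = 1" using string_shape_lead[OF E] .
    show "\<forall>k\<in>supp (E_string X i m). k = m \<or> wt i k < wt i m"
      using string_shape_less[OF E, where d = "\<lambda>j. of_bool (j = i)"] wt_A_monom_self
      unfolding wt_def by fastforce
    show "E_string X i m \<in> string_span X i"
      unfolding string_span_def
      by (rule image_eqI[of _ _ "of_monom m"]) (use m that in \<open>auto simp: lincomb_single\<close>)
  qed
qed (rule ker_diff)

theorem corner_factor_eq_ker: "i \<in> verts X \<Longrightarrow> corner_factor X i = ker_screening X i"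
  using ker_subset_string_span string_span_corner corner_subset_ker by blast

text \<open>Expand \<open>f\<close> in strings. An index \<open>b\<close> of the largest degree
  \<open>M\<close> occurs in no other string, so it survives in \<open>f\<close>, and
  \<open>M\<close> is at most the degree of \<open>m\<close>. On the other hand \<open>m\<close>
  occurs in the string of some index \<open>k\<close>; if it were not \<open>k\<close> itself, it
  would lie strictly below \<open>M\<close>. The grading \<open>d\<close> need not depend on
  \<open>i\<close>, which allows one top monomial to be tested at all vertices.\<close>

lemma top_monomial_idom:
  assumes i: "i \<in> verts X" and d: "\<And>n. 0 < pairing d (A_monom X i n)"
    and f: "f \<in> ker_screening X i" and m: "m \<in> supp f"
    and top: "\<And>k. k \<in> supp f \<Longrightarrow> pairing d k \<le> pairing d m"
  shows "idom i m"
proof -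
  obtain l where l: "\<And>k. k \<in> supp l \<Longrightarrow> k \<in> monoms X \<and> idom i k" "f = lincomb (E_string X i) l"
    using ker_subset_string_span[OF i] f unfolding string_span_def by blast
  note E = E_string(2)[OF i] 
  have E_less: "pairing d b < pairing d a"
    if "a \<in> supp l" "b \<in> supp (E_string X i a)" "b \<noteq> a" for a b
    using string_shape_less[OF E _ _ d] l(1) that by blast
  have "cf f m \<noteq> 0" using m by (simp add: in_keys_iff)
  then obtain k where k: "k \<in> supp l" "cf (E_string X i k) m \<noteq> 0"
    unfolding l(2) lookup_lincomb by (metis (no_types, lifting) mult_eq_0_iff sum.neutral)
  define M where "M = Max (pairing d ` supp l)"
  have M: "pairing d a \<le> M" if "a \<in> supp l" for a using that unfolding M_def by simp
  have "M \<in> pairing d ` supp l" unfolding M_def using k by (intro Max_in) auto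
  then obtain b where b: "b \<in> supp l" "pairing d b = M" by blast
  have "cf f b = (\<Sum>a\<in>supp l. if a = b then cf l b else 0)"
    unfolding l(2) lookup_lincomb
  proof (rule sum.cong[OF refl])
    fix a assume a: "a \<in> supp l"
    have "b \<notin> supp (E_string X i a)" if "a \<noteq> b" using E_less[OF a, of b] M[OF a] b(2) that by auto
    then show "cf l a * cf (E_string X i a) b = (if a = b then cf l b else 0)"
      using string_shape_lead[OF E, of b] l(1)[OF b(1)] by (auto simp: in_keys_iff)
  qed
  then have "b \<in> supp f" using b by (simp add: in_keys_iff)
  then have "M \<le> pairing d m" using top b by blast
  then have "m = k" using E_less[OF k(1), of m] M[OF k(1)] k(2) by (auto simp: in_keys_iff)
  then show ?thesis using l(1) k(1) by blast
qed

section \<open>Elements of the intersection with a given highest monomial\<close>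

text \<open>By \<open>d_cartan\<close> every \<open>A\<^sub>i\<close> has positive degree. Together
  with \<open>d_pos\<close> and the signs of the Cartan matrix this also yields the definiteness in
  \<open>quadratic_form_bound\<close>.\<close>

locale simply_laced_weights =
  fixes X :: dynkin and d :: "nat \<Rightarrow> int"
  assumes verts_nonempty: "verts X \<noteq> {}"
    and cartan_sym: "\<And>i j. i \<in> verts X \<Longrightarrow> j \<in> verts X \<Longrightarrow> cartan X i j = cartan X j i"
    and cartan_offdiag: "\<And>i j. i \<in> verts X \<Longrightarrow> j \<in> verts X \<Longrightarrow> i \<noteq> j \<Longrightarrow> cartan X i j \<in> {0, -1}"
    and d_pos: "\<And>i. i \<in> verts X \<Longrightarrow> 0 < d i"
    and d_cartan: "\<And>i. i \<in> verts X \<Longrightarrow> 0 < (\<Sum>j\<in>verts X. d j * cartan X j i)"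
begin

abbreviation deg :: "monom \<Rightarrow> int" where
  "deg \<equiv> pairing d"

lemma deg_A: "i \<in> verts X \<Longrightarrow> 0 < deg (A_monom X i n)"
  by (simp add: pairing_A_monom' d_cartan)

text \<open>This forces the coefficient 1 at \<open>m\<close>, since \<open>m\<close> does not have
  smaller degree than itself.\<close>

definition lead :: "monom \<Rightarrow> laurent \<Rightarrow> bool" where
  "lead m f \<longleftrightarrow> (\<forall>k\<in>supp (f - of_monom m). deg k < deg m)"

lemma lead_lookup:
  assumes "lead m f" "deg m \<le> deg k"
  shows "cf f k = of_bool (k = m)"
proof -
  have "k \<notin> supp (f - of_monom m)" using assms unfolding lead_def by fastforce
  then show ?thesis by (simp add: in_keys_iff lookup_minus lookup_of_monom)
qed

lemma lead_supp: "lead m f \<Longrightarrow> k \<in> supp f \<Longrightarrow> k = m \<or> deg k < deg m"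
  using lead_lookup[of m f k] by (force simp: in_keys_iff)

lemma lead_mult:
  assumes "lead a e" "lead b f"
  shows "lead (a + b) (e * f)"
  unfolding lead_def
proof
  fix k assume k: "k \<in> supp (e * f - of_monom (a + b))"
  let ?e = "e - of_monom a" and ?f = "f - of_monom b"
  have *: "e * f - of_monom (a + b) = ?e * ?f + (?e * of_monom b + of_monom a * ?f)"
    by (simp add: of_monom_add algebra_simps)
  show "deg k < deg (a + b)"
    using k assms unfolding * lead_def
    by (elim supp_addE supp_multE) (auto simp: pairing_add intro: add_strict_mono)
qed

lemma string_lead:
  assumes "i \<in> verts X" "string_shape X i m f"
  shows "lead m f"
  unfolding lead_def
proof
  fix k assume k: "k \<in> supp (f - of_monom m)"
  then have "k \<noteq> m" 
    using string_shape_lead[OF assms(2)] by (auto simp: in_keys_iff lookup_minus lookup_of_monom)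
  moreover from this have "k \<in> supp f" using k by (simp add: in_keys_iff lookup_minus lookup_of_monom)
  ultimately show "deg k < deg m"
    using string_shape_less[OF assms(2)] deg_A[OF assms(1)] by blast
qed

text \<open>Lower terms start strictly below \<open>p\<close>, so from degree \<open>p\<close>
  upwards only the leading terms are visible. Thus all corrections of one degree can be made at once
  without disturbing what was settled above.\<close>

lemma lookup_level_sum:
  assumes "finite L" "\<And>m. m \<in> L \<Longrightarrow> lead m (e m) \<and> deg m = p" "p \<le> deg k"
  shows "cf (\<Sum>m\<in>L. const (c m) * e m) k = (if k \<in> L then c k else 0)"
proof -
  have "cf (\<Sum>m\<in>L. const (c m) * e m) k = (\<Sum>m\<in>L. if m = k then c k else 0)"
    unfolding lookup_sum lookup_const_mult
  proof (rule sum.cong[OF refl])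
    fix m assume "m \<in> L"
    then show "c m * cf (e m) k = (if m = k then c k else 0)"
      using assms(2)[of m] assms(3) lead_lookup[of m "e m" k] by auto
  qed
  then show ?thesis using assms(1) by simp
qed

subsection \<open>Rank two\<close>

text \<open>In type \<open>A\<^sub>2\<close> the element is the fundamental character
  \<open>Y\<^sub>i(1 + A\<^sub>i\<^sup>-\<^sup>1(1 + A\<^sub>j\<^sup>-\<^sup>1))\<close>, in type \<open>A\<^sub>1 \<times> A\<^sub>1\<close> it is \<open>Y\<^sub>i(1 + A\<^sub>i\<^sup>-\<^sup>1)\<close>.\<close>

lemma rank_two_variable:
  assumes i: "i \<in> verts X" and j: "j \<in> verts X" and "i \<noteq> j"
  shows "\<exists>e \<in> ker_screening X i \<inter> ker_screening X j. lead (Y_monom i n) e"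
proof -
  define y where "y = Y_monom i n"
  define y1 where "y1 = y - A_monom X i (n + 1)"
  define y2 where "y2 = y1 - A_monom X j (n + 2)"
  have y: "cf y (i, k) = of_bool (k = n)" "cf y (j, k) = 0" for k
    using \<open>i \<noteq> j\<close> by (auto simp: y_def Y_monom_def lookup_single when_def)
  have mon: "y \<in> monoms X" "y1 \<in> monoms X" "y2 \<in> monoms X"
    unfolding y2_def y1_def y_def Y_monom_def using i j by (intro monoms_diff monoms_single monoms_A; simp)+
  have deg: "deg y1 < deg y" "deg y2 < deg y"
    using deg_A[OF i, of "n + 1"] deg_A[OF j, of "n + 2"] by (simp_all add: y1_def y2_def pairing_diff)
  have s: "of_monom y + of_monom y1 = of_monom y * (1 + of_monom (- A_monom X i (n + 1)))"
    by (simp add: y1_def of_monom_add[symmetric] distrib_left)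
  have ker_i: "of_monom y + of_monom y1 \<in> ker_screening X i"
    unfolding s by (rule ker_string[OF mon(1) i y(1)])
  have c1: "cf y1 (j, k) = (if k = n + 1 then - cartan X i j else 0)" for k
    using i j \<open>i \<noteq> j\<close> cartan_sym[OF i j] by (auto simp: y1_def lookup_minus y lookup_A_monom)
  consider "cartan X i j = 0" | "cartan X i j = -1" using cartan_offdiag[OF i j \<open>i \<noteq> j\<close>] by blast
  then have "\<exists>e \<in> ker_screening X i \<inter> ker_screening X j. lead y e"
  proof cases
    case 1
    have "of_monom y + of_monom y1 \<in> ker_screening X j"
      by (intro ker_add ker_of_monom mon y) (simp add: c1 1)
    moreover have "lead y (of_monom y + of_monom y1)" using deg by (simp add: lead_def)
    ultimately show ?thesis using ker_i by blast
  next
    case 2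
    \<comment> \<open>The inverse of the variable \<open>(i, n + 2)\<close> in \<open>y1\<close> is
      cancelled on division by the \<open>A_monom\<close> of \<open>j\<close> at
      \<open>n + 2\<close>.\<close>
    have "cf y2 (i, k) = 0" for k
      using i j \<open>i \<noteq> j\<close> 2 by (auto simp: y2_def y1_def lookup_minus y lookup_A_monom)
    then have "of_monom y + of_monom y1 + of_monom y2 \<in> ker_screening X i"
      by (intro ker_add[OF ker_i] ker_of_monom mon)
    moreover have "of_monom y1 * (1 + of_monom (- A_monom X j ((n + 1) + 1))) \<in> ker_screening X j"
      by (intro ker_string mon j) (simp add: c1 2)
    then have "of_monom y1 + of_monom y2 \<in> ker_screening X j"
      by (simp add: y2_def of_monom_add[symmetric] distrib_left add.assoc)
    then have "of_monom y + of_monom y1 + of_monom y2 \<in> ker_screening X j"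
      using ker_add[OF ker_of_monom[OF mon(1) y(2)]] by (simp add: add.assoc)
    moreover have "lead y (of_monom y + of_monom y1 + of_monom y2)"
      unfolding lead_def using deg by (auto simp: add.assoc elim!: supp_addE)
    ultimately show ?thesis by blast
  qed
  then show ?thesis unfolding y_def .
qed

lemma rank_two_element:
  assumes i: "i \<in> verts X" and j: "j \<in> verts X" and ne: "i \<noteq> j"
    and m: "m \<in> monoms X" "idom i m" "idom j m"
  shows "\<exists>e \<in> ker_screening X i \<inter> ker_screening X j. lead m e"
proof -
  define P where "P m e \<longleftrightarrow> e \<in> ker_screening X i \<inter> ker_screening X j \<and> lead m e" for m e
  have one: "P 0 1" using ker_one by (simp add: P_def lead_def)
  have mult: "P (a + b) (e * f)" if "P a e" "P b f" for a b e f
    using that lead_mult ker_mult unfolding P_def by blast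
  have "\<exists>e. P m e"
  proof (rule exists_for_monom[of P, OF one mult])
    fix k assume k: "k \<in> supp m"
    obtain l n where ln: "k = (l, n)" by (cases k)
    have l: "l \<in> verts X" using supp_monoms[OF m(1) k] ln by simp
    show "\<exists>e. P (Poly_Mapping.single k (cf m k)) e"
    proof (cases "l \<in> {i, j}")
      case True
      have "\<exists>e. P (Poly_Mapping.single k 1) e"
        using True rank_two_variable[OF i j ne, of n] rank_two_variable[OF j i ne[symmetric], of n]
        unfolding ln P_def Y_monom_def by blast
      then obtain e where "P (Poly_Mapping.single k 1) e" by blast
      from power_for_monom[of P, OF one mult this, of "nat (cf m k)"] show ?thesis
        using m(2,3) True ln unfolding idom_def by auto
    next
      case False
      have "of_monom (Poly_Mapping.single k (cf m k)) \<in> ker_screening X i \<inter> ker_screening X j"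
        using False ln l by (auto intro!: ker_of_monom monoms_single simp: lookup_single)
      then show ?thesis unfolding P_def by (auto simp: lead_def)
    qed
  qed
  then show ?thesis unfolding P_def by blast
qed

text \<open>The common element is built degree by degree downwards. As \<open>g\<close> and
  \<open>h\<close> agree, a top discrepancy of \<open>G\<close> is one with both of them, hence
  dominant for \<open>i\<close> and for \<open>j\<close> by \<open>top_monomial_idom\<close>, and
  \<open>rank_two_element\<close> supplies the correction.\<close>

lemma rank_two_interpolation:
  assumes i: "i \<in> verts X" and j: "j \<in> verts X" and ne: "i \<noteq> j"
    and gi: "g \<in> ker_screening X i" and gj: "h \<in> ker_screening X j"
    and agree: "\<And>m. n \<le> deg m \<Longrightarrow> cf g m = cf h m"
  shows "\<exists>G \<in> ker_screening X i \<inter> ker_screening X j. \<forall>m. n \<le> deg m \<longrightarrow> cf G m = cf g m"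
proof -
  define N where "N = Max (insert 0 (deg ` supp g))"
  have N: "deg m \<le> N" if "m \<in> supp g" for m using that unfolding N_def by simp
  have "\<exists>G \<in> ker_screening X i \<inter> ker_screening X j.
      \<forall>m. n \<le> deg m \<and> N - int k < deg m \<longrightarrow> cf G m = cf g m" for k
  proof (induction k)
    case 0
    have "cf 0 m = cf g m" if "N - int 0 < deg m" for m
      using N[of m] that by (force simp: in_keys_iff)
    then show ?case by (intro bexI[of _ 0]) (auto intro: ker_zero)
  next
    case (Suc k)
    then obtain G where G: "G \<in> ker_screening X i" "G \<in> ker_screening X j"
      "\<And>m. n \<le> deg m \<Longrightarrow> N - int k < deg m \<Longrightarrow> cf G m = cf g m" by blast
    define L where "L = {m \<in> supp (g - G). deg m = N - int k \<and> n \<le> deg m}"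
    have fin: "finite L" unfolding L_def by simp
    have "\<exists>e \<in> ker_screening X i \<inter> ker_screening X j. lead m e" if m: "m \<in> L" for m
    proof (rule rank_two_element[OF i j ne])
      have m': "m \<in> supp (g - G)" "deg m = N - int k" "n \<le> deg m" using m unfolding L_def by auto
      have m'': "m \<in> supp (h - G)" using m'(1) agree[OF m'(3)] by (simp add: in_keys_iff lookup_minus)
      show "m \<in> monoms X" using ker_supp[OF ker_diff[OF gi G(1)] m'(1)] .
      show "idom i m"
      proof (rule top_monomial_idom[OF i deg_A[OF i] ker_diff[OF gi G(1)] m'(1)], rule ccontr)
        fix b assume "b \<in> supp (g - G)" "\<not> deg b \<le> deg m"
        then show False using G(3)[of b] m' by (simp add: in_keys_iff lookup_minus)
      qed
      show "idom j m"
      proof (rule top_monomial_idom[OF j deg_A[OF j] ker_diff[OF gj G(2)] m''], rule ccontr)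
        fix b assume "b \<in> supp (h - G)" "\<not> deg b \<le> deg m"
        then show False using G(3)[of b] m' agree[of b] by (simp add: in_keys_iff lookup_minus)
      qed
    qed
    then obtain e where e: "\<And>m. m \<in> L \<Longrightarrow> e m \<in> ker_screening X i"
      "\<And>m. m \<in> L \<Longrightarrow> e m \<in> ker_screening X j" "\<And>m. m \<in> L \<Longrightarrow> lead m (e m)"
      by (metis IntE)
    define F where "F = (\<Sum>m\<in>L. const (cf (g - G) m) * e m)"
    have F: "cf F m = (if m \<in> L then cf (g - G) m else 0)" if "N - int k \<le> deg m" for m
      unfolding F_def by (rule lookup_level_sum[OF fin]) (use e(3) that in \<open>auto simp: L_def\<close>)
    have "cf (G + F) m = cf g m" if "n \<le> deg m" "N - int (Suc k) < deg m" for m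
    proof (cases "deg m = N - int k")
      case True
      then show ?thesis using that F[of m]
        by (auto simp: L_def lookup_add lookup_minus in_keys_iff)
    next
      case False
      then show ?thesis using that F[of m] G(3)[of m] by (auto simp: L_def lookup_add)
    qed
    moreover have "G + F \<in> ker_screening X i" "G + F \<in> ker_screening X j"
      unfolding F_def by (intro ker_add ker_sum ker_mult ker_const G e; assumption)+
    ultimately show ?case by blast
  qed
  from this[of "nat (N - n + 1)"] obtain G where G: "G \<in> ker_screening X i \<inter> ker_screening X j"
    "\<And>m. n \<le> deg m \<Longrightarrow> N - int (nat (N - n + 1)) < deg m \<Longrightarrow> cf G m = cf g m" by blast
  have "cf G m = cf g m" if "n \<le> deg m" for m by (rule G(2)) (use that in auto)
  then show ?thesis using G(1) by blast
qed

text \<open>This is the consistency of the algorithm. Interpolate the common part above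
  \<open>m\<close> by an element \<open>G\<close> of both kernels. If \<open>G\<close> differed from
  \<open>g i\<close> at \<open>m\<close>, then \<open>m\<close> would be a top monomial of the
  difference and hence dominant for \<open>i\<close>; the same holds for \<open>j\<close>. So both
  coefficients are that of \<open>G\<close>.\<close>

lemma non_idom_agree:
  assumes i: "i \<in> verts X" and j: "j \<in> verts X"
    and g: "\<And>i. i \<in> verts X \<Longrightarrow> g i \<in> ker_screening X i"
    and agree: "\<And>b. deg m < deg b \<Longrightarrow> cf (g i) b = cf (g j) b"
    and m: "\<not> idom i m" "\<not> idom j m"
  shows "cf (g i) m = cf (g j) m"
proof (cases "i = j")
  case False
  have "deg m + 1 \<le> deg b \<Longrightarrow> cf (g i) b = cf (g j) b" for b using agree by simp
  from rank_two_interpolation[OF i j False g[OF i] g[OF j] this]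
  obtain G where G: "G \<in> ker_screening X i" "G \<in> ker_screening X j"
    "\<And>b. deg m + 1 \<le> deg b \<Longrightarrow> cf G b = cf (g i) b" by blast
  have "cf (G - g l) m = 0" if l: "l \<in> {i, j}" for l
  proof (rule ccontr)
    assume "cf (G - g l) m \<noteq> 0"
    then have ml: "m \<in> supp (G - g l)" by (simp add: in_keys_iff)
    have l': "l \<in> verts X" using l i j by blast
    have k: "G - g l \<in> ker_screening X l" using l G(1,2) g[OF l'] ker_diff by auto
    have "idom l m"
    proof (rule top_monomial_idom[OF l' deg_A[OF l'] k ml], rule ccontr)
      fix b assume "b \<in> supp (G - g l)" "\<not> deg b \<le> deg m"
      then show False using G(3)[of b] agree[of b] l by (auto simp: in_keys_iff lookup_minus)
    qed
    then show False using m l by blast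
  qed
  from this[of i] this[of j] show ?thesis by (simp add: lookup_minus)
qed simp

subsection \<open>The Frenkel-Mukhin algorithm\<close>

text \<open>One partial solution per factor of the intersection; they agree down to a given degree.
  The coefficients of the monomials of the next degree are determined by any of the factors for
  which the monomial is not dominant.\<close>

lemma algorithm:
  assumes R: "R \<subseteq> monoms X"
    and closed: "\<And>i k. i \<in> verts X \<Longrightarrow> k \<in> R \<Longrightarrow> idom i k \<Longrightarrow> supp (E_string X i k) \<subseteq> R"
    and m0: "m0 \<in> R" "\<And>i. i \<in> verts X \<Longrightarrow> idom i m0"
  shows "\<exists>g. (\<forall>i\<in>verts X. g i \<in> ker_screening X i \<and> supp (g i) \<subseteq> R \<and> lead m0 (g i)) \<and>
    (\<forall>i\<in>verts X. \<forall>j\<in>verts X. \<forall>m. deg m0 - int p \<le> deg m \<longrightarrow> cf (g i) m = cf (g j) m)"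
proof (induction p)
  case 0
  have E: "E_string X i m0 \<in> ker_screening X i" "lead m0 (E_string X i m0)" if i: "i \<in> verts X" for i
    using E_string[OF i _ m0(2)[OF i]] m0(1) R corner_subset_ker[OF i] string_lead[OF i] i by blast+
  have "cf (E_string X i m0) m = of_bool (m = m0)" if "i \<in> verts X" "deg m0 - int 0 \<le> deg m" for i m
    using lead_lookup[OF E(2)] that by simp
  then show ?case using E closed m0 by (intro exI[of _ "\<lambda>i. E_string X i m0"]) auto
next
  case (Suc p)
  then obtain g where g: "\<And>i. i \<in> verts X \<Longrightarrow> g i \<in> ker_screening X i"
    "\<And>i. i \<in> verts X \<Longrightarrow> supp (g i) \<subseteq> R" "\<And>i. i \<in> verts X \<Longrightarrow> lead m0 (g i)"
    "\<And>i j m. i \<in> verts X \<Longrightarrow> j \<in> verts X \<Longrightarrow> deg m0 - int p \<le> deg m \<Longrightarrow> cf (g i) m = cf (g j) m"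
    by blast
  define q where "q = deg m0 - int (Suc p)"
  define M where "M = {m \<in> (\<Union>i\<in>verts X. supp (g i)). deg m = q}"
  \<comment> \<open>The choice of the vertex is immaterial by \<open>non_idom_agree\<close>. A
    monomial dominant for all vertices is constrained by none of them and receives the value
    0.\<close>
  define c where "c m = (if \<exists>i\<in>verts X. \<not> idom i m
    then cf (g (SOME i. i \<in> verts X \<and> \<not> idom i m)) m else 0)" for m
  define L where "L i = {m \<in> M. idom i m}" for i
  \<comment> \<open>Where the monomial is dominant for \<open>i\<close>, a multiple of its string
    moves the coefficient to \<open>c m\<close>; elsewhere the coefficient already has this
    value.\<close>
  define F where "F i = (\<Sum>m\<in>L i. const (c m - cf (g i) m) * E_string X i m)" for i
  have fin: "finite (L i)" for i unfolding L_def M_def by simp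
  have L_R: "m \<in> R" if "m \<in> L i" for i m using that g(2) unfolding L_def M_def by blast
  have E: "E_string X i m \<in> ker_screening X i" "lead m (E_string X i m)" 
    if i: "i \<in> verts X" and m: "m \<in> L i" for i m
  proof -
    have "m \<in> monoms X" "idom i m" using R L_R[OF m] m unfolding L_def by auto
    from E_string[OF i this] show "E_string X i m \<in> ker_screening X i" "lead m (E_string X i m)"
      using corner_subset_ker[OF i] string_lead[OF i] by blast+
  qed
  have F: "cf (F i) m = (if m \<in> L i then c m - cf (g i) m else 0)"
    if "i \<in> verts X" "q \<le> deg m" for i m
    unfolding F_def by (rule lookup_level_sum[OF fin]) (use E(2) that in \<open>auto simp: L_def M_def\<close>)
  have F_supp: "\<exists>b\<in>L i. m \<in> supp (E_string X i b)" if "m \<in> supp (F i)" for i m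
  proof -
    have "cf (F i) m \<noteq> 0" using that by (simp add: in_keys_iff)
    then obtain b where "b \<in> L i" "cf (E_string X i b) m \<noteq> 0"
      unfolding F_def lookup_sum lookup_const_mult by (metis (no_types, lifting) mult_eq_0_iff sum.neutral)
    then show ?thesis by (auto simp: in_keys_iff)
  qed
  have c: "cf (g i) m = c m" if i: "i \<in> verts X" "\<not> idom i m" and m: "deg m = q" for i m
  proof -
    define j where "j = (SOME i. i \<in> verts X \<and> \<not> idom i m)"
    have j: "j \<in> verts X" "\<not> idom j m" unfolding j_def using someI_ex i by (metis (mono_tags, lifting))+
    have "cf (g i) m = cf (g j) m"
      by (rule non_idom_agree[OF i(1) j(1) g(1)]) (use g(4)[OF i(1) j(1)] i j m in \<open>auto simp: q_def\<close>)
    then show ?thesis using i unfolding c_def j_def by auto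
  qed
  have new: "cf (g i + F i) m = (if q < deg m then cf (g i) m else if m \<in> M then c m else 0)"
    if i: "i \<in> verts X" and m: "q \<le> deg m" for i m
  proof (cases "q < deg m")
    case True
    then show ?thesis using F[OF i m] by (auto simp: lookup_add L_def M_def)
  next
    case False
    then have m': "deg m = q" using m by simp
    show ?thesis
    proof (cases "m \<in> M")
      case True
      then show ?thesis using F[OF i m] False c[OF i _ m'] by (auto simp: lookup_add L_def)
    next
      case nM: False
      then have "cf (g i) m = 0" using i m' unfolding M_def by (auto simp: in_keys_iff)
      then show ?thesis using F[OF i m] False nM by (simp add: lookup_add L_def)
    qed
  qed
  have "g i + F i \<in> ker_screening X i \<and> supp (g i + F i) \<subseteq> R \<and> lead m0 (g i + F i)"
    if i: "i \<in> verts X" for i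
  proof (intro conjI)
    show "g i + F i \<in> ker_screening X i"
      unfolding F_def by (intro ker_add ker_sum ker_mult ker_const g E i)
    show "supp (g i + F i) \<subseteq> R"
    proof
      fix m assume "m \<in> supp (g i + F i)"
      then show "m \<in> R"
      proof (rule supp_addE)
        assume "m \<in> supp (F i)"
        then obtain b where "b \<in> L i" "m \<in> supp (E_string X i b)" using F_supp by blast
        then show "m \<in> R" using closed[OF i L_R] by (auto simp: L_def)
      qed (use g(2)[OF i] in blast)
    qed
    show "lead m0 (g i + F i)"
      unfolding lead_def
    proof
      fix m assume "m \<in> supp (g i + F i - of_monom m0)"
      then have "m \<in> supp ((g i - of_monom m0) + F i)" by (simp add: algebra_simps)
      then show "deg m < deg m0"
      proof (rule supp_addE)
        assume "m \<in> supp (g i - of_monom m0)"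
        then show ?thesis using g(3)[OF i] unfolding lead_def by blast
      next
        assume "m \<in> supp (F i)"
        then obtain b where b: "b \<in> L i" "m \<in> supp (E_string X i b)" using F_supp by blast
        then have "deg m \<le> deg b" using lead_supp[OF E(2)[OF i b(1)] b(2)] by auto
        then show ?thesis using b(1) unfolding L_def M_def q_def by auto
      qed
    qed
  qed
  moreover have "cf (g i + F i) m = cf (g j + F j) m"
    if "i \<in> verts X" "j \<in> verts X" "deg m0 - int (Suc p) \<le> deg m" for i j m
    using new[OF that(1)] new[OF that(2)] that(3) g(4)[OF that(1,2), of m] unfolding q_def by auto
  ultimately show ?case by (intro exI[of _ "\<lambda>i. g i + F i"]) blast
qed

subsection \<open>Finiteness\<close>

text \<open>For \<open>\<mu> = \<Lambda> - \<Sum>\<^sub>i v\<^sub>i \<alpha>\<^sub>i\<close> this is \<open>(\<mu>, \<mu>) - (\<Lambda>, \<Lambda>)\<close>.\<close>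

definition norm_defect :: "(nat \<Rightarrow> int) \<Rightarrow> (nat \<Rightarrow> int) \<Rightarrow> int" where
  "norm_defect \<Lambda> v = (\<Sum>i\<in>verts X. \<Sum>j\<in>verts X. v i * cartan X i j * v j)
    - 2 * (\<Sum>i\<in>verts X. \<Lambda> i * v i)"

text \<open>The monomials whose weight does not exceed that of \<open>m0\<close>, neither in the dominance order nor in norm.\<close>

definition region :: "monom \<Rightarrow> monom set" where
  "region m0 = {m \<in> monoms X. \<exists>v. (\<forall>i\<in>verts X. 0 \<le> v i) \<and>
     (\<forall>j\<in>verts X. wt j m = wt j m0 - (\<Sum>i\<in>verts X. cartan X j i * v i)) \<and>
     norm_defect (\<lambda>j. wt j m0) v \<le> 0}"

text \<open>Symmetry merges the two cross terms, and the diagonal entry 2 gives the square of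
  \<open>b\<close>. The increment vanishes for \<open>b = 0\<close> and when \<open>b\<close> is the
  pairing of the current weight with the coroot of \<open>i\<close>, where the step is the simple
  reflection; in between it is nonpositive.\<close>

lemma norm_defect_add:
  assumes i: "i \<in> verts X"
  shows "norm_defect \<Lambda> (\<lambda>j. v j + b * of_bool (j = i)) =
    norm_defect \<Lambda> v + 2 * b * (b - (\<Lambda> i - (\<Sum>j\<in>verts X. cartan X i j * v j)))"
proof -
  let ?V = "verts X" and ?d = "\<lambda>j. of_bool (j = i) :: int"
  have delta: "(\<Sum>j\<in>?V. ?d j * h j) = h i" for h
  proof -
    have "(\<Sum>j\<in>?V. ?d j * h j) = (\<Sum>j\<in>?V. if j = i then h i else 0)" by (intro sum.cong) auto
    then show ?thesis using i by simp
  qed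
  have sym: "(\<Sum>l\<in>?V. v l * cartan X l i) = (\<Sum>j\<in>?V. cartan X i j * v j)"
    using cartan_sym[OF i] by (intro sum.cong) auto
  have "(\<Sum>l\<in>?V. \<Sum>j\<in>?V. (v l + b * ?d l) * cartan X l j * (v j + b * ?d j)) =
      (\<Sum>l\<in>?V. \<Sum>j\<in>?V. v l * cartan X l j * v j) + b * (\<Sum>l\<in>?V. \<Sum>j\<in>?V. ?d j * (v l * cartan X l j))
      + b * (\<Sum>l\<in>?V. ?d l * (\<Sum>j\<in>?V. cartan X l j * v j))
      + b * b * (\<Sum>l\<in>?V. ?d l * (\<Sum>j\<in>?V. ?d j * cartan X l j))"
    unfolding sum_distrib_left sum.distrib[symmetric]
    by (intro sum.cong refl) (simp add: algebra_simps)
  also have "\<dots> = (\<Sum>l\<in>?V. \<Sum>j\<in>?V. v l * cartan X l j * v j)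
      + 2 * b * (\<Sum>j\<in>?V. cartan X i j * v j) + 2 * (b * b)"
    unfolding delta sym cartan_self by (simp add: algebra_simps)
  finally have 1: "(\<Sum>l\<in>?V. \<Sum>j\<in>?V. (v l + b * ?d l) * cartan X l j * (v j + b * ?d j)) = \<dots>" .
  have "(\<Sum>l\<in>?V. \<Lambda> l * (v l + b * ?d l)) = (\<Sum>l\<in>?V. \<Lambda> l * v l) + b * (\<Sum>l\<in>?V. ?d l * \<Lambda> l)"
    unfolding sum_distrib_left sum.distrib[symmetric]
    by (intro sum.cong refl) (simp add: algebra_simps)
  then have 2: "(\<Sum>l\<in>?V. \<Lambda> l * (v l + b * ?d l)) = (\<Sum>l\<in>?V. \<Lambda> l * v l) + b * \<Lambda> i"
    unfolding delta .
  show ?thesis unfolding norm_defect_def 1 2 by (simp add: algebra_simps)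
qed

text \<open>Going down an \<open>\<alpha>\<^sub>i\<close>-string from its top to its bottom does not increase the norm.\<close>

lemma region_closed:
  assumes i: "i \<in> verts X" and k: "k \<in> region m0" and "idom i k"
  shows "supp (E_string X i k) \<subseteq> region m0"
proof
  fix m assume m: "m \<in> supp (E_string X i k)"
  obtain v where v: "\<And>i. i \<in> verts X \<Longrightarrow> 0 \<le> v i"
    "\<And>j. j \<in> verts X \<Longrightarrow> wt j k = wt j m0 - (\<Sum>i\<in>verts X. cartan X j i * v i)"
    "norm_defect (\<lambda>j. wt j m0) v \<le> 0" and k': "k \<in> monoms X"
    using k unfolding region_def by blast
  note E = E_string(2)[OF i k' \<open>idom i k\<close>]
  show "m \<in> region m0"
  proof (cases "m = k")
    case False
    obtain xs where xs: "int (length xs) \<le> wt i k" "m = k - (\<Sum>x\<leftarrow>xs. A_monom X i x)"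
      using string_shape_supp[OF E m False] by blast
    let ?b = "int (length xs)"
    let ?v = "\<lambda>j. v j + ?b * of_bool (j = i)"
    have "m \<in> monoms X" unfolding xs(2) by (intro monoms_diff monoms_sum_list monoms_A k' i)
    moreover have "0 \<le> ?v j" if "j \<in> verts X" for j using v(1)[OF that] by simp
    moreover have "wt j m = wt j m0 - (\<Sum>l\<in>verts X. cartan X j l * ?v l)" if j: "j \<in> verts X" for j
    proof -
      have "(\<Sum>l\<in>verts X. cartan X j l * ?v l) =
          (\<Sum>l\<in>verts X. cartan X j l * v l) + (\<Sum>l\<in>verts X. if l = i then ?b * cartan X j i else 0)"
        unfolding sum.distrib[symmetric] by (intro sum.cong) (auto simp: algebra_simps)
      moreover have "(\<Sum>x\<leftarrow>xs. cartan X j i) = ?b * cartan X j i" by (simp add: sum_list_triv)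
      ultimately show ?thesis
        using v(2)[OF j] i unfolding xs(2) wt_simps by (simp add: wt_A_monom[OF i j])
    qed
    moreover have "norm_defect (\<lambda>j. wt j m0) ?v \<le> 0"
    proof -
      \<comment> \<open>The length bound in \<open>string_shape\<close> keeps the step between the
        weight and its reflection.\<close>
      have "?b * (?b - wt i k) \<le> 0" using xs(1) by (simp add: mult_nonneg_nonpos)
      then show ?thesis using norm_defect_add[OF i, of "\<lambda>j. wt j m0" v ?b] v(2)[OF i] v(3) by simp
    qed
    ultimately show ?thesis
      unfolding region_def mem_Collect_eq by (intro conjI exI[of _ ?v] ballI) simp_all
  qed (use k in simp)
qed

text \<open>Substituting multiples of \<open>d\<close> for \<open>v\<close>, the difference of the
  two sides is a sum over unordered pairs of the squares of \<open>d j * v i - d i * v j\<close>,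
  with factors \<open>- cartan X i j / (d i * d j)\<close>, which are nonnegative off the diagonal.
  The function \<open>h\<close> distributes this over ordered pairs, so only
  \<open>h i j + h j i\<close> has a sign.\<close>

lemma quadratic_form_bound:
  fixes v :: "nat \<Rightarrow> real"
  shows "(\<Sum>i\<in>verts X. (\<Sum>j\<in>verts X. d j * cartan X j i) / d i * (v i)\<^sup>2)
    \<le> (\<Sum>i\<in>verts X. \<Sum>j\<in>verts X. v i * cartan X i j * v j)"
proof -
  let ?V = "verts X"
  define h where "h i j = cartan X i j * (v i * v j - d j / d i * (v i)\<^sup>2)" for i j
  have "0 \<le> h i j + h j i" if i: "i \<in> ?V" and j: "j \<in> ?V" for i j
  proof (cases "i = j")
    case True
    then show ?thesis using d_pos[OF i] by (simp add: h_def power2_eq_square)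
  next
    case False
    define c where "c = real_of_int (cartan X i j)"
    have c: "c \<le> 0" using cartan_offdiag[OF i j False] unfolding c_def by auto
    have pos: "0 < real_of_int (d i)" "0 < real_of_int (d j)" using d_pos i j by auto
    have "h i j + h j i = c * (v i * v j - d j / d i * (v i)\<^sup>2) + c * (v j * v i - d i / d j * (v j)\<^sup>2)"
      unfolding h_def c_def using cartan_sym[OF i j] by simp
    also have "\<dots> = (- c) * ((d j * v i - d i * v j)\<^sup>2 / (d i * d j))"
      using pos by (simp add: power2_eq_square field_simps)
    also have "0 \<le> \<dots>" using c pos by (intro mult_nonneg_nonneg divide_nonneg_nonneg) auto
    finally show ?thesis .
  qed
  then have "0 \<le> (\<Sum>i\<in>?V. \<Sum>j\<in>?V. h i j + h j i)" by (intro sum_nonneg)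
  also have "\<dots> = (\<Sum>i\<in>?V. \<Sum>j\<in>?V. h i j) + (\<Sum>i\<in>?V. \<Sum>j\<in>?V. h j i)"
    by (simp add: sum.distrib)
  also have "(\<Sum>i\<in>?V. \<Sum>j\<in>?V. h j i) = (\<Sum>i\<in>?V. \<Sum>j\<in>?V. h i j)" by (rule sum.swap)
  finally have "0 \<le> (\<Sum>i\<in>?V. \<Sum>j\<in>?V. h i j)" by simp
  also have "(\<Sum>i\<in>?V. \<Sum>j\<in>?V. h i j) = (\<Sum>i\<in>?V. \<Sum>j\<in>?V. v i * cartan X i j * v j)
      - (\<Sum>i\<in>?V. \<Sum>j\<in>?V. d j * cartan X i j / d i * (v i)\<^sup>2)"
    unfolding sum_subtractf[symmetric] h_def
    by (intro sum.cong refl) (simp add: algebra_simps)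
  also have "(\<Sum>i\<in>?V. \<Sum>j\<in>?V. d j * cartan X i j / d i * (v i)\<^sup>2) =
      (\<Sum>i\<in>?V. (\<Sum>j\<in>?V. d j * cartan X j i) / d i * (v i)\<^sup>2)"
  proof (intro sum.cong refl)
    fix i assume i: "i \<in> ?V"
    have "(\<Sum>j\<in>?V. d j * cartan X i j / d i * (v i)\<^sup>2) = (\<Sum>j\<in>?V. d j * cartan X j i / d i * (v i)\<^sup>2)"
      using cartan_sym[OF i] by (intro sum.cong refl) simp
    also have "\<dots> = (\<Sum>j\<in>?V. d j * cartan X j i) / d i * (v i)\<^sup>2"
      by (simp add: sum_distrib_right sum_divide_distrib)
    finally show "(\<Sum>j\<in>?V. d j * cartan X i j / d i * (v i)\<^sup>2) =
      (\<Sum>j\<in>?V. d j * cartan X j i) / d i * (v i)\<^sup>2" .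
  qed
  finally show ?thesis by simp
qed

text \<open>The norm condition bounds a definite quadratic form in \<open>v\<close> by a linear one,
  and the drop in degree is linear in \<open>v\<close>. Only degrees are bounded, not the spectral
  parameters; this suffices because the partial solutions have finite support anyway.\<close>

lemma region_bounded:
  assumes m0: "m0 \<in> monoms X"
  obtains H where "\<And>m. m \<in> region m0 \<Longrightarrow> deg m0 - int H \<le> deg m"
proof -
  let ?V = "verts X"
  define e where "e i = (\<Sum>j\<in>?V. d j * cartan X j i)" for i
  define \<Lambda> where "\<Lambda> i = wt i m0" for i
  \<comment> \<open>The constants left over from completing squares:
    \<open>x * v \<le> c * v\<^sup>2 + x\<^sup>2 / (4 * c)\<close> with \<open>c = e i / d i\<close>
    and \<open>x = e i + 2 * \<Lambda> i\<close>. The summand \<open>2 * \<Lambda> i\<close> is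
    there to cancel against the norm condition.\<close>
  define B where "B = (\<Sum>i\<in>?V. (e i + 2 * \<Lambda> i)\<^sup>2 / (4 * (e i / d i)) :: real)"
  have "deg m0 - int (nat \<lceil>B\<rceil>) \<le> deg m" if "m \<in> region m0" for m
  proof -
    obtain v where v: "\<And>j. j \<in> ?V \<Longrightarrow> wt j m = \<Lambda> j - (\<Sum>i\<in>?V. cartan X j i * v i)"
      "norm_defect \<Lambda> v \<le> 0" and m: "m \<in> monoms X"
      using \<open>m \<in> region m0\<close> unfolding region_def \<Lambda>_def by blast
    have "(\<Sum>j\<in>?V. d j * wt j m) = (\<Sum>j\<in>?V. d j * \<Lambda> j) - (\<Sum>j\<in>?V. \<Sum>i\<in>?V. d j * cartan X j i * v i)"
      unfolding sum_subtractf[symmetric]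
      by (intro sum.cong refl) (simp add: v(1) right_diff_distrib sum_distrib_left mult.assoc)
    also have "(\<Sum>j\<in>?V. \<Sum>i\<in>?V. d j * cartan X j i * v i) = (\<Sum>i\<in>?V. e i * v i)"
      by (subst sum.swap) (simp add: e_def sum_distrib_right)
    finally have deg: "deg m = deg m0 - (\<Sum>i\<in>?V. e i * v i)"
      using pairing_eq_sum_wt[OF m] pairing_eq_sum_wt[OF m0] unfolding \<Lambda>_def by simp
    have "(\<Sum>i\<in>?V. (e i + 2 * \<Lambda> i) * v i) \<le> (\<Sum>i\<in>?V. e i / d i * (v i)\<^sup>2 +
        (e i + 2 * \<Lambda> i)\<^sup>2 / (4 * (e i / d i)) :: real)"
      unfolding of_int_sum
    proof (rule sum_mono)
      fix i assume i: "i \<in> ?V"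
      define c where "c = real_of_int (e i) / d i"
      define s where "s = real_of_int (e i + 2 * \<Lambda> i)"
      have "0 < e i" using d_cartan[OF i] by (simp add: e_def)
      then have c: "0 < c" using d_pos[OF i] by (simp add: c_def)
      have "0 \<le> (2 * c * v i - s)\<^sup>2 / (4 * c)" using c by simp
      also have "\<dots> = c * (v i)\<^sup>2 + s\<^sup>2 / (4 * c) - s * v i"
        using c by (simp add: power2_eq_square field_simps)
      finally show "real_of_int ((e i + 2 * \<Lambda> i) * v i) \<le>
          e i / d i * (v i)\<^sup>2 + (e i + 2 * \<Lambda> i)\<^sup>2 / (4 * (e i / d i))"
        by (simp add: c_def s_def)
    qed
    also have "\<dots> = (\<Sum>i\<in>?V. e i / d i * (v i)\<^sup>2) + B"
      by (simp add: B_def sum.distrib)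
    also have "(\<Sum>i\<in>?V. e i / d i * (v i)\<^sup>2) \<le> (\<Sum>i\<in>?V. \<Sum>j\<in>?V. v i * cartan X i j * v j)"
      using quadratic_form_bound[of "\<lambda>i. real_of_int (v i)"] by (simp add: e_def)
    also have "\<dots> \<le> 2 * (\<Sum>i\<in>?V. \<Lambda> i * v i)"
      using v(2) unfolding norm_defect_def by linarith
    finally have "real_of_int (\<Sum>i\<in>?V. e i * v i) \<le> B"
      by (simp add: distrib_right sum.distrib sum_distrib_left mult.assoc)
    then show ?thesis unfolding deg by linarith
  qed
  then show ?thesis using that by blast
qed

theorem exists_dominant_element:
  assumes m0: "m0 \<in> monoms X" "\<And>i. i \<in> verts X \<Longrightarrow> idom i m0"
  shows "\<exists>\<chi> \<in> (\<Inter>i\<in>verts X. ker_screening X i). lead m0 \<chi>"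
proof -
  obtain H where H: "\<And>m. m \<in> region m0 \<Longrightarrow> deg m0 - int H \<le> deg m"
    using region_bounded[OF m0(1)] by blast
  have sub: "region m0 \<subseteq> monoms X" unfolding region_def by blast
  have "m0 \<in> region m0"
    unfolding region_def norm_defect_def using m0(1) by (auto intro!: exI[of _ "\<lambda>_. 0"])
  then obtain g where g: "\<And>i. i \<in> verts X \<Longrightarrow> g i \<in> ker_screening X i"
    "\<And>i. i \<in> verts X \<Longrightarrow> supp (g i) \<subseteq> region m0" "\<And>i. i \<in> verts X \<Longrightarrow> lead m0 (g i)"
    "\<And>i j m. i \<in> verts X \<Longrightarrow> j \<in> verts X \<Longrightarrow> deg m0 - int H \<le> deg m \<Longrightarrow> cf (g i) m = cf (g j) m"
    using algorithm[of "region m0" m0 H, OF sub region_closed _ m0(2)] by blast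
  \<comment> \<open>Below the bound the region contains no monomials, so after \<open>H\<close>
    steps the partial solutions have nothing left to disagree on.\<close>
  have eq: "g i = g j" if "i \<in> verts X" "j \<in> verts X" for i j
  proof (rule poly_mapping_eqI)
    fix m
    show "cf (g i) m = cf (g j) m"
    proof (cases "deg m0 - int H \<le> deg m")
      case False
      then have "m \<notin> region m0" using H by blast
      then have "m \<notin> supp (g i)" "m \<notin> supp (g j)" using g(2) that by blast+
      then show ?thesis by (simp add: in_keys_iff)
    qed (rule g(4)[OF that])
  qed
  obtain l where l: "l \<in> verts X" using verts_nonempty by blast
  have "g l \<in> (\<Inter>i\<in>verts X. ker_screening X i)" using g(1) eq[OF l] by auto
  then show ?thesis using g(3)[OF l] by blast
qed

end

section \<open>Folding\<close>

lemma orb_onto: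
  assumes "valid_folding F" "j \<in> verts (lower F)"
  obtains i where "i \<in> verts (upper F)" "orb F i = j"
  using assms(2) unfolding orb_image[OF assms(1), symmetric] by (elim imageE) blast

lemma orb_mem: "valid_folding F \<Longrightarrow> i \<in> verts (upper F) \<Longrightarrow> orb F i \<in> verts (lower F)"
  using orb_image[of F] by (metis imageI)

section \<open>Folding of monomials\<close>

lemma fold_monom_superset:
  "finite S \<Longrightarrow> supp m \<subseteq> S \<Longrightarrow>
    fold_monom F m = (\<Sum>k\<in>S. Poly_Mapping.single (orb F (fst k), snd k) (cf m k))"
  unfolding fold_monom_def case_prod_unfold prod.collapse
  by (rule sum.mono_neutral_left) (auto simp: in_keys_iff)

lemma fold_monom_add: "fold_monom F (a + b) = fold_monom F a + fold_monom F b"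
  using fold_monom_superset[of "supp a \<union> supp b" a F] fold_monom_superset[of "supp a \<union> supp b" b F]
    fold_monom_superset[of "supp a \<union> supp b" "a + b" F] Poly_Mapping.keys_add[of a b]
  by (simp add: lookup_add single_add sum.distrib)

lemma fold_monom_zero [simp]: "fold_monom F 0 = 0"
  by (simp add: fold_monom_def)

lemma fold_monom_single:
  "fold_monom F (Poly_Mapping.single (i, n) u) = Poly_Mapping.single (orb F i, n) u"
  using fold_monom_superset[of "{(i, n)}" "Poly_Mapping.single (i, n) u" F] by simp

lemma fold_monom_sum: "fold_monom F (\<Sum>x\<in>S. f x) = (\<Sum>x\<in>S. fold_monom F (f x))"
  by (induction S rule: infinite_finite_induct) (auto simp: fold_monom_add)

lemma lookup_fold_monom:
  assumes "m \<in> monoms X"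
  shows "cf (fold_monom F m) (j, n) = (\<Sum>i | i \<in> verts X \<and> orb F i = j. cf m (i, n))"
proof -
  let ?O = "{i. i \<in> verts X \<and> orb F i = j}"
  define S where "S = supp m \<union> ?O \<times> {n}"
  have S: "finite S" "supp m \<subseteq> S" unfolding S_def by auto
  have "cf (fold_monom F m) (j, n) = (\<Sum>k\<in>S. if k \<in> ?O \<times> {n} then cf m k else 0)"
    unfolding fold_monom_superset[OF S] lookup_sum
  proof (rule sum.cong[OF refl])
    fix k assume "k \<in> S"
    then have "fst k \<in> verts X" using supp_monoms[OF assms, of k] unfolding S_def by (cases k) auto
    then show "cf (Poly_Mapping.single (orb F (fst k), snd k) (cf m k)) (j, n) =
        (if k \<in> ?O \<times> {n} then cf m k else 0)"
      by (cases k) (auto simp: lookup_single when_def)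
  qed
  also have "\<dots> = (\<Sum>k\<in>?O \<times> {n}. cf m k)"
    using S(1) by (subst sum.inter_restrict[symmetric]) (auto simp: S_def Int_absorb1 intro!: sum.cong)
  also have "\<dots> = (\<Sum>i\<in>?O. cf m (i, n))"
    by (rule sum.reindex_bij_witness[of _ "\<lambda>i. (i, n)" fst]) auto
  finally show ?thesis .
qed

lemma fold_monom_monoms:
  assumes "valid_folding F" "m \<in> monoms (upper F)"
  shows "fold_monom F m \<in> monoms (lower F)"
proof -
  have "orb F (fst k) \<in> verts (lower F)" if "k \<in> supp m" for k
    by (rule orb_mem[OF assms(1) supp_monoms[OF assms(2) that]])
  then show ?thesis
    unfolding fold_monom_superset[OF finite_keys order_refl] by (intro monoms_sum monoms_single)
qed

lemma pairing_fold_monom: "pairing d (fold_monom F m) = pairing (\<lambda>i. d (orb F i)) m"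
  unfolding fold_monom_superset[OF finite_keys order_refl] pairing_sum pairing_single
  by (simp add: pairing_def)

text \<open>The exponents are orbit sums of a column of the Cartan matrix, evaluated by
  \<open>cartan_lower\<close>. Over the orbit of \<open>i\<close> itself the sum is the diagonal
  entry 2, already accounted for by \<open>i\<close>, so the other members of the orbit contribute
  nothing.\<close>

lemma fold_A_monom:
  assumes F: "valid_folding F" and i: "i \<in> verts (upper F)"
  shows "fold_monom F (A_monom (upper F) i n) = A_monom (lower F) (orb F i) n"
proof (rule poly_mapping_eqI)
  fix x :: "nat \<times> int"
  obtain j k where x: "x = (j, k)" by (cases x)
  let ?O = "{l. l \<in> verts (upper F) \<and> orb F l = j}"
  let ?C = "\<lambda>l. cartan (upper F) l i"
  have lhs: "cf (fold_monom F (A_monom (upper F) i n)) x = (\<Sum>l\<in>?O. cf (A_monom (upper F) i n) (l, k))"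
    unfolding x by (rule lookup_fold_monom) (rule monoms_A[OF i])
  show "cf (fold_monom F (A_monom (upper F) i n)) x = cf (A_monom (lower F) (orb F i) n) x"
  proof (cases "j = orb F i")
    case True
    have fin: "finite ?O" and iO: "i \<in> ?O" using i True by auto
    have "(\<Sum>l\<in>?O. ?C l) = 2"
      using cartan_lower[OF F i i] True by (simp add: cartan_self)
    then have C: "(\<Sum>l\<in>?O - {i}. ?C l) = 0"
      using sum.remove[OF fin iO, of ?C] by (simp add: cartan_self)
    have "(\<Sum>l\<in>?O. cf (A_monom (upper F) i n) (l, k)) =
        (of_bool (k = n + 1) + of_bool (k = n - 1)) + (\<Sum>l\<in>?O - {i}. if k = n then ?C l else 0)"
      unfolding sum.remove[OF fin iO]
      by (intro arg_cong2[where f = "(+)"] sum.cong refl) (auto simp: lookup_A_monom)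
    also have "(\<Sum>l\<in>?O - {i}. if k = n then ?C l else 0) = 0" using C by (cases "k = n") simp_all
    finally show ?thesis unfolding lhs unfolding x using True by (simp add: lookup_A_monom)
  next
    case False
    have "(\<Sum>l\<in>?O. cf (A_monom (upper F) i n) (l, k)) = (\<Sum>l\<in>?O. if k = n then ?C l else 0)"
      using False by (intro sum.cong refl) (auto simp: lookup_A_monom)
    also have "\<dots> = (if j \<in> verts (lower F) \<and> k = n then cartan (lower F) j (orb F i) else 0)"
    proof (cases "j \<in> verts (lower F)")
      case True
      then obtain l where "l \<in> verts (upper F)" "orb F l = j" using orb_onto[OF F] by metis
      then show ?thesis using cartan_lower[OF F _ i, of l] True by simp
    next
      case nj: False
      then have "?O = {}" using orb_mem[OF F] by auto
      then show ?thesis unfolding \<open>?O = {}\<close> using nj by simp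
    qed
    finally show ?thesis unfolding lhs unfolding x using False by (simp add: lookup_A_monom)
  qed
qed

section \<open>Folding of Laurent polynomials\<close>

lemma fold_laurent_superset:
  "finite S \<Longrightarrow> supp f \<subseteq> S \<Longrightarrow>
    fold_laurent F f = (\<Sum>m\<in>S. Poly_Mapping.single (fold_monom F m) (cf f m))"
  unfolding fold_laurent_def by (rule sum.mono_neutral_left) (auto simp: in_keys_iff)

lemma fold_laurent_add: "fold_laurent F (f + g) = fold_laurent F f + fold_laurent F g"
  using fold_laurent_superset[of "supp f \<union> supp g" f F] fold_laurent_superset[of "supp f \<union> supp g" g F]
    fold_laurent_superset[of "supp f \<union> supp g" "f + g" F] Poly_Mapping.keys_add[of f g]
  by (simp add: lookup_add single_add sum.distrib)

lemma fold_laurent_zero [simp]: "fold_laurent F 0 = 0"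
  by (simp add: fold_laurent_def)

lemma fold_laurent_single:
  "fold_laurent F (Poly_Mapping.single m c) = Poly_Mapping.single (fold_monom F m) c"
  using fold_laurent_superset[of "{m}" "Poly_Mapping.single m c" F] by simp

lemma fold_laurent_mult: "fold_laurent F (f * g) = fold_laurent F f * fold_laurent F g"
proof (induction f rule: laurent_induct)
  case (single a c)
  show ?case
  proof (induction g rule: laurent_induct)
    case (single b d)
    show ?case by (simp add: mult_single fold_laurent_single fold_monom_add)
  next
    case (add g g')
    then show ?case by (simp add: fold_laurent_add distrib_left)
  qed
next
  case (add f f')
  then show ?case by (simp add: fold_laurent_add distrib_right)
qed

lemma fold_laurent_of_monom: "fold_laurent F (of_monom m) = of_monom (fold_monom F m)"
  by (simp add: of_monom_def fold_laurent_single)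

lemma fold_laurent_one: "fold_laurent F 1 = 1"
  using fold_laurent_of_monom[of F 0] by simp

lemma fold_laurent_const: "fold_laurent F (const c) = const c"
  by (simp add: const_def fold_laurent_single)

lemma fold_laurent_diff: "fold_laurent F (f - g) = fold_laurent F f - fold_laurent F g"
  using fold_laurent_add[of F "f - g" g] by simp

lemma supp_fold_laurent: "supp (fold_laurent F f) \<subseteq> fold_monom F ` supp f"
  unfolding fold_laurent_def by (rule order_trans[OF Poly_Mapping.keys_sum]) auto

lemma fold_laurent_carrier:
  assumes "valid_folding F" "f \<in> carrier (laurent_ring (upper F))"
  shows "fold_laurent F f \<in> carrier (laurent_ring (lower F))"
  using assms(2) fold_monom_monoms[OF assms(1)]
  unfolding carrier_laurent by (intro order_trans[OF supp_fold_laurent] image_subsetI) auto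

section \<open>Folding and the screening operators\<close>

lemma fold_screening_relations:
  assumes F: "valid_folding F" and i: "i \<in> verts (upper F)"
    and "s \<in> screening_relations (upper F) i"
  shows "\<exists>s' \<in> screening_relations (lower F) (orb F i). \<forall>n. cf s' n = fold_laurent F (cf s n)"
  using assms(3)
proof (induction rule: screening_relations.induct)
  case zero
  show ?case by (intro bexI[of _ 0]) (auto intro: screening_relations.zero)
next
  case (add_multiple r a m)
  then obtain r' where r': "r' \<in> screening_relations (lower F) (orb F i)"
    "\<And>n. cf r' n = fold_laurent F (cf r n)" by blast
  let ?A = "\<lambda>X i. of_monom (A_monom X i (m + 1))"
  have A: "fold_laurent F (?A (upper F) i) = ?A (lower F) (orb F i)"
    by (simp add: fold_laurent_of_monom fold_A_monom[OF F i])
  show ?case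
    using screening_relations.add_multiple[OF r'(1) fold_laurent_carrier[OF F add_multiple(2)], of m]
    by (rule bexI[rotated])
      (simp add: lookup_add lookup_minus lookup_single when_def r'(2) fold_laurent_add fold_laurent_diff
        fold_laurent_mult A)
qed

text \<open>On a monomial the derivation multiplies by an exponent, and the exponents of a folded
  monomial are orbit sums. The rest is additivity.\<close>

lemma lookup_screening_lift_fold:
  assumes "f \<in> carrier (laurent_ring X)"
  shows "cf (screening_lift j (fold_laurent F f)) n =
    (\<Sum>i | i \<in> verts X \<and> orb F i = j. fold_laurent F (cf (screening_lift i f) n))"
proof -
  let ?P = "\<lambda>f. cf (screening_lift j (fold_laurent F f)) n =
    (\<Sum>i | i \<in> verts X \<and> orb F i = j. fold_laurent F (cf (screening_lift i f) n))"
  have s: "?P (Poly_Mapping.single m c)" if "m \<in> monoms X" for m c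
  proof -
    have "Poly_Mapping.single m (\<Sum>i\<in>S. h i) = (\<Sum>i\<in>S. Poly_Mapping.single m (h i))"
      for m :: monom and S :: "nat set" and h :: "nat \<Rightarrow> complex"
      by (induction S rule: infinite_finite_induct) (auto simp: single_add)
    then show ?thesis
      by (simp add: fold_laurent_single lookup_screening_lift_single lookup_fold_monom[OF that]
          sum_distrib_right)
  qed
  have a: "?P (f + g)" if "?P f" "?P g" for f g
    using that by (simp add: fold_laurent_add screening_lift_add lookup_add sum.distrib)
  \<comment> \<open>An induction over all Laurent polynomials would leave the carrier, where orbits
    inside \<open>verts X\<close> no longer determine the folded exponents. Hence the partial sums
    of \<open>f\<close>.\<close>
  have *: "?P (\<Sum>m\<in>S. Poly_Mapping.single m (cf f m))" if "S \<subseteq> supp f" for S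
    using finite_subset[OF that finite_keys] that
  proof (induction S rule: finite_induct)
    case empty
    show ?case using s[of 0 0] by simp
  next
    case (insert m S)
    then have "m \<in> monoms X" using assms unfolding carrier_laurent by blast
    then show ?case using insert a[OF s] by simp
  qed
  have "(\<Sum>m\<in>supp f. Poly_Mapping.single m (cf f m)) = f"
    by (rule poly_mapping_eqI) (simp add: lookup_sum lookup_single when_def in_keys_iff)
  then show ?thesis using *[OF order_refl] by simp
qed

lemma fold_ker:
  assumes F: "valid_folding F" and f: "f \<in> (\<Inter>i\<in>verts (upper F). ker_screening (upper F) i)"
    and j: "j \<in> verts (lower F)"
  shows "fold_laurent F f \<in> ker_screening (lower F) j"
proof -
  let ?O = "{i. i \<in> verts (upper F) \<and> orb F i = j}"
  have "\<exists>s \<in> screening_relations (lower F) j. \<forall>n. cf s n = fold_laurent F (cf (screening_lift i f) n)"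
    if "i \<in> ?O" for i
    using fold_screening_relations[OF F, of i "screening_lift i f"] that f
    unfolding ker_screening_def by auto
  then obtain s where s: "\<And>i. i \<in> ?O \<Longrightarrow> s i \<in> screening_relations (lower F) j"
    "\<And>i n. i \<in> ?O \<Longrightarrow> cf (s i) n = fold_laurent F (cf (screening_lift i f) n)" by metis
  obtain i where "i \<in> verts (upper F)" using orb_onto[OF F j] by metis
  then have c: "f \<in> carrier (laurent_ring (upper F))" using f ker_carrier by blast
  have "screening_lift j (fold_laurent F f) = (\<Sum>i\<in>?O. s i)"
    by (rule poly_mapping_eqI)
      (use s(2) in \<open>simp add: lookup_screening_lift_fold[OF c] lookup_sum\<close>)
  also have "\<dots> \<in> screening_relations (lower F) j" using s(1) by (rule relations_sum)
  finally show ?thesis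
    unfolding ker_screening_def using fold_laurent_carrier[OF F c] by blast
qed

section \<open>Surjectivity\<close>

text \<open>Choose one vertex \<open>s j\<close> in each orbit and replace the variables of
  \<open>j\<close> by those of \<open>s j\<close>; the exponents stay nonnegative.\<close>

lemma lift_dominant_monomial:
  assumes F: "valid_folding F" and m: "m \<in> monoms (lower F)" "\<And>j. j \<in> verts (lower F) \<Longrightarrow> idom j m"
  shows "\<exists>m' \<in> monoms (upper F). fold_monom F m' = m \<and> (\<forall>i\<in>verts (upper F). idom i m')"
proof -
  have "\<forall>j\<in>verts (lower F). \<exists>i\<in>verts (upper F). orb F i = j"
    using orb_onto[OF F] by metis
  then obtain s where s: "\<And>j. j \<in> verts (lower F) \<Longrightarrow> s j \<in> verts (upper F)"
    "\<And>j. j \<in> verts (lower F) \<Longrightarrow> orb F (s j) = j" by metis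
  define m' where "m' = (\<Sum>k\<in>supp m. Poly_Mapping.single (s (fst k), snd k) (cf m k))"
  have k: "fst k \<in> verts (lower F)" "0 \<le> cf m k" if "k \<in> supp m" for k
    using supp_monoms[OF m(1) that] m(2)[of "fst k"] unfolding idom_def by (simp, metis prod.collapse)
  have "m' \<in> monoms (upper F)"
    unfolding m'_def by (intro monoms_sum monoms_single s k)
  moreover have "fold_monom F m' = m"
  proof -
    have "fold_monom F m' = (\<Sum>k\<in>supp m. Poly_Mapping.single k (cf m k))"
      unfolding m'_def fold_monom_sum fold_monom_single
      using s(2) k(1) by (intro sum.cong refl) simp
    also have "\<dots> = m"
      by (rule poly_mapping_eqI) (simp add: lookup_sum lookup_single when_def in_keys_iff)
    finally show ?thesis .
  qed
  moreover have "idom i m'" for i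
    unfolding idom_def m'_def lookup_sum using k(2)
    by (auto intro!: sum_nonneg simp: lookup_single when_def)
  ultimately show ?thesis by blast
qed

text \<open>Being constant on orbits, \<open>d\<close> descends to a grading \<open>e\<close> for
  which folding preserves degrees. So the folded elements of \<open>exists_dominant_element\<close>
  keep their leading monomials, and every dominant monomial is one of these;
  \<open>triangular_span\<close> then exhausts the lower intersection.\<close>

lemma fold_surjective:
  assumes F: "valid_folding F" and w: "simply_laced_weights (upper F) d"
    and orb: "\<And>i j. i \<in> verts (upper F) \<Longrightarrow> j \<in> verts (upper F) \<Longrightarrow> orb F i = orb F j \<Longrightarrow> d i = d j"
  shows "(\<Inter>j\<in>verts (lower F). ker_screening (lower F) j)
    \<subseteq> fold_laurent F ` (\<Inter>i\<in>verts (upper F). ker_screening (upper F) i)"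
    (is "?S \<subseteq> fold_laurent F ` ?T")
proof -
  interpret simply_laced_weights "upper F" d by (rule w)
  define e where "e j = d (SOME i. i \<in> verts (upper F) \<and> orb F i = j)" for j
  have e: "e (orb F i) = d i" if i: "i \<in> verts (upper F)" for i
  proof -
    have "\<exists>l. l \<in> verts (upper F) \<and> orb F l = orb F i" using i by blast
    from someI_ex[OF this] show ?thesis unfolding e_def using orb i by blast
  qed
  have e_fold: "pairing e (fold_monom F m) = deg m" if "m \<in> monoms (upper F)" for m
    unfolding pairing_fold_monom unfolding pairing_def
    using supp_monoms[OF that] e by (intro sum.cong refl) simp
  have onto: "\<exists>i\<in>verts (upper F). orb F i = j" if "j \<in> verts (lower F)" for j
    using orb_onto[OF F that] by metis
  have e_pos: "0 < e j" if j: "j \<in> verts (lower F)" for j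
    using onto[OF j] e d_pos by force
  have e_A: "0 < pairing e (A_monom (lower F) j n)" if j: "j \<in> verts (lower F)" for j n
  proof -
    obtain i where i: "i \<in> verts (upper F)" "orb F i = j" using onto[OF j] by blast
    show ?thesis using deg_A[OF i(1)] e_fold[OF monoms_A[OF i(1)]] fold_A_monom[OF F i(1)] i(2) by metis
  qed
  obtain i0 where "i0 \<in> verts (upper F)" using verts_nonempty by blast
  then obtain j0 where j0: "j0 \<in> verts (lower F)" using orb_mem[OF F] by metis
  show ?thesis
  proof (rule triangular_span[where deg = "pairing e" and G = "\<lambda>m. \<forall>j\<in>verts (lower F). idom j m"])
    show "f - g \<in> ?S" if "f \<in> ?S" "g \<in> ?S" for f g using that by (auto intro: ker_diff)
    show "fold_laurent F ` ?T \<subseteq> ?S" using fold_ker[OF F] by blast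
    show "0 \<in> fold_laurent F ` ?T" by (rule image_eqI[of _ _ 0]) (auto intro: ker_zero)
    show "f + g \<in> fold_laurent F ` ?T" if fg: "f \<in> fold_laurent F ` ?T" "g \<in> fold_laurent F ` ?T" for f g
    proof -
      obtain f' g' where "f' \<in> ?T" "f = fold_laurent F f'" "g' \<in> ?T" "g = fold_laurent F g'"
        using fg by blast
      then show ?thesis
        by (intro image_eqI[of _ _ "f' + g'"]) (auto simp: fold_laurent_add intro: ker_add)
    qed
    show "const c * f \<in> fold_laurent F ` ?T" if f: "f \<in> fold_laurent F ` ?T" for f c
    proof -
      obtain f' where "f' \<in> ?T" "f = fold_laurent F f'" using f by blast
      then show ?thesis
        by (intro image_eqI[of _ _ "const c * f'"])
          (auto simp: fold_laurent_mult fold_laurent_const intro: ker_mult ker_const)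
    qed
    \<comment> \<open>The grading \<open>e\<close> is positive on every \<open>A\<^sub>j\<close>, so
      one monomial of top degree is dominant for all \<open>j\<close> simultaneously.\<close>
    show "\<exists>m\<in>supp f. \<forall>j\<in>verts (lower F). idom j m" if f: "f \<in> ?S" "f \<noteq> 0" for f
    proof -
      define N where "N = Max (pairing e ` supp f)"
      have N: "pairing e m \<le> N" if "m \<in> supp f" for m using that unfolding N_def by simp
      have "N \<in> pairing e ` supp f" unfolding N_def using f(2) by (intro Max_in) auto
      then obtain m where m: "m \<in> supp f" "pairing e m = N" by blast
      have "idom j m" if j: "j \<in> verts (lower F)" for j
        using top_monomial_idom[OF j e_A[OF j] _ m(1)] f(1) j N m(2) by blast
      then show ?thesis using m(1) by blast
    qed
    fix m f assume f: "f \<in> ?S" "m \<in> supp f" and dom: "\<forall>j\<in>verts (lower F). idom j m"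
    have m: "m \<in> monoms (lower F)" using ker_supp[of f "lower F" j0] f j0 by blast
    have "0 \<le> pairing e m"
      unfolding pairing_eq_sum_wt[OF m]
      using dom e_pos idom_wt by (intro sum_nonneg mult_nonneg_nonneg) (auto intro: less_imp_le)
    moreover obtain m' where m': "m' \<in> monoms (upper F)" "fold_monom F m' = m"
      "\<And>i. i \<in> verts (upper F) \<Longrightarrow> idom i m'" using lift_dominant_monomial[OF F m] dom by blast
    then obtain \<chi> where \<chi>: "\<chi> \<in> ?T" "lead m' \<chi>" using exists_dominant_element by blast
    define r where "r = \<chi> - of_monom m'"
    have r: "fold_laurent F \<chi> = of_monom m + fold_laurent F r"
      by (simp add: r_def fold_laurent_diff fold_laurent_of_monom m'(2))
    have less: "pairing e k < pairing e m" if k: "k \<in> supp (fold_laurent F r)" for k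
    proof -
      obtain b where b: "b \<in> supp r" "k = fold_monom F b"
        using subsetD[OF supp_fold_laurent k] by (elim imageE)
      have "b \<in> monoms (upper F)"
      proof (cases "b = m'")
        case False
        then have "b \<in> supp \<chi>" using b(1) unfolding r_def by (simp add: in_keys_iff lookup_minus lookup_of_monom)
        then show ?thesis using ker_supp[of \<chi> "upper F" i0] \<chi>(1) \<open>i0 \<in> verts (upper F)\<close> by blast
      qed (use m' in simp)
      then show ?thesis using b \<chi>(2) e_fold m' unfolding lead_def r_def by metis
    qed
    have "cf (fold_laurent F \<chi>) m = 1"
      using less[of m] by (auto simp: r lookup_add lookup_of_monom in_keys_iff)
    moreover have "k = m \<or> pairing e k < pairing e m" if "k \<in> supp (fold_laurent F \<chi>)" for k
      using that less unfolding r by (auto elim!: supp_addE)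
    ultimately show "0 \<le> pairing e m \<and> (\<exists>h\<in>fold_laurent F ` ?T. cf h m = 1 \<and>
        (\<forall>k\<in>supp h. k = m \<or> pairing e k < pairing e m))"
      using \<chi>(1) by blast
  qed
qed

section \<open>The coefficients of the sum of the positive roots\<close>

text \<open>In terms of simple roots; its pairing with each simple coroot is 2, which is where the
  positivity asked of \<open>d\<close> comes from. The index \<open>i - 1\<close> translates labels
  starting at 1 into list positions, and the last clause is a default for the types that are not
  simply-laced.\<close>

fun two_rho :: "dynkin \<Rightarrow> nat \<Rightarrow> int" where
  "two_rho (TypeA n) i = int i * (int n + 1 - int i)"
| "two_rho (TypeD n) i =
     (if i + 2 \<le> n then int i * (2 * int n - int i - 1) else int n * (int n - 1) div 2)"
| "two_rho (TypeE n) i =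
     (if n = 6 then [16, 22, 30, 42, 30, 16]
      else if n = 7 then [34, 49, 66, 96, 75, 52, 27]
      else [92, 136, 182, 270, 220, 168, 114, 58]) ! (i - 1)"
| "two_rho _ i = 0"

lemma valid_upper: "valid_folding F \<Longrightarrow> valid_simply_laced (upper F)"
  by (cases F) auto

lemma cartan_simply_laced:
  assumes "valid_simply_laced X"
  shows "cartan X i j = (if i = j then 2 else if (i, j) \<in> links X \<or> (j, i) \<in> links X then -1 else 0)"
proof -
  have "sq_len X k = 2" for k using assms by (cases X) auto
  then show ?thesis by (simp add: cartan_def ip_def)
qed

text \<open>With \<open>N\<close> the set of neighbours of \<open>i\<close>, this is the discrete
  Laplacian of \<open>d\<close> on the diagram.\<close>

lemma sum_cartan:
  assumes X: "valid_simply_laced X" and i: "i \<in> verts X" and N: "N \<subseteq> verts X - {i}"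
    "\<And>j. j \<in> verts X - {i} \<Longrightarrow> j \<in> N \<longleftrightarrow> (i, j) \<in> links X \<or> (j, i) \<in> links X"
  shows "(\<Sum>j\<in>verts X. d j * cartan X j i) = 2 * d i - (\<Sum>j\<in>N. d j)"
proof -
  have "(\<Sum>j\<in>verts X. d j * cartan X j i) = 2 * d i + (\<Sum>j\<in>verts X - {i}. if j \<in> N then - d j else 0)"
    unfolding sum.remove[OF finite_verts i]
    using N(2) by (intro arg_cong2[where f = "(+)"] sum.cong refl) (auto simp: cartan_simply_laced[OF X])
  also have "(\<Sum>j\<in>verts X - {i}. if j \<in> N then - d j else 0) = (\<Sum>j\<in>N. - d j)"
    using N(1) by (subst sum.inter_restrict[symmetric]) (auto simp: Int_absorb1)
  finally show ?thesis by (simp add: sum_negf)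
qed

text \<open>The quadratic formula has second difference -2 and vanishes at 0 and
  \<open>n + 1\<close>, so the ends of the diagram are no exception.\<close>

lemma two_rho_A:
  assumes i: "1 \<le> i" "i \<le> n"
  shows "(\<Sum>j\<in>verts (TypeA n). two_rho (TypeA n) j * cartan (TypeA n) j i) = 2"
proof -
  let ?N = "(if i = 1 then {} else {i - 1}) \<union> (if i = n then {} else {i + 1})"
  have "(\<Sum>j\<in>verts (TypeA n). two_rho (TypeA n) j * cartan (TypeA n) j i) =
      2 * two_rho (TypeA n) i - (\<Sum>j\<in>?N. two_rho (TypeA n) j)"
    using i by (intro sum_cartan) (auto split: if_splits)
  also have "\<dots> = 2"
    using i by (auto simp: of_nat_diff algebra_simps)
  finally show ?thesis .
qed

text \<open>On the line the formula has second difference -2. The branch vertex \<open>n - 2\<close>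
  sees both spin vertices with the common value \<open>s\<close>, and these see only the branch
  vertex.\<close>

lemma two_rho_D:
  assumes n: "4 \<le> n" and i: "1 \<le> i" "i \<le> n"
  shows "(\<Sum>j\<in>verts (TypeD n). two_rho (TypeD n) j * cartan (TypeD n) j i) = 2"
proof -
  define s where "s = int n * (int n - 1) div 2"
  have s: "2 * s = int n * (int n - 1)" unfolding s_def by simp
  have spin: "two_rho (TypeD n) j = s" if "n < j + 2" for j using that by (simp add: s_def)
  have line: "two_rho (TypeD n) j = int j * (2 * int n - int j - 1)" if "j + 2 \<le> n" for j
    using that by simp
  consider "i + 2 < n" | "i + 2 = n" | "i + 1 = n" | "i = n" using i by linarith
  then show ?thesis
  proof cases
    case 1
    let ?N = "(if i = 1 then {} else {i - 1}) \<union> {i + 1}"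
    have "(\<Sum>j\<in>verts (TypeD n). two_rho (TypeD n) j * cartan (TypeD n) j i) =
        2 * two_rho (TypeD n) i - (\<Sum>j\<in>?N. two_rho (TypeD n) j)"
      using n i 1 by (intro sum_cartan) (auto split: if_splits)
    also have "\<dots> = 2"
    proof (cases "i = 1")
      case True
      then show ?thesis using n by (simp add: line del: two_rho.simps)
    next
      case False
      have "(\<Sum>j\<in>?N. two_rho (TypeD n) j) = two_rho (TypeD n) (i - 1) + two_rho (TypeD n) (i + 1)"
        using False i by (subst sum.union_disjoint) auto
      then show ?thesis
        using i 1 by (simp add: line of_nat_diff algebra_simps del: two_rho.simps)
    qed
    finally show ?thesis .
  next
    case 2
    have "(\<Sum>j\<in>verts (TypeD n). two_rho (TypeD n) j * cartan (TypeD n) j i) =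
        2 * two_rho (TypeD n) i - (\<Sum>j\<in>{i - 1, i + 1, i + 2}. two_rho (TypeD n) j)"
      using n i 2 by (intro sum_cartan) auto
    also have "(\<Sum>j\<in>{i - 1, i + 1, i + 2}. two_rho (TypeD n) j) = two_rho (TypeD n) (i - 1) + 2 * s"
    proof -
      have "i - 1 \<noteq> i + 1" "i - 1 \<noteq> i + 2" by auto
      then show ?thesis using 2 by (simp add: spin del: two_rho.simps)
    qed
    also have "2 * two_rho (TypeD n) i - (two_rho (TypeD n) (i - 1) + 2 * s) = 2"
    proof -
      have n': "int n = int i + 2" using 2 by simp
      show ?thesis using i 2 unfolding s by (simp add: line n' of_nat_diff algebra_simps del: two_rho.simps)
    qed
    finally show ?thesis .
  next
    case 3
    have "(\<Sum>j\<in>verts (TypeD n). two_rho (TypeD n) j * cartan (TypeD n) j i) =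
        2 * two_rho (TypeD n) i - (\<Sum>j\<in>{i - 1}. two_rho (TypeD n) j)"
      using n i 3 by (intro sum_cartan) auto
    also have "\<dots> = 2 * s - two_rho (TypeD n) (i - 1)" using 3 by (simp add: spin del: two_rho.simps)
    also have "\<dots> = 2"
    proof -
      have n': "int n = int i + 1" using 3 by simp
      show ?thesis using i 3 unfolding s by (simp add: line n' of_nat_diff algebra_simps del: two_rho.simps)
    qed
    finally show ?thesis .
  next
    case 4
    have "(\<Sum>j\<in>verts (TypeD n). two_rho (TypeD n) j * cartan (TypeD n) j i) =
        2 * two_rho (TypeD n) i - (\<Sum>j\<in>{i - 2}. two_rho (TypeD n) j)"
      using n i 4 by (intro sum_cartan) auto
    also have "\<dots> = 2 * s - two_rho (TypeD n) (i - 2)" using 4 by (simp add: spin del: two_rho.simps)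
    also have "\<dots> = 2"
      using n 4 unfolding s by (simp add: line of_nat_diff algebra_simps del: two_rho.simps)
    finally show ?thesis .
  qed
qed

lemma two_rho_E6:
  assumes "i \<in> verts (TypeE 6)"
  shows "0 < two_rho (TypeE 6) i"
    "(\<Sum>j\<in>verts (TypeE 6). two_rho (TypeE 6) j * cartan (TypeE 6) j i) = 2"
proof -
  have v: "{1..6} = {1, 2, 3, 4, 5, 6 :: nat}" by auto
  have X: "valid_simply_laced (TypeE 6)" by simp
  have i: "i \<in> {1, 2, 3, 4, 5, 6}" using assms unfolding verts.simps v .
  show "0 < two_rho (TypeE 6) i" using i by (elim insertE emptyE) simp_all
  show "(\<Sum>j\<in>verts (TypeE 6). two_rho (TypeE 6) j * cartan (TypeE 6) j i) = 2"
    using i unfolding cartan_simply_laced[OF X] verts.simps v by (elim insertE emptyE) simp_all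
qed

lemma two_rho_E7:
  assumes "i \<in> verts (TypeE 7)"
  shows "0 < two_rho (TypeE 7) i"
    "(\<Sum>j\<in>verts (TypeE 7). two_rho (TypeE 7) j * cartan (TypeE 7) j i) = 2"
proof -
  have v: "{1..7} = {1, 2, 3, 4, 5, 6, 7 :: nat}" by auto
  have X: "valid_simply_laced (TypeE 7)" by simp
  have i: "i \<in> {1, 2, 3, 4, 5, 6, 7}" using assms unfolding verts.simps v .
  show "0 < two_rho (TypeE 7) i" using i by (elim insertE emptyE) simp_all
  show "(\<Sum>j\<in>verts (TypeE 7). two_rho (TypeE 7) j * cartan (TypeE 7) j i) = 2"
    using i unfolding cartan_simply_laced[OF X] verts.simps v by (elim insertE emptyE) simp_all
qed

lemma two_rho_E8:
  assumes "i \<in> verts (TypeE 8)"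
  shows "0 < two_rho (TypeE 8) i"
    "(\<Sum>j\<in>verts (TypeE 8). two_rho (TypeE 8) j * cartan (TypeE 8) j i) = 2"
proof -
  have v: "{1..8} = {1, 2, 3, 4, 5, 6, 7, 8 :: nat}" by auto
  have X: "valid_simply_laced (TypeE 8)" by simp
  have i: "i \<in> {1, 2, 3, 4, 5, 6, 7, 8}" using assms unfolding verts.simps v .
  show "0 < two_rho (TypeE 8) i" using i by (elim insertE emptyE) simp_all
  show "(\<Sum>j\<in>verts (TypeE 8). two_rho (TypeE 8) j * cartan (TypeE 8) j i) = 2"
    using i unfolding cartan_simply_laced[OF X] verts.simps v by (elim insertE emptyE) simp_all
qed

lemma two_rho_E:
  assumes "n \<in> {6, 7, 8}" "i \<in> verts (TypeE n)"
  shows "0 < two_rho (TypeE n) i"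
    "(\<Sum>j\<in>verts (TypeE n). two_rho (TypeE n) j * cartan (TypeE n) j i) = 2"
  using assms two_rho_E6 two_rho_E7 two_rho_E8 by (elim insertE emptyE; metis)+

lemma simply_laced_weights_two_rho:
  assumes X: "valid_simply_laced X"
  shows "simply_laced_weights X (two_rho X)"
proof
  show "verts X \<noteq> {}" using X by (cases X) auto
  show "cartan X i j = cartan X j i" for i j unfolding cartan_simply_laced[OF X] by auto
  show "cartan X i j \<in> {0, -1}" if "i \<noteq> j" for i j
    unfolding cartan_simply_laced[OF X] using that by simp
  show "0 < two_rho X i" if i: "i \<in> verts X" for i
  proof (cases X)
    case (TypeD n)
    then have n: "4 \<le> n" "1 \<le> i" "i \<le> n" using X i by auto
    have "2 \<le> int n * (int n - 1)" using n mult_mono[of 2 "int n" 1 "int n - 1"] by simp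
    then have "0 < int n * (int n - 1) div 2" by linarith
    then show ?thesis using n TypeD by simp
  next
    case (TypeE n)
    then show ?thesis using X i two_rho_E(1)[of n i] by simp
  qed (use X i in auto)
  show "0 < (\<Sum>j\<in>verts X. two_rho X j * cartan X j i)" if i: "i \<in> verts X" for i
  proof (cases X)
    case (TypeA n)
    then show ?thesis using i two_rho_A[of i n] by simp
  next
    case (TypeD n)
    then show ?thesis using X i two_rho_D[of n i] by simp
  next
    case (TypeE n)
    then show ?thesis using X i two_rho_E(2)[of n i] by simp
  qed (use X in auto)
qed

text \<open>By \<open>orb_eq_iff\<close> the fibres of \<open>orb\<close> are the orbits, so
  invariance under one application of \<open>sigma\<close> is enough. For \<open>A_to_C\<close> this
  application exchanges the two factors of \<open>two_rho\<close>.\<close>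

lemma two_rho_orb:
  assumes F: "valid_folding F" and i: "i \<in> verts (upper F)" "j \<in> verts (upper F)" "orb F i = orb F j"
  shows "two_rho (upper F) i = two_rho (upper F) j"
proof -
  have s: "two_rho (upper F) (sigma F k) = two_rho (upper F) k \<and> sigma F k \<in> verts (upper F)"
    if "k \<in> verts (upper F)" for k
  proof (cases F)
    case (A_to_C l)
    then show ?thesis using that F by (auto simp: of_nat_diff algebra_simps)
  next
    case E6_to_F4
    have v: "{1..6} = {1, 2, 3, 4, 5, 6 :: nat}" by auto
    have "k \<in> {1, 2, 3, 4, 5, 6}" using that unfolding E6_to_F4 upper.simps verts.simps v .
    then show ?thesis unfolding E6_to_F4 by (elim insertE emptyE) simp_all
  next
    case D4_to_G2
    have v: "{1..4} = {1, 2, 3, 4 :: nat}" by auto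
    have "k \<in> {1, 2, 3, 4}" using that unfolding D4_to_G2 upper.simps verts.simps v .
    then show ?thesis unfolding D4_to_G2 by (elim insertE emptyE) simp_all
  qed (use that F in auto)
  obtain k where "(sigma F ^^ k) i = j" using orb_eq_iff[OF F i(1,2)] i(3) by blast
  moreover have "two_rho (upper F) ((sigma F ^^ k) i) = two_rho (upper F) i \<and>
      (sigma F ^^ k) i \<in> verts (upper F)"
    using s i(1) by (induction k) auto
  ultimately show ?thesis by simp
qed

section \<open>The commutative diagram\<close>

lemma carrier_corner_ring: "carrier (corner_ring X) = (\<Inter>i\<in>verts X. ker_screening X i)"
  by (simp add: corner_ring_def corner_factor_eq_ker)

text \<open>Both rings inherit their operations from the Laurent ring, so equality of the carriers
  makes them equal as records and the bottom arrow becomes the identity.\<close>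

lemma K_minus_eq_corner_ring: "K_minus X = corner_ring X"
  unfolding K_minus_def corner_ring_def
  by (simp add: corner_factor_eq_ker ker_screening_def screening_eq_iff)

lemma corner_ring_simps [simp]:
  "\<one>\<^bsub>corner_ring X\<^esub> = 1" "f \<oplus>\<^bsub>corner_ring X\<^esub> g = f + g" "f \<otimes>\<^bsub>corner_ring X\<^esub> g = f * g"
  by (simp_all add: corner_ring_def laurent_ring_def)

lemma fold_laurent_hom:
  assumes F: "valid_folding F"
  shows "fold_laurent F \<in> Ring.ring_hom (corner_ring (upper F)) (corner_ring (lower F))"
  by (rule ring_hom_memI)
    (auto simp: carrier_corner_ring fold_laurent_mult fold_laurent_add fold_laurent_one
      intro!: fold_ker[OF F])

lemma fold_laurent_image:
  assumes F: "valid_folding F"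
  shows "fold_laurent F ` carrier (corner_ring (upper F)) = carrier (corner_ring (lower F))"
proof
  show "fold_laurent F ` carrier (corner_ring (upper F)) \<subseteq> carrier (corner_ring (lower F))"
    using ring_hom_closed[OF fold_laurent_hom[OF F]] by blast
  show "carrier (corner_ring (lower F)) \<subseteq> fold_laurent F ` carrier (corner_ring (upper F))"
    unfolding carrier_corner_ring
    by (rule fold_surjective[OF F simply_laced_weights_two_rho[OF valid_upper[OF F]] two_rho_orb[OF F]])
qed

theorem theorem4p3:
  fixes t :: complex and F :: folding
  assumes "t \<noteq> 0" and "\<forall>n>0. t ^ n \<noteq> 1"
    and "valid_folding F"
    and frenkel_mukhin:
      "t_char t (upper F) \<in> ring_iso (Rep_z t (upper F)) (corner_ring (upper F))"
  shows "fold_laurent F \<in> Ring.ring_hom (corner_ring (upper F)) (corner_ring (lower F))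
    \<and> (\<lambda>f. f) \<in> ring_iso (K_minus (lower F)) (corner_ring (lower F))
    \<and> (\<exists>\<pi> \<in> Ring.ring_hom (Rep_z t (upper F)) (K_minus (lower F)).
         \<pi> ` carrier (Rep_z t (upper F)) = carrier (K_minus (lower F))
         \<and> (\<forall>a \<in> carrier (Rep_z t (upper F)). \<pi> a = fold_laurent F (t_char t (upper F) a)))"
proof (intro conjI)
  note F = assms(3)
  show fold: "fold_laurent F \<in> Ring.ring_hom (corner_ring (upper F)) (corner_ring (lower F))"
    by (rule fold_laurent_hom[OF F])
  show "(\<lambda>f. f) \<in> ring_iso (K_minus (lower F)) (corner_ring (lower F))"
    unfolding K_minus_eq_corner_ring by (rule ring_iso_memI) (auto simp: bij_betw_def)
  \<comment> \<open>The bottom arrow is the identity, so commutativity dictates this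
    composite.\<close>
  let ?\<pi> = "fold_laurent F \<circ> t_char t (upper F)"
  have hom: "t_char t (upper F) \<in> Ring.ring_hom (Rep_z t (upper F)) (corner_ring (upper F))"
    and onto: "t_char t (upper F) ` carrier (Rep_z t (upper F)) = carrier (corner_ring (upper F))"
    using frenkel_mukhin unfolding ring_iso_def bij_betw_def by blast+
  show "\<exists>\<pi> \<in> Ring.ring_hom (Rep_z t (upper F)) (K_minus (lower F)).
      \<pi> ` carrier (Rep_z t (upper F)) = carrier (K_minus (lower F))
      \<and> (\<forall>a \<in> carrier (Rep_z t (upper F)). \<pi> a = fold_laurent F (t_char t (upper F) a))"
    unfolding K_minus_eq_corner_ring
  proof (intro bexI conjI ballI)
    show "?\<pi> ` carrier (Rep_z t (upper F)) = carrier (corner_ring (lower F))"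
      unfolding image_comp[symmetric] onto by (rule fold_laurent_image[OF F])
    show "?\<pi> \<in> Ring.ring_hom (Rep_z t (upper F)) (corner_ring (lower F))"
      by (rule ring_hom_trans[OF hom fold])
  qed simp
qed

end
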